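(* Let $(E,\mathcal{E})$ be a measurable space and let $(\eta_l)_{l\ge 0}$, $(G_l)_{l\ge 0}$, $(M_l)_{l\ge 1}$, $Z_l$ and the particle system be as described in the context. Assume (A1) and (A2). Then there exist constants $C<+\infty$ and $\kappa\in(0,1)$, not depending on $L$ or on the particle numbers, such that for every $L\ge 1$, every choice of integers $N_0\ge N_1\ge\cdots\ge N_{L-1}\ge 1$ and every $g\in\mathcal{B}_b(E)$ with $\|g\|_\infty=1$, the estimator $$\widehat{Y}=\eta_0^{N_0}(g)+\sum_{l=1}^{L}\Big\{\frac{\eta_{l-1}^{N_{l-1}}(gG_{l-1})}{\eta_{l-1}^{N_{l-1}}(G_{l-1})}-\eta_{l-1}^{N_{l-1}}(g)\Big\}$$ satisfies \begin{align*} \mathbb{E}\big[\{\widehat{Y}-\eta_L(g)\}^2\big] \le C\bigg(&\frac{1}{N_0}+\sum_{l=1}^{L}\frac{\|\tfrac{Z_{l-1}}{Z_l}G_{l-1}-1\|_\infty^2}{N_{l-1}}\\ &+\sum_{1\le l<q\le L}\|\tfrac{Z_{l-1}}{Z_l}G_{l-1}-1\|_\infty\,\|\tfrac{Z_{q-1}}{Z_q}G_{q-1}-1\|_\infty\Big\{\frac{\kappa^{q-l}}{N_{l-1}}+\frac{1}{N_{l-1}^{1/2}N_{q-1}}\Big\}\bigg). \end{align*}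
   Context: $(E,\mathcal{E})$ is a measurable space with a finite dominating measure $du$. For $l\ge0$, $\gamma_l:E\to(0,\infty)$ is measurable with $Z_l=\int_E\gamma_l(u)\,du\in(0,\infty)$, and $\eta_l(du)=\gamma_l(u)du/Z_l$ is a probability measure. Set $G_l=\gamma_{l+1}/\gamma_l$ for $l\ge0$. For $l\ge1$, $M_l$ is a Markov kernel on $E$ with $\eta_lM_l=\eta_l$. Notation: $\mathcal{B}_b(E)$ is the set of bounded measurable real functions, $\|f\|_\infty=\sup_u|f(u)|$, $\mu(f)=\int f\,d\mu$, $M_lf(u)=\int f(v)M_l(u,dv)$. Particle system: given integers $N_0\ge N_1\ge\cdots$, the particles $U_0^1,\dots,U_0^{N_0}$ are i.i.d. with law $\eta_0$; for $l\ge1$, conditionally on all particles at levels $0,\dots,l-1$, the particles $U_l^1,\dots,U_l^{N_l}$ are i.i.d. with law $\sum_{i=1}^{N_{l-1}}G_{l-1}(U_{l-1}^i)M_l(U_{l-1}^i,\cdot)\big/\sum_{i=1}^{N_{l-1}}G_{l-1}(U_{l-1}^i)$ (resampling by weights $G_{l-1}$ followed by an $M_l$ move). $\eta_l^{N_l}=\frac1{N_l}\sum_{i=1}^{N_l}\delta_{U_l^i}$ is the empirical measure, so $\eta_l^{N_l}(\varphi)=\frac1{N_l}\sum_i\varphi(U_l^i)$. Expectations are with respect to the law of this particle system. (A1): there exist $0<\underline{C}<\overline{C}<\infty$ with $\underline C\le G_l(u)\le\overline C$ for all $l\ge1$, $u\in E$. (A2): there exists $\rho\in(0,1)$ with $M_l(u,A)\ge\rho\,M_l(v,A)$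 for all $l\ge1$, $u,v\in E$, $A\in\mathcal{E}$. *)

theory Defs
  imports "HOL-Probability.Probability"
begin

definition Zc :: "'a measure \<Rightarrow> (nat \<Rightarrow> 'a \<Rightarrow> real) \<Rightarrow> nat \<Rightarrow> real" where
  "Zc mu \<gamma> l = (\<integral>u. \<gamma> l u \<partial>mu)"

definition eta :: "'a measure \<Rightarrow> (nat \<Rightarrow> 'a \<Rightarrow> real) \<Rightarrow> nat \<Rightarrow> 'a measure" where
  "eta mu \<gamma> l = density mu (\<lambda>u. ennreal (\<gamma> l u / Zc mu \<gamma> l))"

definition Gw :: "(nat \<Rightarrow> 'a \<Rightarrow> real) \<Rightarrow> nat \<Rightarrow> 'a \<Rightarrow> real" where
  "Gw \<gamma> l u = \<gamma> (Suc l) u / \<gamma> l u"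

definition supnorm :: "'a measure \<Rightarrow> ('a \<Rightarrow> real) \<Rightarrow> ennreal" where
  "supnorm mu f = (SUP u\<in>space mu. ennreal \<bar>f u\<bar>)"

definition selmove :: "'a measure \<Rightarrow> ('a \<Rightarrow> real) \<Rightarrow> ('a \<Rightarrow> 'a measure) \<Rightarrow> nat \<Rightarrow> (nat \<Rightarrow> 'a) \<Rightarrow> 'a measure" where
  "selmove mu G K n x = measure_of (space mu) (sets mu)
     (\<lambda>A. (\<Sum>i<n. ennreal (G (x i)) * emeasure (K (x i)) A) * ennreal (1 / (\<Sum>i<n. G (x i))))"

text \<open>Measurable space of the particles at levels 0..k: U l i is particle i at level l.\<close>
definition levels_space :: "'a measure \<Rightarrow> (nat \<Rightarrow> nat) \<Rightarrow> nat \<Rightarrow> (nat \<Rightarrow> nat \<Rightarrow> 'a) measure" where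
  "levels_space mu N k = (\<Pi>\<^sub>M l\<in>{..k}. \<Pi>\<^sub>M i\<in>{..<N l}. mu)"

fun particle_law :: "'a measure \<Rightarrow> (nat \<Rightarrow> 'a \<Rightarrow> real) \<Rightarrow> (nat \<Rightarrow> 'a \<Rightarrow> 'a measure)
    \<Rightarrow> (nat \<Rightarrow> nat) \<Rightarrow> nat \<Rightarrow> (nat \<Rightarrow> nat \<Rightarrow> 'a) measure" where
  "particle_law mu \<gamma> M N 0 =
     distr (\<Pi>\<^sub>M i\<in>{..<N 0}. eta mu \<gamma> 0) (levels_space mu N 0) (\<lambda>x. (\<lambda>l. undefined)(0 := x))"
| "particle_law mu \<gamma> M N (Suc k) =
     particle_law mu \<gamma> M N k \<bind>
       (\<lambda>U. distr (\<Pi>\<^sub>M i\<in>{..<N (Suc k)}. selmove mu (Gw \<gamma> k) (M (Suc k)) (N k) (U k))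
                   (levels_space mu N (Suc k)) (\<lambda>V. U(Suc k := V)))"

definition emp :: "(nat \<Rightarrow> nat) \<Rightarrow> (nat \<Rightarrow> nat \<Rightarrow> 'a) \<Rightarrow> nat \<Rightarrow> ('a \<Rightarrow> real) \<Rightarrow> real" where
  "emp N U l \<phi> = (\<Sum>i<N l. \<phi> (U l i)) / real (N l)"

definition Yhat :: "(nat \<Rightarrow> 'a \<Rightarrow> real) \<Rightarrow> (nat \<Rightarrow> nat) \<Rightarrow> nat \<Rightarrow> ('a \<Rightarrow> real) \<Rightarrow> (nat \<Rightarrow> nat \<Rightarrow> 'a) \<Rightarrow> real" where
  "Yhat \<gamma> N L g U = emp N U 0 g +
     (\<Sum>l\<in>{1..L}. emp N U (l - 1) (\<lambda>u. g u * Gw \<gamma> (l - 1) u) / emp N U (l - 1) (Gw \<gamma> (l - 1))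
                  - emp N U (l - 1) g)"

end

theory Submission
  imports Defs
begin

text \<open>
  Write \<open>W\<^sub>l = Z\<^sub>l/Z\<^sub>l\<^sub>+\<^sub>1 G\<^sub>l\<close>, so that \<open>\<eta>\<^sub>l(W\<^sub>l) = 1\<close>. The error of the estimator is the initial sampling error
  plus a sum of increments \<open>\<Delta>\<^sub>p\<close>, each of which is a linear term
  \<open>(\<eta>\<^sub>p\<^sup>N - \<eta>\<^sub>p)((g - \<eta>\<^sub>p\<^sub>+\<^sub>1(g)) (W\<^sub>p - 1))\<close> minus the product of \<open>\<eta>\<^sub>p\<^sup>N(W\<^sub>p - 1)\<close> with another centred
  fluctuation. Backward iterates \<open>Q\<close> of the kernels \<open>W\<^sub>s M\<^sub>s\<^sub>+\<^sub>1\<close> make the ratios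
  \<open>D\<^sub>s = \<eta>\<^sub>s\<^sup>N(Q f)/\<eta>\<^sub>s\<^sup>N(Q 1)\<close> telescope: given the levels below \<open>s\<close>, the particles at level \<open>s\<close> are i.i.d. from a law
  whose own ratio is exactly \<open>D\<^sub>s\<^sub>-\<^sub>1\<close>, so \<open>D\<^sub>s - D\<^sub>s\<^sub>-\<^sub>1\<close> has \<open>L\<^sup>4\<close> norm \<open>O(N\<^sub>s\<^sup>-\<^sup>1\<^sup>/\<^sup>2)\<close> but conditional mean only
  \<open>O(1/N\<^sub>s)\<close>, both damped geometrically by the mixing condition. Summing in \<open>L\<^sup>4\<close> bounds every increment; summing
  the conditional means of the linear term of \<open>\<Delta>\<^sub>q\<close> down to level \<open>p\<close> bounds the covariances of \<open>\<Delta>\<^sub>p\<close> and \<open>\<Delta>\<^sub>q\<close>.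
  Hypothesis (A1) is silent about \<open>G\<^sub>0\<close>: either \<open>W\<^sub>0 - 1\<close> is unbounded and the right-hand side is infinite,
  or \<open>W\<^sub>0\<close> is bounded above, which suffices.
\<close>

section \<open>Bounded functions and fourth moments\<close>

text \<open>The obstacle is the off-diagonal part of the squared error. Cauchy-Schwarz on
  \<open>\<Delta> p\<close> and \<open>\<Delta> q\<close> would only give
  \<open>1 / sqrt (N p * N q)\<close>. The linear term of \<open>\<Delta> q\<close> is therefore
  handled through its conditional means: what is visible at level \<open>p\<close> has decayed by
  \<open>\<kappa> ^ (q - p)\<close>, and each later level \<open>s\<close> adds a damped sampling
  bias of order \<open>1 / N s\<close>, at most \<open>1 / N q\<close> because particle numbers do
  not increase. The quadratic term of \<open>\<Delta> q\<close> is already of order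
  \<open>1 / N q\<close>, but times \<open>\<Delta> p\<close> it is a product of three fluctuations;
  putting two of them in \<open>L^4\<close> and their product in \<open>L^2\<close> is why fourth
  moments are controlled throughout. Using \<open>W\<close> instead of \<open>G\<close> keeps the
  mean of \<open>Q1\<close> equal to one, so no constant grows with the level. The lower bound on
  the weights makes \<open>Q1\<close> comparable between points from level 1 on, where the
  populations come from resampling; at level 0 the weight either cancels in a ratio or the ratio is
  bounded pathwise.\<close>

definition bmf :: "'a measure \<Rightarrow> ('a \<Rightarrow> real) set" where
  "bmf M = {f \<in> borel_measurable M. \<exists>B. \<forall>x\<in>space M. \<bar>f x\<bar> \<le> B}"

lemma bmfI: "f \<in> borel_measurable M \<Longrightarrow> (\<And>x. x \<in> space M \<Longrightarrow> \<bar>f x\<bar> \<le> B) \<Longrightarrow> f \<in> bmf M"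
  unfolding bmf_def by blast

lemma bmfD1 [measurable_dest]: "f \<in> bmf M \<Longrightarrow> f \<in> borel_measurable M"
  unfolding bmf_def by simp

lemma bmf_bound:
  assumes "f \<in> bmf M"
  obtains B where "B > 0" "\<And>x. x \<in> space M \<Longrightarrow> \<bar>f x\<bar> \<le> B"
proof -
  obtain B where "\<And>x. x \<in> space M \<Longrightarrow> \<bar>f x\<bar> \<le> B" using assms unfolding bmf_def by blast
  then show thesis using that[of "max B 1"] by (meson less_max_iff_disj max.coboundedI1 zero_less_one)
qed

lemma bmf_const [simp, intro!]: "(\<lambda>_. c) \<in> bmf M"
  by (rule bmfI[where B="\<bar>c\<bar>"]) auto

lemma bmf_add [simp, intro!]:
  assumes "f \<in> bmf M" "g \<in> bmf M" shows "(\<lambda>x. f x + g x) \<in> bmf M"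
proof -
  obtain A where A: "\<And>x. x \<in> space M \<Longrightarrow> \<bar>f x\<bar> \<le> A" using bmf_bound[OF assms(1)] by metis
  obtain B where B: "\<And>x. x \<in> space M \<Longrightarrow> \<bar>g x\<bar> \<le> B" using bmf_bound[OF assms(2)] by metis
  show ?thesis
  proof (rule bmfI[where B="A+B"])
    show "(\<lambda>x. f x + g x) \<in> borel_measurable M" using assms by measurable
    show "\<bar>f x + g x\<bar> \<le> A + B" if "x \<in> space M" for x using A[OF that] B[OF that] by linarith
  qed
qed

lemma bmf_mult [simp, intro!]:
  assumes "f \<in> bmf M" "g \<in> bmf M" shows "(\<lambda>x. f x * g x) \<in> bmf M"
proof -
  obtain A where A: "A > 0" "\<And>x. x \<in> space M \<Longrightarrow> \<bar>f x\<bar> \<le> A" using bmf_bound[OF assms(1)] by metis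
  obtain B where B: "\<And>x. x \<in> space M \<Longrightarrow> \<bar>g x\<bar> \<le> B" using bmf_bound[OF assms(2)] by metis
  show ?thesis
  proof (rule bmfI[where B="A*B"])
    show "(\<lambda>x. f x * g x) \<in> borel_measurable M" using assms by measurable
    show "\<bar>f x * g x\<bar> \<le> A * B" if "x \<in> space M" for x
      unfolding abs_mult using A(1) A(2)[OF that] B[OF that] by (intro mult_mono) auto
  qed
qed

lemma bmf_uminus [simp, intro!]: "f \<in> bmf M \<Longrightarrow> (\<lambda>x. - f x) \<in> bmf M"
  using bmf_mult[of "\<lambda>_. -1" M f] by simp

lemma bmf_diff [simp, intro!]: "f \<in> bmf M \<Longrightarrow> g \<in> bmf M \<Longrightarrow> (\<lambda>x. f x - g x) \<in> bmf M"
  using bmf_add[of f M "\<lambda>x. - g x"] by auto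

lemma bmf_divide_const [simp, intro!]: "f \<in> bmf M \<Longrightarrow> (\<lambda>x. f x / c) \<in> bmf M"
  using bmf_mult[of f M "\<lambda>_. 1 / c"] by simp

lemma bmf_power [simp, intro!]: "f \<in> bmf M \<Longrightarrow> (\<lambda>x. f x ^ n) \<in> bmf M"
  by (induction n) auto

lemma bmf_abs [simp, intro!]: "f \<in> bmf M \<Longrightarrow> (\<lambda>x. \<bar>f x\<bar>) \<in> bmf M"
  unfolding bmf_def by auto

lemma bmf_sum [simp, intro!]: "(\<And>i. i \<in> I \<Longrightarrow> f i \<in> bmf M) \<Longrightarrow> (\<lambda>x. \<Sum>i\<in>I. f i x) \<in> bmf M"
  by (induction I rule: infinite_finite_induct) auto

lemma (in finite_measure) bmf_integrable [simp, intro]: "f \<in> bmf M \<Longrightarrow> integrable M f"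
  by (metis bmf_bound bmfD1 integrable_const_bound AE_I2 real_norm_def)

context prob_space
begin

lemma integral_le_bound:
  assumes "f \<in> bmf M" "\<And>x. x \<in> space M \<Longrightarrow> f x \<le> c"
  shows "(\<integral>x. f x \<partial>M) \<le> c"
  by (rule integral_le_const) (use assms in \<open>auto simp: AE_I2\<close>)

lemma integral_ge_bound:
  assumes "f \<in> bmf M" "\<And>x. x \<in> space M \<Longrightarrow> c \<le> f x"
  shows "c \<le> (\<integral>x. f x \<partial>M)"
  by (rule integral_ge_const) (use assms in \<open>auto simp: AE_I2\<close>)

lemma integral_abs_le_bound:
  assumes "f \<in> bmf M" "\<And>x. x \<in> space M \<Longrightarrow> \<bar>f x\<bar> \<le> c"
  shows "\<bar>\<integral>x. f x \<partial>M\<bar> \<le> c"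
  using integral_le_bound[OF assms(1), of c] integral_ge_bound[OF assms(1), of "-c"] assms(2)
  by (simp add: abs_le_iff minus_le_iff)

text \<open>The quadratic in \<open>t\<close> given by the expectation of
  \<open>(t * X - Y)^2\<close> is nonnegative, so its discriminant is not positive. A vanishing
  leading coefficient is treated separately.\<close>

lemma expectation_Cauchy_Schwarz:
  assumes [intro]: "X \<in> bmf M" "Y \<in> bmf M"
  shows "(expectation (\<lambda>x. X x * Y x))\<^sup>2 \<le> expectation (\<lambda>x. (X x)\<^sup>2) * expectation (\<lambda>x. (Y x)\<^sup>2)"
proof -
  define a b c where "a = expectation (\<lambda>x. (X x)\<^sup>2)" and "b = expectation (\<lambda>x. X x * Y x)"
    and "c = expectation (\<lambda>x. (Y x)\<^sup>2)"
  have q: "0 \<le> t\<^sup>2 * a - 2 * t * b + c" for t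
  proof -
    have "0 \<le> expectation (\<lambda>x. (t * X x - Y x)\<^sup>2)" by (intro integral_nonneg_AE) auto
    also have "(\<lambda>x. (t * X x - Y x)\<^sup>2) = (\<lambda>x. t\<^sup>2 * (X x)\<^sup>2 - 2 * t * (X x * Y x) + (Y x)\<^sup>2)"
      by (auto simp: power2_eq_square algebra_simps)
    also have "expectation \<dots> = t\<^sup>2 * a - 2 * t * b + c"
    proof (rule has_bochner_integral_integral_eq)
      have "integrable M (\<lambda>x. (X x)\<^sup>2)" "integrable M (\<lambda>x. (Y x)\<^sup>2)" "integrable M (\<lambda>x. X x * Y x)"
        by (rule bmf_integrable; auto)+
      then show "has_bochner_integral M (\<lambda>x. t\<^sup>2 * (X x)\<^sup>2 - 2 * t * (X x * Y x) + (Y x)\<^sup>2) (t\<^sup>2 * a - 2 * t * b + c)"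
        unfolding a_def b_def c_def
        by (intro has_bochner_integral_add has_bochner_integral_diff has_bochner_integral_mult_right
          has_bochner_integral_integrable)
    qed
    finally show ?thesis .
  qed
  have a0: "a \<ge> 0" unfolding a_def by (intro integral_nonneg_AE) auto
  have "b\<^sup>2 \<le> a * c"
  proof (cases "a = 0")
    case True
    have "b = 0"
    proof (rule ccontr)
      assume b: "b \<noteq> 0"
      \<comment> \<open>With \<open>a = 0\<close> the quadratic is affine, and this \<open>t\<close>
        is chosen to give it the value \<open>-1\<close>.\<close>
      have "0 \<le> ((c + 1) / (2 * b))\<^sup>2 * a - 2 * ((c + 1) / (2 * b)) * b + c" by (rule q)
      also have "\<dots> = -1" unfolding True using b by (simp add: field_simps)
      finally show False by simp
    qed
    then show ?thesis using True by simp
  next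
    case False
    then have "a > 0" using a0 by simp
    \<comment> \<open>The minimiser of the quadratic is \<open>t = b / a\<close>.\<close>
    have "0 \<le> (b/a)\<^sup>2 * a - 2 * (b/a) * b + c" by (rule q)
    also have "\<dots> = c - b\<^sup>2 / a" using \<open>a > 0\<close> by (simp add: power2_eq_square field_simps)
    finally show ?thesis using \<open>a > 0\<close> by (simp add: field_simps)
  qed
  then show ?thesis unfolding a_def b_def c_def .
qed

lemma expectation_abs_mult_le:
  assumes XY: "X \<in> bmf M" "Y \<in> bmf M"
    and "expectation (\<lambda>x. (X x)\<^sup>2) \<le> a\<^sup>2" "expectation (\<lambda>x. (Y x)\<^sup>2) \<le> b\<^sup>2" "a \<ge> 0" "b \<ge> 0"
  shows "expectation (\<lambda>x. \<bar>X x * Y x\<bar>) \<le> a * b"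
proof -
  have "(expectation (\<lambda>x. \<bar>X x\<bar> * \<bar>Y x\<bar>))\<^sup>2
      \<le> expectation (\<lambda>x. \<bar>X x\<bar>\<^sup>2) * expectation (\<lambda>x. \<bar>Y x\<bar>\<^sup>2)"
    by (intro expectation_Cauchy_Schwarz bmf_abs XY)
  then have "(expectation (\<lambda>x. \<bar>X x * Y x\<bar>))\<^sup>2 \<le> expectation (\<lambda>x. (X x)\<^sup>2) * expectation (\<lambda>x. (Y x)\<^sup>2)"
    by (simp only: abs_mult power2_abs)
  moreover have "expectation (\<lambda>x. (X x)\<^sup>2) * expectation (\<lambda>x. (Y x)\<^sup>2) \<le> a\<^sup>2 * b\<^sup>2"
    by (rule mult_mono[OF assms(3,4)]) simp_all
  ultimately have "(expectation (\<lambda>x. \<bar>X x * Y x\<bar>))\<^sup>2 \<le> (a * b)\<^sup>2"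
    unfolding power_mult_distrib by (rule order_trans)
  then show ?thesis by (rule power2_le_imp_le) (simp add: assms(5,6))
qed

text \<open>The number \<open>a\<close> is an upper bound for the \<open>L^4\<close> norm of
  \<open>X\<close>. Keeping it as an argument lets the closure rules below act as a calculus of
  norms without extracting roots, and membership in \<open>bmf\<close> settles
  integrability.\<close>

definition L4 :: "('a \<Rightarrow> real) \<Rightarrow> real \<Rightarrow> bool" where
  "L4 X a \<longleftrightarrow> X \<in> bmf M \<and> 0 \<le> a \<and> expectation (\<lambda>x. X x ^ 4) \<le> a ^ 4"

lemma L4_bmf: "L4 X a \<Longrightarrow> X \<in> bmf M" and L4_nonneg: "L4 X a \<Longrightarrow> 0 \<le> a"
  by (auto simp: L4_def)

lemma L4_imp_L2: "L4 X a \<Longrightarrow> expectation (\<lambda>x. (X x)\<^sup>2) \<le> a\<^sup>2"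
proof -
  assume L: "L4 X a"
  then have [intro]: "X \<in> bmf M" and a: "0 \<le> a" and e: "expectation (\<lambda>x. X x ^ 4) \<le> a ^ 4" by (auto simp: L4_def)
  have "expectation (\<lambda>x. \<bar>(X x)\<^sup>2 * 1\<bar>) \<le> a\<^sup>2 * 1"
    by (rule expectation_abs_mult_le) (use a e in \<open>auto simp: prob_space power_mult[symmetric]\<close>)
  then show ?thesis by simp
qed

lemma L4_mult: "L4 X a \<Longrightarrow> L4 Y b \<Longrightarrow> expectation (\<lambda>x. \<bar>X x * Y x\<bar>) \<le> a * b"
  by (intro expectation_abs_mult_le L4_imp_L2 L4_bmf L4_nonneg)

lemma L4_mult_L2: "L4 X a \<Longrightarrow> L4 Y b \<Longrightarrow> expectation (\<lambda>x. (X x * Y x)\<^sup>2) \<le> (a * b)\<^sup>2"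
proof -
  assume L: "L4 X a" "L4 Y b"
  then have [intro]: "X \<in> bmf M" "Y \<in> bmf M" by (auto simp: L4_def)
  have "expectation (\<lambda>x. \<bar>(X x)\<^sup>2 * (Y x)\<^sup>2\<bar>) \<le> a\<^sup>2 * b\<^sup>2"
    by (rule expectation_abs_mult_le) (use L in \<open>auto simp: L4_def power_mult[symmetric]\<close>)
  then show ?thesis by (simp add: power_mult_distrib)
qed

text \<open>Hoelder with exponents 2, 4, 4: the product of the last two factors is bounded in
  \<open>L^2\<close> by their fourth moments.\<close>

lemma L4_mult3: "L4 X a \<Longrightarrow> L4 Y b \<Longrightarrow> L4 Z c \<Longrightarrow> expectation (\<lambda>x. \<bar>X x * (Y x * Z x)\<bar>) \<le> a * (b * c)"
  by (intro expectation_abs_mult_le L4_imp_L2 L4_mult_L2) (auto simp: L4_def)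

lemma L4_abs: "L4 X a \<Longrightarrow> expectation (\<lambda>x. \<bar>X x\<bar>) \<le> a"
  using L4_mult[of X a "\<lambda>_. 1" 1] by (simp add: L4_def prob_space)

lemma L4_mono:
  assumes "L4 Y b" "X \<in> bmf M" "\<And>x. x \<in> space M \<Longrightarrow> \<bar>X x\<bar> \<le> \<bar>Y x\<bar>" "b \<le> c"
  shows "L4 X c"
proof -
  have "expectation (\<lambda>x. X x ^ 4) \<le> expectation (\<lambda>x. Y x ^ 4)"
  proof (rule integral_mono)
    show "X x ^ 4 \<le> Y x ^ 4" if "x \<in> space M" for x
      using power_mono[OF assms(3)[OF that], of 4] by (simp add: power_even_abs)
  qed (use assms in \<open>auto dest: L4_bmf\<close>)
  also have "\<dots> \<le> c ^ 4" using assms(1,4) power_mono[of b c 4] unfolding L4_def by linarith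
  finally show ?thesis using assms by (auto simp: L4_def)
qed

lemma L4_cmult: "L4 X a \<Longrightarrow> L4 (\<lambda>x. c * X x) (\<bar>c\<bar> * a)"
  unfolding L4_def by (auto simp: power_mult_distrib power_even_abs mult_left_mono)

lemma L4_const: "\<bar>c\<bar> \<le> a \<Longrightarrow> L4 (\<lambda>x. c) a"
  unfolding L4_def using power_mono[of "\<bar>c\<bar>" a 4] by (auto simp: prob_space power_even_abs)

text \<open>The binomial expansion of the fourth power is bounded termwise with the Cauchy--Schwarz
  inequality, writing \<open>X\<^sup>3 Y\<close> as \<open>X\<^sup>2 (X Y)\<close>.\<close>

lemma L4_add:
  assumes X: "L4 X a" and Y: "L4 Y b"
  shows "L4 (\<lambda>x. X x + Y x) (a + b)"
proof -
  have [intro]: "X \<in> bmf M" "Y \<in> bmf M" using X Y by (auto dest: L4_bmf)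
  have ab: "0 \<le> a" "0 \<le> b" using X Y by (auto dest: L4_nonneg)
  have X4: "expectation (\<lambda>x. X x^4) \<le> a^4" and Y4: "expectation (\<lambda>x. Y x^4) \<le> b^4"
    using X Y unfolding L4_def by blast+
  have le: "expectation f \<le> d" if "f \<in> bmf M" "expectation (\<lambda>x. \<bar>f x\<bar>) \<le> d" for f d
  proof -
    have "expectation f \<le> expectation (\<lambda>x. \<bar>f x\<bar>)" using that by (intro integral_mono) auto
    then show ?thesis using that(2) by linarith
  qed
  have 1: "expectation (\<lambda>x. (X x)\<^sup>2 * (X x * Y x)) \<le> a\<^sup>2 * (a * b)"
  proof (rule le)
    show "expectation (\<lambda>x. \<bar>(X x)\<^sup>2 * (X x * Y x)\<bar>) \<le> a\<^sup>2 * (a * b)"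
      using X Y ab by (intro expectation_abs_mult_le L4_mult_L2) (auto simp: L4_def power_mult[symmetric])
  qed auto
  have 2: "expectation (\<lambda>x. (X x)\<^sup>2 * (Y x)\<^sup>2) \<le> a\<^sup>2 * b\<^sup>2"
  proof (rule le)
    show "expectation (\<lambda>x. \<bar>(X x)\<^sup>2 * (Y x)\<^sup>2\<bar>) \<le> a\<^sup>2 * b\<^sup>2"
      using X Y ab by (intro expectation_abs_mult_le) (auto simp: L4_def power_mult[symmetric])
  qed auto
  have 3: "expectation (\<lambda>x. (Y x)\<^sup>2 * (X x * Y x)) \<le> b\<^sup>2 * (a * b)"
  proof (rule le)
    show "expectation (\<lambda>x. \<bar>(Y x)\<^sup>2 * (X x * Y x)\<bar>) \<le> b\<^sup>2 * (a * b)"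
      using X Y ab by (intro expectation_abs_mult_le L4_mult_L2) (auto simp: L4_def power_mult[symmetric])
  qed auto
  have e: "(x + y)^4 = x^4 + 4 * (x\<^sup>2 * (x * y)) + 6 * (x\<^sup>2 * y\<^sup>2) + 4 * (y\<^sup>2 * (x * y)) + y^4" for x y :: real
    by algebra
  have "expectation (\<lambda>x. (X x + Y x)^4) \<le> (a + b)^4"
  proof -
    have i1: "integrable M (\<lambda>x. X x^4)" and i2: "integrable M (\<lambda>x. Y x^4)"
      and i3: "integrable M (\<lambda>x. (X x)\<^sup>2 * (X x * Y x))" and i4: "integrable M (\<lambda>x. (X x)\<^sup>2 * (Y x)\<^sup>2)"
      and i5: "integrable M (\<lambda>x. (Y x)\<^sup>2 * (X x * Y x))"
      by (rule bmf_integrable; auto)+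
    note h = has_bochner_integral_integrable
    have "has_bochner_integral M (\<lambda>x. (X x + Y x)^4) (expectation (\<lambda>x. X x^4)
      + 4 * expectation (\<lambda>x. (X x)\<^sup>2 * (X x * Y x)) + 6 * expectation (\<lambda>x. (X x)\<^sup>2 * (Y x)\<^sup>2)
      + 4 * expectation (\<lambda>x. (Y x)\<^sup>2 * (X x * Y x)) + expectation (\<lambda>x. Y x^4))"
      unfolding e
      by (intro has_bochner_integral_add has_bochner_integral_mult_right h[OF i1] h[OF i2] h[OF i3] h[OF i4] h[OF i5])
    then have "expectation (\<lambda>x. (X x + Y x)^4) = expectation (\<lambda>x. X x^4)
      + 4 * expectation (\<lambda>x. (X x)\<^sup>2 * (X x * Y x)) + 6 * expectation (\<lambda>x. (X x)\<^sup>2 * (Y x)\<^sup>2)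
      + 4 * expectation (\<lambda>x. (Y x)\<^sup>2 * (X x * Y x)) + expectation (\<lambda>x. Y x^4)" (is "_ = ?S")
      by (rule has_bochner_integral_integral_eq)
    moreover have "?S \<le> a^4 + 4 * (a\<^sup>2 * (a * b)) + 6 * (a\<^sup>2 * b\<^sup>2) + 4 * (b\<^sup>2 * (a * b)) + b^4"
      by (intro add_mono mult_left_mono 1 2 3 X4 Y4 zero_le_numeral)
    ultimately show ?thesis by (simp only: e[of a b])
  qed
  moreover have "(\<lambda>x. X x + Y x) \<in> bmf M" by (rule bmf_add) fact+
  ultimately show ?thesis using ab unfolding L4_def by simp
qed

lemma L4_diff:
  assumes "L4 X a" "L4 Y b"
  shows "L4 (\<lambda>x. X x - Y x) (a + b)"
proof -
  have "L4 (\<lambda>x. -1 * Y x) (\<bar>-1\<bar> * b)" by (rule L4_cmult) fact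
  then have "L4 (\<lambda>x. - Y x) b" by (simp only: mult_minus1 abs_minus_cancel abs_one mult_1)
  from L4_add[OF assms(1) this] show ?thesis by (simp only: diff_conv_add_uminus)
qed

end

section \<open>Two elementary finite sums\<close>

lemma geometric_sum_le:
  fixes x :: real
  assumes "0 \<le> x" "x < 1"
  shows "(\<Sum>i<n. x ^ i) \<le> 1 / (1 - x)"
proof -
  have "(\<Sum>i<n. x ^ i) = (1 - x ^ n) / (1 - x)" using assms by (simp add: sum_gp_strict)
  also have "\<dots> \<le> 1 / (1 - x)" using assms by (intro divide_right_mono) auto
  finally show ?thesis .
qed

lemma square_sum_split:
  fixes x :: "nat \<Rightarrow> real"
  shows "(\<Sum>p\<le>n. x p)\<^sup>2 = (\<Sum>p\<le>n. (x p)\<^sup>2) + 2 * (\<Sum>p\<le>n. \<Sum>q\<in>{p<..n}. x p * x q)"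
proof (induction n)
  case (Suc n)
  have "(\<Sum>q\<in>{p<..Suc n}. x p * x q) = (\<Sum>q\<in>{p<..n}. x p * x q) + x p * x (Suc n)" if "p \<le> n" for p
  proof -
    have "{p<..Suc n} = insert (Suc n) {p<..n}" using that by auto
    then show ?thesis by simp
  qed
  then have "(\<Sum>p\<le>n. \<Sum>q\<in>{p<..Suc n}. x p * x q) = (\<Sum>p\<le>n. (\<Sum>q\<in>{p<..n}. x p * x q) + x p * x (Suc n))"
    by (intro sum.cong) auto
  then have "(\<Sum>p\<le>n. \<Sum>q\<in>{p<..Suc n}. x p * x q)
    = (\<Sum>p\<le>n. \<Sum>q\<in>{p<..n}. x p * x q) + (\<Sum>p\<le>n. x p) * x (Suc n)"
    by (simp only: sum.distrib sum_distrib_right)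
  moreover have "(s + t)\<^sup>2 = s\<^sup>2 + t\<^sup>2 + 2 * (s * t)" for s t :: real
    by (simp add: power2_eq_square algebra_simps)
  ultimately show ?case using Suc by (simp add: distrib_left)
qed simp

section \<open>Empirical means and ratios of i.i.d. samples\<close>

lemma bmf_PiM_component [simp, intro]:
  assumes "\<phi> \<in> bmf M" "i \<in> I"
  shows "(\<lambda>x. \<phi> (x i)) \<in> bmf (\<Pi>\<^sub>M i\<in>I. M)"
proof -
  obtain B where "\<And>x. x \<in> space M \<Longrightarrow> \<bar>\<phi> x\<bar> \<le> B" using bmf_bound[OF assms(1)] by metis
  then show ?thesis
    using assms(2) measurable_compose[OF measurable_component_singleton bmfD1, OF assms(2,1)]
    by (intro bmfI[of _ _ B]) (auto simp: space_PiM)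
qed

lemma bmf_PiM_sum: "\<phi> \<in> bmf M \<Longrightarrow> (\<lambda>x. \<Sum>i<n. \<phi> (x i)) \<in> bmf (\<Pi>\<^sub>M i\<in>{..<n}. M)"
  by (rule bmf_sum) simp

context prob_space
begin

abbreviation iid :: "nat \<Rightarrow> (nat \<Rightarrow> 'a) measure" where
  "iid n \<equiv> (\<Pi>\<^sub>M i\<in>{..<n}. M)"

lemma prob_space_iid: "prob_space (iid n)"
  by (intro prob_space_PiM prob_space_axioms)

lemma integral_iid_Suc:
  fixes F :: "(nat \<Rightarrow> 'a) \<Rightarrow> real"
  assumes "F \<in> bmf (iid (Suc n))"
  shows "(\<integral>x. F x \<partial>iid (Suc n)) = (\<integral>x. (\<integral>y. F (x(n := y)) \<partial>M) \<partial>iid n)"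
proof -
  interpret product_sigma_finite "\<lambda>_::nat. M" by unfold_locales
  interpret I: prob_space "iid (Suc n)" by (rule prob_space_iid)
  show ?thesis
    using product_integral_insert[of "{..<n}" n F] I.bmf_integrable[OF assms]
    by (simp add: lessThan_Suc)
qed

text \<open>The last sample is integrated out first. Terms linear in it vanish, so the second moment
  grows by \<open>v 2\<close>, and the fourth by \<open>6 v 2\<close> times the second moment plus
  \<open>v 4\<close>; the \<open>v 3\<close> term dies because the sum itself has mean zero. The
  three claims feed each other and are proved by one induction.\<close>

lemma iid_centered_moments:
  assumes \<phi>: "\<phi> \<in> bmf M" and c: "\<And>x. x \<in> space M \<Longrightarrow> \<bar>\<phi> x\<bar> \<le> c" and z: "(\<integral>x. \<phi> x \<partial>M) = 0"
  defines "S \<equiv> \<lambda>n x. \<Sum>i<n. \<phi> (x i)"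
  shows "(\<integral>x. S n x \<partial>iid n) = 0 \<and> (\<integral>x. (S n x)^2 \<partial>iid n) \<le> c^2 * real n
    \<and> (\<integral>x. (S n x)^4 \<partial>iid n) \<le> 3 * c^4 * (real n)^2"
proof (induction n)
  case 0
  show ?case by (simp add: S_def)
next
  case (Suc n)
  interpret I: prob_space "iid n" by (rule prob_space_iid)
  define v where "v k = (\<integral>x. \<phi> x ^ k \<partial>M)" for k
  have ph [simp]: "(\<lambda>x. \<phi> x ^ k) \<in> bmf M" for k using \<phi> by simp
  have Sb: "S m \<in> bmf (iid m)" for m unfolding S_def using \<phi> by (rule bmf_PiM_sum)
  then have Sk: "(\<lambda>x. S m x ^ k) \<in> bmf (iid m)" for m k by (rule bmf_power)
  have hb: "has_bochner_integral M (\<lambda>x. \<phi> x ^ k) (v k)" for k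
    unfolding v_def by (rule has_bochner_integral_integrable) simp
  have hS: "has_bochner_integral (iid n) (\<lambda>x. S n x ^ k) (\<integral>x. S n x ^ k \<partial>iid n)" for k
    by (rule has_bochner_integral_integrable) (rule I.bmf_integrable[OF Sk])
  have hS1: "has_bochner_integral (iid n) (S n) (\<integral>x. S n x \<partial>iid n)"
    by (rule has_bochner_integral_integrable) (rule I.bmf_integrable[OF Sb])
  have hb1: "has_bochner_integral M \<phi> 0"
    using has_bochner_integral_integrable[OF bmf_integrable[OF \<phi>]] z by simp
  have vk: "\<bar>v k\<bar> \<le> c ^ k" for k
    unfolding v_def by (rule integral_abs_le_bound) (auto simp: power_abs intro!: power_mono c)
  have upd: "S (Suc n) (x(n := y)) = S n x + \<phi> y" for x y
    unfolding S_def by simp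

  have one: "(\<integral>x. S (Suc n) x \<partial>iid (Suc n)) = 0"
  proof -
    have "(\<integral>y. S n x + \<phi> y \<partial>M) = S n x" for x
      using \<phi> z by (subst Bochner_Integration.integral_add) (simp_all add: prob_space)
    then show ?thesis using Suc by (simp add: integral_iid_Suc[OF Sb] upd)
  qed

  have "(\<integral>y. (S n x + \<phi> y)^2 \<partial>M) = (S n x)^2 + v 2" for x
  proof (rule has_bochner_integral_integral_eq)
    \<comment> \<open>Constants are written as multiples of \<open>\<phi> y ^ 0\<close>, so that
      \<open>hb\<close> integrates them to multiples of \<open>v 0 = 1\<close>.\<close>
    have "has_bochner_integral M (\<lambda>y. (S n x)^2 * \<phi> y ^ 0 + 2 * S n x * \<phi> y + \<phi> y ^ 2) ((S n x)^2 * v 0 + 2 * S n x * 0 + v 2)"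
      by (intro has_bochner_integral_add has_bochner_integral_mult_right hb hb1)
    moreover have "v 0 = 1" by (simp add: v_def prob_space)
    ultimately show "has_bochner_integral M (\<lambda>y. (S n x + \<phi> y)^2) ((S n x)^2 + v 2)"
      by (simp add: power2_sum algebra_simps)
  qed
  then have "(\<integral>x. (S (Suc n) x)^2 \<partial>iid (Suc n)) = (\<integral>x. (S n x)^2 + v 2 \<partial>iid n)"
    using integral_iid_Suc[OF Sk[of "Suc n" 2]] by (simp add: upd)
  also have "\<dots> = (\<integral>x. (S n x)^2 \<partial>iid n) + v 2"
    using I.bmf_integrable[OF Sk] by (subst Bochner_Integration.integral_add) (simp_all add: I.prob_space)
  finally have two: "(\<integral>x. (S (Suc n) x)^2 \<partial>iid (Suc n)) \<le> c^2 * real (Suc n)"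
    using conjunct1[OF conjunct2[OF Suc]] vk[of 2] unfolding of_nat_Suc distrib_left abs_le_iff by linarith

  have "(\<integral>y. (S n x + \<phi> y)^4 \<partial>M) = (S n x)^4 + 6 * v 2 * (S n x)^2 + 4 * v 3 * S n x + v 4" for x
  proof (rule has_bochner_integral_integral_eq)
    have "has_bochner_integral M (\<lambda>y. (S n x)^4 * \<phi> y ^ 0 + 4 * (S n x)^3 * \<phi> y + 6 * (S n x)^2 * \<phi> y ^ 2 + 4 * S n x * \<phi> y ^ 3 + \<phi> y ^ 4)
       ((S n x)^4 * v 0 + 4 * (S n x)^3 * 0 + 6 * (S n x)^2 * v 2 + 4 * S n x * v 3 + v 4)"
      by (intro has_bochner_integral_add has_bochner_integral_mult_right hb hb1)
    moreover have "v 0 = 1" by (simp add: v_def prob_space)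
    moreover have "(s + t)^4 = s^4 * t^0 + 4 * s^3 * t + 6 * s^2 * t^2 + 4 * s * t^3 + t^4" for s t :: real
      by (simp, algebra)
    ultimately show "has_bochner_integral M (\<lambda>y. (S n x + \<phi> y)^4) ((S n x)^4 + 6 * v 2 * (S n x)^2 + 4 * v 3 * S n x + v 4)"
      by (simp add: mult.commute mult.left_commute)
  qed
  then have "(\<integral>x. (S (Suc n) x)^4 \<partial>iid (Suc n)) = (\<integral>x. (S n x)^4 + 6 * v 2 * (S n x)^2 + 4 * v 3 * S n x + v 4 * S n x ^ 0 \<partial>iid n)"
    using integral_iid_Suc[OF Sk[of "Suc n" 4]] by (simp add: upd)
  also have "\<dots> = (\<integral>x. (S n x)^4 \<partial>iid n) + 6 * v 2 * (\<integral>x. (S n x)^2 \<partial>iid n) + 4 * v 3 * (\<integral>x. S n x \<partial>iid n) + v 4 * (\<integral>x. S n x ^ 0 \<partial>iid n)"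
    by (rule has_bochner_integral_integral_eq)
       (intro has_bochner_integral_add has_bochner_integral_mult_right hS hS1)
  also have "\<dots> = (\<integral>x. (S n x)^4 \<partial>iid n) + 6 * (v 2 * (\<integral>x. (S n x)^2 \<partial>iid n)) + v 4"
    using Suc by (simp add: I.prob_space)
  also have "\<dots> \<le> 3 * c^4 * (real n)^2 + 6 * (c^2 * (c^2 * real n)) + c^4"
  proof -
    have "v 2 * (\<integral>x. (S n x)^2 \<partial>iid n) \<le> c^2 * (c^2 * real n)"
      using Suc vk[of 2] by (intro mult_mono) auto
    moreover have "v 4 \<le> c^4" using vk[of 4] by simp
    ultimately show ?thesis using Suc by linarith
  qed
  also have "\<dots> \<le> 3 * c^4 * (real (Suc n))^2"
  proof -
    \<comment> \<open>The mixed term with coefficient 6 dictates the factor 3: passing from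
      \<open>n\<close> to \<open>n + 1\<close> raises \<open>3 d n^2\<close> by
      \<open>6 d n + 3 d\<close>, with \<open>2 d\<close> to spare.\<close>
    have "3 * d * (real (Suc n))\<^sup>2 - (3 * d * (real n)^2 + 6 * (d * real n) + d) = 2 * d" for d
      by (simp add: power2_eq_square algebra_simps)
    moreover have "c^2 * (c^2 * real n) = c^4 * real n" by algebra
    moreover have "c^4 \<ge> 0" by simp
    ultimately show ?thesis by smt
  qed
  finally show ?case using one two by simp
qed

lemma iid_mean_L4_centered:
  assumes \<phi>: "\<phi> \<in> bmf M" and c: "\<And>x. x \<in> space M \<Longrightarrow> \<bar>\<phi> x\<bar> \<le> c" and z: "(\<integral>x. \<phi> x \<partial>M) = 0" and n: "n > 0"
  shows "prob_space.L4 (iid n) (\<lambda>x. (\<Sum>i<n. \<phi> (x i)) / real n) (2 * c / sqrt (real n))"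
proof -
  interpret I: prob_space "iid n" by (rule prob_space_iid)
  obtain x0 where "x0 \<in> space M" using not_empty by blast
  then have c0: "c \<ge> 0" using c[of x0] by linarith
  have 4: "(\<integral>x. (\<Sum>i<n. \<phi> (x i))^4 \<partial>iid n) \<le> 3 * c^4 * (real n)^2"
    using iid_centered_moments[OF \<phi> c z] by blast
  have "(\<integral>x. ((\<Sum>i<n. \<phi> (x i)) / real n)^4 \<partial>iid n) = (\<integral>x. (\<Sum>i<n. \<phi> (x i))^4 \<partial>iid n) / (real n)^4"
    by (simp add: power_divide)
  also have "\<dots> \<le> 3 * c^4 * (real n)^2 / (real n)^4" using 4 by (intro divide_right_mono) auto
  also have "\<dots> = 3 * (c^4 / (real n)^2)" using n by (simp add: field_simps eval_nat_numeral)
  \<comment> \<open>The factor 3 is rounded up to \<open>16 = 2^4\<close>, so that the bound is a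
    fourth power.\<close>
  also have "\<dots> \<le> 16 * (c^4 / (real n)^2)" by (intro mult_right_mono) auto
  also have "\<dots> = (2 * c / sqrt (real n))^4"
  proof -
    have "s ^ 4 = (s ^ 2) ^ 2" for s :: real by algebra
    from this[of "sqrt (real n)"] show ?thesis by (simp add: power_divide power_mult_distrib)
  qed
  finally show ?thesis unfolding I.L4_def using c0 \<phi> by (auto intro!: bmf_divide_const bmf_PiM_sum)
qed

lemma iid_mean_L4:
  assumes \<phi>: "\<phi> \<in> bmf M" and c: "\<And>x. x \<in> space M \<Longrightarrow> \<bar>\<phi> x\<bar> \<le> c" and n: "n > 0"
  shows "prob_space.L4 (iid n) (\<lambda>x. (\<Sum>i<n. \<phi> (x i)) / real n - (\<integral>y. \<phi> y \<partial>M)) (4 * c / sqrt (real n))"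
proof -
  \<comment> \<open>Centring at most doubles the bound on \<open>\<phi>\<close>, which turns
    \<open>2 * c\<close> into \<open>4 * c\<close>.\<close>
  have "prob_space.L4 (iid n) (\<lambda>x. (\<Sum>i<n. \<phi> (x i) - (\<integral>y. \<phi> y \<partial>M)) / real n) (2 * (2 * c) / sqrt (real n))"
  proof (rule iid_mean_L4_centered)
    show "\<bar>\<phi> x - (\<integral>y. \<phi> y \<partial>M)\<bar> \<le> 2 * c" if "x \<in> space M" for x
      using c[OF that] integral_abs_le_bound[OF \<phi> c] by linarith
    show "(\<integral>x. \<phi> x - (\<integral>y. \<phi> y \<partial>M) \<partial>M) = 0" using \<phi> by (simp add: prob_space)
  qed (use \<phi> n in auto)
  moreover have "(\<Sum>i<n. \<phi> (x i) - (\<integral>y. \<phi> y \<partial>M)) / real n = (\<Sum>i<n. \<phi> (x i)) / real n - (\<integral>y. \<phi> y \<partial>M)" for x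
    using n by (simp add: sum_subtractf field_simps)
  ultimately show ?thesis by simp
qed

end

text \<open>The quotient is the mean of the \<open>A i / B i\<close> with weights proportional to
  \<open>B i\<close>, so it stays within \<open>e\<close> of \<open>d\<close> when all of them
  do.\<close>

lemma weighted_ratio_deviation:
  fixes A B :: "nat \<Rightarrow> real"
  assumes "n > 0" "\<And>i. i < n \<Longrightarrow> B i > 0" "\<And>i. i < n \<Longrightarrow> \<bar>A i - d * B i\<bar> \<le> e * B i"
  shows "\<bar>(\<Sum>i<n. A i) / (\<Sum>i<n. B i) - d\<bar> \<le> e"
proof -
  have pos: "(\<Sum>i<n. B i) > 0" using assms by (intro sum_pos) auto
  have "\<bar>\<Sum>i<n. A i - d * B i\<bar> \<le> (\<Sum>i<n. e * B i)" using assms by (intro sum_abs[THEN order_trans] sum_mono) auto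
  then have "\<bar>(\<Sum>i<n. A i) - d * (\<Sum>i<n. B i)\<bar> \<le> e * (\<Sum>i<n. B i)"
    by (simp add: sum_subtractf sum_distrib_left)
  moreover have "(\<Sum>i<n. A i) / (\<Sum>i<n. B i) - d = ((\<Sum>i<n. A i) - d * (\<Sum>i<n. B i)) / (\<Sum>i<n. B i)"
    using pos by (simp add: field_simps)
  ultimately show ?thesis using pos by (simp add: abs_divide pos_divide_le_eq)
qed

section \<open>Size and bias of a self-normalised ratio\<close>

context prob_space
begin

text \<open>By the choice of \<open>d\<close>, the function \<open>A - d * B\<close> is centred, and
  \<open>D\<close> is its sample mean divided by that of \<open>B\<close>, which is at least
  \<open>1 / R\<close>. This gives the order \<open>1 / sqrt n\<close>. To first order
  \<open>D\<close> is a centred mean divided by a constant, so its expectation comes from the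
  second-order term alone and has order \<open>1 / n\<close>. Both bounds are proportional to
  \<open>e\<close>, which later carries the geometric damping.\<close>

lemma iid_ratio:
  fixes A B :: "'a \<Rightarrow> real"
  assumes A: "A \<in> bmf M" and B: "B \<in> bmf M" and R: "R \<ge> 1"
    and Bb: "\<And>x. x \<in> space M \<Longrightarrow> 1 / R \<le> B x \<and> B x \<le> R"
    and d: "d = (\<integral>x. A x \<partial>M) / (\<integral>x. B x \<partial>M)"
    and e: "\<And>x. x \<in> space M \<Longrightarrow> \<bar>A x - d * B x\<bar> \<le> e * B x" and n: "n > 0"
  defines "D \<equiv> \<lambda>x. (\<Sum>i<n. A (x i)) / (\<Sum>i<n. B (x i)) - d"
  shows "prob_space.L4 (iid n) D (2 * R\<^sup>2 * e / sqrt (real n))" (is ?L)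
    and "\<bar>\<integral>x. D x \<partial>iid n\<bar> \<le> 4 * R^4 * e / real n" (is ?E)
proof -
  interpret I: prob_space "iid n" by (rule prob_space_iid)
  have R1: "1 / R > 0" using R by simp
  have Bpos: "B x > 0" if "x \<in> space M" for x
    using Bb[OF that] R1 by linarith
  obtain x0 where x0: "x0 \<in> space M" using not_empty by blast
  then have "0 \<le> e * B x0" using e[OF x0] by linarith
  then have e0: "e \<ge> 0" using Bpos[OF x0] by (simp add: zero_le_mult_iff)
  define b where "b = (\<integral>x. B x \<partial>M)"
  have b: "1 / R \<le> b" "b \<le> R"
    unfolding b_def using B Bb by (auto intro!: integral_ge_bound integral_le_bound)
  then have b0: "b > 0" using R1 by linarith
  define \<phi> where "\<phi> x = A x - d * B x" for x
  have \<phi>: "\<phi> \<in> bmf M" unfolding \<phi>_def using A B by simp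
  have \<phi>0: "(\<integral>x. \<phi> x \<partial>M) = 0" unfolding \<phi>_def d using A B b0 by (simp add: b_def)
  have \<phi>b: "\<bar>\<phi> x\<bar> \<le> e * R" if "x \<in> space M" for x
    using e[OF that] Bb[OF that] mult_left_mono[of "B x" R e] e0 unfolding \<phi>_def by linarith
  define S where "S f x = (\<Sum>i<n. f (x i)) / real n" for f :: "'a \<Rightarrow> real" and x
  have Sbmf [simp]: "f \<in> bmf M \<Longrightarrow> S f \<in> bmf (iid n)" for f
    unfolding S_def using bmf_divide_const[OF bmf_PiM_sum] by blast
  have sp: "x i \<in> space M" if "x \<in> space (iid n)" "i < n" for x i
    using that by (auto simp: space_PiM)
  have SBge: "1 / R \<le> S B x" if "x \<in> space (iid n)" for x
  proof -
    have "real n * (1 / R) \<le> (\<Sum>i<n. B (x i))"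
      using sum_bounded_below[of "{..<n}" "1 / R" "\<lambda>i. B (x i)"] Bb sp[OF that] by simp
    then show ?thesis using n unfolding S_def by (simp add: pos_le_divide_eq mult.commute)
  qed
  have D_eq: "D x = S \<phi> x / S B x" if "x \<in> space (iid n)" for x
  proof -
    have "S B x > 0" using SBge[OF that] R1 by linarith
    then have "(\<Sum>i<n. B (x i)) \<noteq> 0" by (auto simp: S_def)
    then have "D x = ((\<Sum>i<n. A (x i)) - d * (\<Sum>i<n. B (x i))) / (\<Sum>i<n. B (x i))"
      unfolding D_def by (simp add: diff_divide_distrib)
    also have "(\<Sum>i<n. A (x i)) - d * (\<Sum>i<n. B (x i)) = (\<Sum>i<n. \<phi> (x i))"
      unfolding \<phi>_def by (simp add: sum_subtractf sum_distrib_left)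
    finally show ?thesis unfolding S_def using n by simp
  qed
  have inv: "1 / S B x \<le> R" "S B x > 0" if "x \<in> space (iid n)" for x
  proof -
    show p: "S B x > 0" using SBge[OF that] R1 by linarith
    have "1 / S B x \<le> 1 / (1 / R)" using SBge[OF that] R by (intro frac_le) auto
    then show "1 / S B x \<le> R" by simp
  qed
  have [measurable]: "A \<in> borel_measurable M" "B \<in> borel_measurable M" using A B by auto
  have Dbmf: "D \<in> bmf (iid n)"
  proof (rule bmfI[where B=e])
    show "D \<in> borel_measurable (iid n)" unfolding D_def by measurable
    show "\<bar>D x\<bar> \<le> e" if "x \<in> space (iid n)" for x
      unfolding D_def using e Bpos sp[OF that] n by (intro weighted_ratio_deviation) auto
  qed
  have LS: "I.L4 (S \<phi>) (2 * (e * R) / sqrt (real n))"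
    unfolding S_def by (rule iid_mean_L4_centered) (use \<phi> \<phi>b \<phi>0 n in auto)
  have "I.L4 (\<lambda>x. R * S \<phi> x) (\<bar>R\<bar> * (2 * (e * R) / sqrt (real n)))"
    by (rule I.L4_cmult[OF LS])
  then show ?L
  proof (rule I.L4_mono[OF _ Dbmf])
    show "\<bar>D x\<bar> \<le> \<bar>R * S \<phi> x\<bar>" if "x \<in> space (iid n)" for x
      using mult_right_mono[OF inv(1)[OF that], of "\<bar>S \<phi> x\<bar>"] inv(2)[OF that] R
      by (simp add: D_eq[OF that] abs_mult abs_divide)
    show "\<bar>R\<bar> * (2 * (e * R) / sqrt (real n)) \<le> 2 * R\<^sup>2 * e / sqrt (real n)"
      using R by (simp add: power2_eq_square ac_simps)
  qed
  define \<psi> where "\<psi> x = B x - b" for x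
  have \<psi>: "\<psi> \<in> bmf M" unfolding \<psi>_def using B by simp
  have L\<psi>: "I.L4 (S \<psi>) (2 * R / sqrt (real n))"
    unfolding S_def
  proof (rule iid_mean_L4_centered)
    show "\<bar>\<psi> x\<bar> \<le> R" if "x \<in> space M" for x
      using b Bb[OF that] R1 unfolding \<psi>_def by linarith
    show "(\<integral>x. \<psi> x \<partial>M) = 0" unfolding \<psi>_def b_def using B by (simp add: prob_space)
  qed (use \<psi> n in auto)
  have S\<psi>: "S \<psi> x = S B x - b" for x
    using n unfolding S_def \<psi>_def by (simp add: sum_subtractf field_simps)
  have ES: "(\<integral>x. S \<phi> x \<partial>iid n) = 0"
    using iid_centered_moments[OF \<phi> \<phi>b \<phi>0, of n] by (simp add: S_def)
  \<comment> \<open>Replacing the random denominator by its mean \<open>b\<close> leaves a term of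
    mean zero; \<open>V\<close> is the error made, equal to
    \<open>- S \<phi> x * S \<psi> x / (S B x * b)\<close>.\<close>
  define V where "V x = D x - S \<phi> x / b" for x
  have V: "V \<in> bmf (iid n)" unfolding V_def using Dbmf \<phi> by simp
  have "(\<integral>x. D x \<partial>iid n) = (\<integral>x. V x \<partial>iid n)"
    unfolding V_def using Dbmf \<phi> ES by simp
  moreover have "\<bar>\<integral>x. V x \<partial>iid n\<bar> \<le> (\<integral>x. \<bar>V x\<bar> \<partial>iid n)" by (rule integral_abs_bound)
  moreover have "(\<integral>x. \<bar>V x\<bar> \<partial>iid n) \<le> (\<integral>x. R\<^sup>2 * \<bar>S \<phi> x * S \<psi> x\<bar> \<partial>iid n)"
  proof (rule integral_mono)
    show "\<bar>V x\<bar> \<le> R\<^sup>2 * \<bar>S \<phi> x * S \<psi> x\<bar>" if "x \<in> space (iid n)" for x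
    proof -
      have p: "S B x > 0" by (rule inv) fact
      have "V x = - (1 / S B x * (1 / b)) * (S \<phi> x * S \<psi> x)"
        unfolding V_def D_eq[OF that] S\<psi> using p b0 by (simp add: field_simps)
      then have "\<bar>V x\<bar> = (1 / S B x * (1 / b)) * \<bar>S \<phi> x * S \<psi> x\<bar>"
        using p b0 by (simp add: abs_mult)
      moreover have "1 / b \<le> 1 / (1 / R)" using b R by (intro frac_le) auto
      then have "1 / S B x * (1 / b) \<le> R * R"
        using inv[OF that] b0 R by (intro mult_mono) auto
      then have "1 / S B x * (1 / b) * \<bar>S \<phi> x * S \<psi> x\<bar> \<le> R * R * \<bar>S \<phi> x * S \<psi> x\<bar>"
        by (rule mult_right_mono) simp
      ultimately show ?thesis by (simp only: power2_eq_square)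
    qed
  qed (use V \<phi> \<psi> in \<open>auto intro!: I.bmf_integrable\<close>)
  moreover have "(\<integral>x. R\<^sup>2 * \<bar>S \<phi> x * S \<psi> x\<bar> \<partial>iid n) \<le> R\<^sup>2 * ((2 * (e * R) / sqrt (real n)) * (2 * R / sqrt (real n)))"
    using mult_left_mono[OF I.L4_mult[OF LS L\<psi>], of "R\<^sup>2"] by (simp only: integral_mult_right_zero zero_le_power2)
  moreover have "R\<^sup>2 * ((2 * (e * R) / sqrt (real n)) * (2 * R / sqrt (real n))) = 4 * R^4 * e / real n"
    using n by (simp add: power2_eq_square eval_nat_numeral)
  ultimately show ?E by linarith
qed

end

section \<open>Probability kernels and the selection-mutation law\<close>

text \<open>Rectangles form an intersection-stable generator, and on a rectangle the product law is
  a finite product of measurable functions of \<open>x\<close>. This makes the law of a new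
  population a kernel in the old one.\<close>

lemma measurable_PiM_iid:
  assumes \<kappa> [measurable]: "\<kappa> \<in> M \<rightarrow>\<^sub>M prob_algebra N" and I: "finite I"
  shows "(\<lambda>x. \<Pi>\<^sub>M i\<in>I. \<kappa> x) \<in> M \<rightarrow>\<^sub>M prob_algebra (\<Pi>\<^sub>M i\<in>I. N)"
proof (rule measurable_prob_algebra_generated[OF sets_PiM Int_stable_prod_algebra prod_algebra_sets_into_space])
  fix a assume a: "a \<in> space M"
  then have p: "prob_space (\<kappa> a)" "sets (\<kappa> a) = sets N"
    using measurable_space[OF \<kappa>] by (auto simp: space_prob_algebra)
  show "prob_space (\<Pi>\<^sub>M i\<in>I. \<kappa> a)" by (intro prob_space_PiM p)
  show "sets (\<Pi>\<^sub>M i\<in>I. \<kappa> a) = sets (\<Pi>\<^sub>M i\<in>I. N)" by (intro sets_PiM_cong p refl)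
next
  fix A assume "A \<in> prod_algebra I (\<lambda>_. N)"
  then obtain X where X: "A = Pi\<^sub>E I X" "\<And>i. i \<in> I \<Longrightarrow> X i \<in> sets N"
    using I by (auto simp: prod_algebra_eq_finite)
  have "emeasure (\<Pi>\<^sub>M i\<in>I. \<kappa> a) A = (\<Prod>i\<in>I. emeasure (\<kappa> a) (X i))" if "a \<in> space M" for a
  proof -
    have p: "prob_space (\<kappa> a)" "sets (\<kappa> a) = sets N"
      using measurable_space[OF \<kappa> that] by (auto simp: space_prob_algebra)
    interpret prob_space "\<kappa> a" by (rule p)
    interpret product_sigma_finite "\<lambda>_. \<kappa> a" by unfold_locales
    show ?thesis unfolding X(1) using X(2) p(2) I by (intro emeasure_PiM) auto
  qed
  moreover have "(\<lambda>a. \<Prod>i\<in>I. emeasure (\<kappa> a) (X i)) \<in> borel_measurable M"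
    using X(2) by (intro borel_measurable_prod_ennreal measurable_compose[OF measurable_prob_algebraD[OF \<kappa>] measurable_emeasure_subprob_algebra])
  ultimately show "(\<lambda>a. emeasure (\<Pi>\<^sub>M i\<in>I. \<kappa> a) A) \<in> borel_measurable M"
    by (simp cong: measurable_cong)
qed

lemma prob_kernelD:
  assumes "K \<in> M \<rightarrow>\<^sub>M prob_algebra N" "x \<in> space M"
  shows "prob_space (K x)" "sets (K x) = sets N" "space (K x) = space N"
  using measurable_space[OF assms] by (auto simp: space_prob_algebra dest: sets_eq_imp_space_eq)

lemma bmf_cong_sets: "sets M = sets N \<Longrightarrow> bmf M = bmf N"
  unfolding bmf_def by (auto cong: measurable_cong_sets dest: sets_eq_imp_space_eq)

lemma bmf_kernel:
  assumes K: "K \<in> M \<rightarrow>\<^sub>M prob_algebra N" and f: "f \<in> bmf N"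
  shows "(\<lambda>x. \<integral>y. f y \<partial>K x) \<in> bmf M"
proof -
  obtain B where B: "\<And>x. x \<in> space N \<Longrightarrow> \<bar>f x\<bar> \<le> B" using bmf_bound[OF f] by metis
  show ?thesis
  proof (rule bmfI[of _ _ B])
    show "(\<lambda>x. \<integral>y. f y \<partial>K x) \<in> borel_measurable M"
      using measurable_compose[OF measurable_prob_algebraD[OF K] integral_measurable_subprob_algebra[OF bmfD1[OF f]]] .
    show "\<bar>\<integral>y. f y \<partial>K x\<bar> \<le> B" if "x \<in> space M" for x
    proof -
      note k = prob_kernelD[OF K that]
      interpret prob_space "K x" by (rule k)
      show ?thesis using f B bmf_cong_sets[OF k(2)] k(3) by (intro integral_abs_le_bound) auto
    qed
  qed
qed

lemma integral_bind_kernel: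
  assumes M: "prob_space M" and K: "K \<in> M \<rightarrow>\<^sub>M prob_algebra N" and f: "f \<in> bmf N"
  shows "(\<integral>y. f y \<partial>(M \<bind> K)) = (\<integral>x. (\<integral>y. f y \<partial>K x) \<partial>M)"
proof -
  interpret prob_space M by fact
  obtain B where B: "\<And>x. x \<in> space N \<Longrightarrow> \<bar>f x\<bar> \<le> B" using bmf_bound[OF f] by metis
  show ?thesis
  proof (rule integral_bind[where K=N and B=B and B'=1])
    show "AE x in M. emeasure (K x) (space (K x)) \<le> ennreal 1"
      using prob_kernelD(1)[OF K] by (intro AE_I2) (simp add: prob_space.emeasure_space_1)
  qed (use B f K measurable_prob_algebraD in \<open>auto intro: finite_measure_axioms\<close>)
qed

section \<open>The selection-mutation law as a mixture\<close>

context
  fixes mu :: "'a measure" and G :: "'a \<Rightarrow> real" and K :: "'a \<Rightarrow> 'a measure" and n :: nat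
  assumes G [measurable]: "G \<in> borel_measurable mu" and Gpos: "\<And>u. u \<in> space mu \<Longrightarrow> G u > 0"
    and K: "K \<in> mu \<rightarrow>\<^sub>M prob_algebra mu" and n: "n > 0"
begin

text \<open>Selecting an index with probability proportional to its weight and then moving from that
  particle gives the same law. Since \<open>selmove\<close> is built by \<open>measure_of\<close>,
  its set function gives the actual values only once it is known to be a measure; the mixture
  supplies this.\<close>

lemma selmove_bind:
  assumes x: "x \<in> space (\<Pi>\<^sub>M i\<in>{..<n}. mu)"
  defines "P \<equiv> point_measure {..<n} (\<lambda>i. ennreal (G (x i) / (\<Sum>i<n. G (x i))))"
  shows "selmove mu G K n x = P \<bind> (\<lambda>i. K (x i))" and "prob_space P"
    and "(\<lambda>i. K (x i)) \<in> P \<rightarrow>\<^sub>M prob_algebra mu"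
    and "A \<in> sets mu \<Longrightarrow> emeasure (selmove mu G K n x) A
      = (\<Sum>i<n. ennreal (G (x i)) * emeasure (K (x i)) A) * ennreal (1 / (\<Sum>i<n. G (x i)))"
proof -
  have xi: "x i \<in> space mu" if "i < n" for i using x that by (auto simp: space_PiM)
  have S: "(\<Sum>i<n. G (x i)) > 0" using n xi Gpos by (intro sum_pos) auto
  show P: "prob_space P"
  proof (rule prob_spaceI)
    have "(\<Sum>i<n. ennreal (G (x i) / (\<Sum>i<n. G (x i)))) = ennreal (\<Sum>i<n. G (x i) / (\<Sum>i<n. G (x i)))"
      using S xi Gpos by (intro sum_ennreal) (auto intro!: divide_nonneg_nonneg less_imp_le)
    also have "(\<Sum>i<n. G (x i) / (\<Sum>i<n. G (x i))) = 1" using S by (simp add: sum_divide_distrib[symmetric])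
    finally show "emeasure P (space P) = 1"
      unfolding P_def by (simp add: space_point_measure emeasure_point_measure_finite)
  qed
  show Km: "(\<lambda>i. K (x i)) \<in> P \<rightarrow>\<^sub>M prob_algebra mu"
    unfolding P_def using xi measurable_space[OF K] by (auto simp: measurable_point_measure_eq1)
  have ne: "space P \<noteq> {}" using P by (rule prob_space.not_empty)
  have sets: "sets (P \<bind> (\<lambda>i. K (x i))) = sets mu"
    using sets_bind_measurable[OF measurable_prob_algebraD[OF Km] ne] .
  have em: "(\<Sum>i<n. ennreal (G (x i)) * emeasure (K (x i)) A) * ennreal (1 / (\<Sum>i<n. G (x i)))
      = emeasure (P \<bind> (\<lambda>i. K (x i))) A" if A: "A \<in> sets mu" for A
  proof -
    have "emeasure (P \<bind> (\<lambda>i. K (x i))) A = (\<integral>\<^sup>+i. emeasure (K (x i)) A \<partial>P)"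
      by (rule emeasure_bind[OF ne measurable_prob_algebraD[OF Km] A])
    also have "\<dots> = (\<Sum>i<n. ennreal (G (x i) / (\<Sum>i<n. G (x i))) * emeasure (K (x i)) A)"
      unfolding P_def by (rule nn_integral_point_measure_finite) simp
    also have "\<dots> = (\<Sum>i<n. ennreal (G (x i)) * emeasure (K (x i)) A * ennreal (1 / (\<Sum>i<n. G (x i))))"
    proof (rule sum.cong[OF refl])
      fix i assume "i \<in> {..<n}"
      then have "ennreal (G (x i) / (\<Sum>i<n. G (x i))) = ennreal (G (x i)) * ennreal (1 / (\<Sum>i<n. G (x i)))"
        using S Gpos[OF xi[of i]] by (subst ennreal_mult[symmetric]) auto
      then show "ennreal (G (x i) / (\<Sum>i<n. G (x i))) * emeasure (K (x i)) A
        = ennreal (G (x i)) * emeasure (K (x i)) A * ennreal (1 / (\<Sum>i<n. G (x i)))"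
        by (simp add: ac_simps)
    qed
    finally show ?thesis by (simp add: sum_distrib_right)
  qed
  have "selmove mu G K n x = measure_of (space mu) (sets mu) (emeasure (P \<bind> (\<lambda>i. K (x i))))"
    unfolding selmove_def using em by (intro measure_of_eq) (auto simp: sets.space_closed sets.sigma_sets_eq)
  also have "\<dots> = P \<bind> (\<lambda>i. K (x i))"
    using measure_of_of_measure[of "P \<bind> (\<lambda>i. K (x i))"] sets sets_eq_imp_space_eq[OF sets] by simp
  finally show eq: "selmove mu G K n x = P \<bind> (\<lambda>i. K (x i))" .
  show "A \<in> sets mu \<Longrightarrow> emeasure (selmove mu G K n x) A
      = (\<Sum>i<n. ennreal (G (x i)) * emeasure (K (x i)) A) * ennreal (1 / (\<Sum>i<n. G (x i)))"
    unfolding eq by (rule em[symmetric])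
qed

lemma prob_space_selmove:
  assumes x: "x \<in> space (\<Pi>\<^sub>M i\<in>{..<n}. mu)"
  shows "prob_space (selmove mu G K n x)"
  using selmove_bind[OF x] by (auto intro!: prob_space_bind' simp: space_prob_algebra)

lemma sets_selmove [simp]: "sets (selmove mu G K n x) = sets mu"
  by (simp add: selmove_def)

lemma integral_selmove:
  assumes x: "x \<in> space (\<Pi>\<^sub>M i\<in>{..<n}. mu)" and f: "f \<in> bmf mu"
  shows "(\<integral>y. f y \<partial>selmove mu G K n x) = (\<Sum>i<n. G (x i) * (\<integral>y. f y \<partial>K (x i))) / (\<Sum>i<n. G (x i))"
proof -
  have xi: "x i \<in> space mu" if "i < n" for i using x that by (auto simp: space_PiM)
  have S: "(\<Sum>i<n. G (x i)) > 0" using n xi Gpos by (intro sum_pos) auto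
  note b = selmove_bind[OF x]
  have "(\<integral>y. f y \<partial>selmove mu G K n x) = (\<integral>i. (\<integral>y. f y \<partial>K (x i)) \<partial>point_measure {..<n} (\<lambda>i. ennreal (G (x i) / (\<Sum>i<n. G (x i)))))"
    unfolding b(1) by (rule integral_bind_kernel[OF b(2,3) f])
  also have "\<dots> = (\<Sum>i<n. (G (x i) / (\<Sum>i<n. G (x i))) *\<^sub>R (\<integral>y. f y \<partial>K (x i)))"
    using S xi Gpos by (intro lebesgue_integral_point_measure_finite) (auto intro!: divide_nonneg_nonneg less_imp_le)
  finally show ?thesis by (simp add: sum_divide_distrib)
qed

lemma measurable_selmove:
  "selmove mu G K n \<in> (\<Pi>\<^sub>M i\<in>{..<n}. mu) \<rightarrow>\<^sub>M prob_algebra mu"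
proof (rule measurable_prob_algebraI)
  show "prob_space (selmove mu G K n x)" if "x \<in> space (\<Pi>\<^sub>M i\<in>{..<n}. mu)" for x
    using that by (rule prob_space_selmove)
  show "selmove mu G K n \<in> (\<Pi>\<^sub>M i\<in>{..<n}. mu) \<rightarrow>\<^sub>M subprob_algebra mu"
  proof (rule measurable_subprob_algebra)
    show "subprob_space (selmove mu G K n x)" if "x \<in> space (\<Pi>\<^sub>M i\<in>{..<n}. mu)" for x
      using prob_space_selmove[OF that] by (rule prob_space_imp_subprob_space)
    fix A assume A: "A \<in> sets mu"
    have [measurable]: "(\<lambda>u. emeasure (K u) A) \<in> borel_measurable mu"
      using measurable_compose[OF measurable_prob_algebraD[OF K] measurable_emeasure_subprob_algebra[OF A]] .
    have "emeasure (selmove mu G K n x) A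
      = (\<Sum>i<n. ennreal (G (x i)) * emeasure (K (x i)) A) * ennreal (1 / (\<Sum>i<n. G (x i)))"
      if "x \<in> space (\<Pi>\<^sub>M i\<in>{..<n}. mu)" for x
      using selmove_bind(4)[OF that A] .
    moreover have "(\<lambda>x. (\<Sum>i<n. ennreal (G (x i)) * emeasure (K (x i)) A) * ennreal (1 / (\<Sum>i<n. G (x i))))
        \<in> borel_measurable (\<Pi>\<^sub>M i\<in>{..<n}. mu)"
      by measurable
    ultimately show "(\<lambda>x. emeasure (selmove mu G K n x) A) \<in> borel_measurable (\<Pi>\<^sub>M i\<in>{..<n}. mu)"
      by (simp cong: measurable_cong)
  qed simp
qed

end

section \<open>The Feynman--Kac semigroup and its stability\<close>

text \<open>The bounds are stated for normalised weights with one constant \<open>K\<close>. The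
  upper bound starts at level 0, where it will come from a finite sup norm; the lower bound starts
  at level 1, where (A1) provides it.\<close>

locale smc =
  fixes mu :: "'a measure" and \<gamma> :: "nat \<Rightarrow> 'a \<Rightarrow> real" and M :: "nat \<Rightarrow> 'a \<Rightarrow> 'a measure"
    and K \<rho> :: real
  assumes integ: "\<And>l. integrable mu (\<gamma> l)"
    and gpos: "\<And>l u. u \<in> space mu \<Longrightarrow> \<gamma> l u > 0"
    and Zpos: "\<And>l. Zc mu \<gamma> l > 0"
    and kern: "\<And>l. l \<ge> 1 \<Longrightarrow> M l \<in> mu \<rightarrow>\<^sub>M prob_algebra mu"
    and inv: "\<And>l. l \<ge> 1 \<Longrightarrow> eta mu \<gamma> l \<bind> M l = eta mu \<gamma> l"
    and mixing: "\<And>l u v A. l \<ge> 1 \<Longrightarrow> u \<in> space mu \<Longrightarrow> v \<in> space mu \<Longrightarrow> A \<in> sets mu \<Longrightarrow>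
         emeasure (M l u) A \<ge> ennreal \<rho> * emeasure (M l v) A"
    and rho: "0 < \<rho>" "\<rho> < 1"
    and K1: "K \<ge> 1"
    and weight_ub: "\<And>l u. u \<in> space mu \<Longrightarrow> Zc mu \<gamma> l / Zc mu \<gamma> (Suc l) * Gw \<gamma> l u \<le> K"
    and weight_lb: "\<And>l u. l \<ge> 1 \<Longrightarrow> u \<in> space mu \<Longrightarrow> 1 / K \<le> Zc mu \<gamma> l / Zc mu \<gamma> (Suc l) * Gw \<gamma> l u"
begin

abbreviation \<eta> :: "nat \<Rightarrow> 'a measure" where "\<eta> \<equiv> eta mu \<gamma>"

text \<open>This is the Radon-Nikodym density of \<open>\<eta> (Suc l)\<close> with respect to
  \<open>\<eta> l\<close>.\<close>

definition W :: "nat \<Rightarrow> 'a \<Rightarrow> real" where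
  "W l u = Zc mu \<gamma> l / Zc mu \<gamma> (Suc l) * Gw \<gamma> l u"

lemma gmeas [measurable]: "\<gamma> l \<in> borel_measurable mu"
  using integ by auto

lemma Gw_meas [measurable]: "Gw \<gamma> l \<in> borel_measurable mu"
  unfolding Gw_def by measurable

lemma Gw_pos: "u \<in> space mu \<Longrightarrow> Gw \<gamma> l u > 0"
  unfolding Gw_def using gpos by simp

lemma W_pos: "u \<in> space mu \<Longrightarrow> W l u > 0"
  unfolding W_def using Gw_pos Zpos by simp

lemma W_le: "u \<in> space mu \<Longrightarrow> W l u \<le> K"
  unfolding W_def by (rule weight_ub)

lemma W_ge: "l \<ge> 1 \<Longrightarrow> u \<in> space mu \<Longrightarrow> 1 / K \<le> W l u"
  unfolding W_def by (rule weight_lb)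

lemma W_bmf [simp]: "W l \<in> bmf mu"
proof (rule bmfI)
  show "W l \<in> borel_measurable mu" unfolding W_def by measurable
  show "\<bar>W l u\<bar> \<le> K" if "u \<in> space mu" for u using W_pos[OF that, of l] W_le[OF that, of l] by simp
qed

lemma sets_eta [simp]: "sets (\<eta> l) = sets mu" and space_eta [simp]: "space (\<eta> l) = space mu"
  by (simp_all add: eta_def)

lemma bmf_eta [simp]: "bmf (\<eta> l) = bmf mu"
  by (rule bmf_cong_sets) simp

lemma integral_eta:
  assumes [measurable]: "f \<in> borel_measurable mu"
  shows "(\<integral>u. f u \<partial>\<eta> l) = (\<integral>u. \<gamma> l u / Zc mu \<gamma> l * f u \<partial>mu)"
  unfolding eta_def using gpos Zpos by (subst integral_density) (auto intro!: AE_I2 less_imp_le divide_pos_pos)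

lemma prob_space_eta: "prob_space (\<eta> l)"
proof (rule prob_spaceI)
  have "emeasure (\<eta> l) (space (\<eta> l)) = (\<integral>\<^sup>+u. ennreal (\<gamma> l u / Zc mu \<gamma> l) \<partial>mu)"
    unfolding space_eta unfolding eta_def by (subst emeasure_density) (auto intro!: nn_integral_cong)
  also have "\<dots> = ennreal (\<integral>u. \<gamma> l u / Zc mu \<gamma> l \<partial>mu)"
    using integ gpos Zpos by (intro nn_integral_eq_integral) (auto intro!: AE_I2 less_imp_le divide_pos_pos)
  also have "(\<integral>u. \<gamma> l u / Zc mu \<gamma> l \<partial>mu) = 1"
    using Zpos[of l] by (simp add: Zc_def)
  finally show "emeasure (\<eta> l) (space (\<eta> l)) = 1" by simp
qed

lemma space_ne: "space mu \<noteq> {}"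
  using prob_space.not_empty[OF prob_space_eta] by simp

lemma eta_W:
  assumes [measurable]: "f \<in> borel_measurable mu"
  shows "(\<integral>u. W l u * f u \<partial>\<eta> l) = (\<integral>u. f u \<partial>\<eta> (Suc l))"
proof -
  have [measurable]: "W l \<in> borel_measurable mu" by (rule bmfD1) simp
  show ?thesis
    unfolding integral_eta[OF assms] by (subst integral_eta, measurable, rule Bochner_Integration.integral_cong)
      (use gpos Zpos in \<open>auto simp: W_def Gw_def less_imp_neq[symmetric]\<close>)
qed

lemma eta_M:
  assumes "l \<ge> 1" "f \<in> bmf mu"
  shows "(\<integral>u. (\<integral>v. f v \<partial>M l u) \<partial>\<eta> l) = (\<integral>u. f u \<partial>\<eta> l)"
proof -
  have "M l \<in> \<eta> l \<rightarrow>\<^sub>M prob_algebra mu" using kern[OF assms(1)] by (simp cong: measurable_cong_sets)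
  from integral_bind_kernel[OF prob_space_eta this assms(2)] show ?thesis using inv[OF assms(1)] by simp
qed

lemma M_prob:
  assumes "l \<ge> 1" "u \<in> space mu"
  shows "prob_space (M l u)" "sets (M l u) = sets mu" "space (M l u) = space mu" "bmf (M l u) = bmf mu"
  using prob_kernelD[OF kern[OF assms(1)] assms(2)] by (simp_all add: bmf_cong_sets[of "M l u" mu])

lemma M_bmf: "l \<ge> 1 \<Longrightarrow> f \<in> bmf mu \<Longrightarrow> (\<lambda>u. \<integral>v. f v \<partial>M l u) \<in> bmf mu"
  by (rule bmf_kernel[OF kern])

text \<open>The mixing condition on sets says that a scaled measure lies below another measure;
  monotonicity of the integral in the measure extends it to nonnegative functions.\<close>

lemma M_mixing:
  assumes l: "l \<ge> 1" and uv: "u \<in> space mu" "v \<in> space mu" and f: "f \<in> bmf mu"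
    and f0: "\<And>x. x \<in> space mu \<Longrightarrow> 0 \<le> f x"
  shows "\<rho> * (\<integral>x. f x \<partial>M l v) \<le> (\<integral>x. f x \<partial>M l u)"
proof -
  note u = M_prob[OF l uv(1)] and v = M_prob[OF l uv(2)]
  interpret u: prob_space "M l u" by (rule u)
  interpret v: prob_space "M l v" by (rule v)
  have nn: "(\<integral>\<^sup>+x. ennreal (f x) \<partial>M l w) = ennreal (\<integral>x. f x \<partial>M l w)" if w: "w \<in> space mu" for w
  proof -
    interpret w: prob_space "M l w" by (rule M_prob[OF l w])
    show ?thesis using f f0 M_prob[OF l w] by (intro nn_integral_eq_integral AE_I2) auto
  qed
  have fm: "f \<in> borel_measurable (M l v)" using f v by auto
  have le: "scale_measure (ennreal \<rho>) (M l v) \<le> M l u"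
    using u v mixing[OF l uv] by (subst le_measure) auto
  have "ennreal (\<rho> * (\<integral>x. f x \<partial>M l v)) = ennreal \<rho> * (\<integral>\<^sup>+x. ennreal (f x) \<partial>M l v)"
    unfolding nn[OF uv(2)] using rho f0 v by (intro ennreal_mult Bochner_Integration.integral_nonneg) auto
  also have "\<dots> = (\<integral>\<^sup>+x. ennreal (f x) \<partial>scale_measure (ennreal \<rho>) (M l v))"
    using fm by (intro nn_integral_scale_measure[symmetric]) simp
  also have "\<dots> \<le> (\<integral>\<^sup>+x. ennreal (f x) \<partial>M l u)"
    using u v by (intro nn_integral_mono_measure le) simp
  also have "\<dots> = ennreal (\<integral>x. f x \<partial>M l u)" by (rule nn) fact
  finally show ?thesis
    using f0 u by (subst (asm) ennreal_le_iff) (auto intro!: Bochner_Integration.integral_nonneg)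
qed

text \<open>The Feynman-Kac semigroup from level \<open>s\<close> to level \<open>s + n\<close>.
  Recursion is on the number of remaining steps while the starting level moves up, matching the way
  particles at one level are resampled to form the next.\<close>

primrec Q :: "nat \<Rightarrow> nat \<Rightarrow> ('a \<Rightarrow> real) \<Rightarrow> 'a \<Rightarrow> real" where
  "Q 0 s f = f"
| "Q (Suc n) s f = (\<lambda>u. W s u * (\<integral>v. Q n (Suc s) f v \<partial>M (Suc s) u))"

abbreviation Q1 :: "nat \<Rightarrow> nat \<Rightarrow> 'a \<Rightarrow> real" where "Q1 n s \<equiv> Q n s (\<lambda>_. 1)"

lemma Q_bmf [simp]: "f \<in> bmf mu \<Longrightarrow> Q n s f \<in> bmf mu"
  by (induction n arbitrary: s) (auto intro!: bmf_mult M_bmf)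

text \<open>In each step \<open>W s\<close> carries \<open>\<eta> s\<close> to
  \<open>\<eta> (Suc s)\<close>, and the kernel leaves the latter invariant.\<close>

lemma eta_Q: "f \<in> bmf mu \<Longrightarrow> (\<integral>u. Q n s f u \<partial>\<eta> s) = (\<integral>u. f u \<partial>\<eta> (s + n))"
proof (induction n arbitrary: s)
  case (Suc n)
  have "(\<integral>u. Q (Suc n) s f u \<partial>\<eta> s) = (\<integral>u. (\<integral>v. Q n (Suc s) f v \<partial>M (Suc s) u) \<partial>\<eta> (Suc s))"
    using Suc.prems by (simp add: eta_W bmfD1 M_bmf)
  also have "\<dots> = (\<integral>u. Q n (Suc s) f u \<partial>\<eta> (Suc s))" using Suc.prems by (simp add: eta_M)
  finally show ?case using Suc by simp
qed simp

lemma Q1_eta: "(\<integral>u. Q1 n s u \<partial>\<eta> s) = 1"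
  using prob_space.prob_space[OF prob_space_eta] by (simp add: eta_Q)

lemma R0_pos: "K\<^sup>2 / \<rho> > 0" "1 / (K\<^sup>2 / \<rho>) > 0"
  using K1 rho by simp_all

text \<open>One weight costs a factor \<open>K^2\<close>, and mixing compares the integrals under
  two starting points at the price \<open>1 / \<rho>\<close>, whatever the integrand. So the bound
  does not compound with \<open>n\<close>: the induction hypothesis serves to keep the integrals
  positive.\<close>

lemma Q1_ratio:
  "s \<ge> 1 \<Longrightarrow> u \<in> space mu \<Longrightarrow> v \<in> space mu \<Longrightarrow> Q1 n s u > 0 \<and> Q1 n s u \<le> K\<^sup>2 / \<rho> * Q1 n s v"
proof (induction n arbitrary: s u v)
  case 0
  have "\<rho> * 1 \<le> 1 * K\<^sup>2" using rho K1 by (intro mult_mono) auto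
  then show ?case using rho by (simp add: field_simps)
next
  case (Suc n)
  define I where "I w = (\<integral>x. Q1 n (Suc s) x \<partial>M (Suc s) w)" for w
  have pos: "Q1 n (Suc s) w > 0" if "w \<in> space mu" for w using Suc.IH[of "Suc s" w w] that by simp
  have I: "I w > 0" if w: "w \<in> space mu" for w
  proof -
    interpret w: prob_space "M (Suc s) w" using M_prob[of "Suc s" w] w by simp
    \<comment> \<open>Comparison with the value at the single point \<open>w\<close> gives a
      positive constant below the integrand, hence a strictly positive integral.\<close>
    have "\<rho> / K\<^sup>2 * Q1 n (Suc s) w \<le> Q1 n (Suc s) x" if "x \<in> space mu" for x
      using Suc.IH[of "Suc s" w x] w that rho K1 by (simp add: field_simps)
    then have "\<rho> / K\<^sup>2 * Q1 n (Suc s) w \<le> I w"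
      unfolding I_def using M_prob[of "Suc s" w] w by (intro w.integral_ge_bound) auto
    moreover have "\<rho> / K\<^sup>2 * Q1 n (Suc s) w > 0" using rho K1 pos[OF w] by simp
    ultimately show ?thesis by linarith
  qed
  have "\<rho> * I u \<le> I v"
    unfolding I_def using Suc.prems pos by (intro M_mixing) (auto intro: less_imp_le)
  then have "I u \<le> I v / \<rho>" using rho by (simp add: pos_le_divide_eq mult.commute)
  moreover have "W s u \<le> K\<^sup>2 * W s v"
  proof -
    have "K * (1 / K) \<le> K * W s v" using W_ge[OF Suc.prems(1,3)] K1 by (intro mult_left_mono) auto
    then have "K * 1 \<le> K * (K * W s v)" using K1 by (intro mult_left_mono) auto
    then show ?thesis using W_le[OF Suc.prems(2), of s] by (simp add: power2_eq_square mult.assoc)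
  qed
  ultimately have "W s u * I u \<le> K\<^sup>2 * W s v * (I v / \<rho>)"
    using I[OF Suc.prems(2)] W_pos[OF Suc.prems(3), of s] by (intro mult_mono) auto
  moreover have "W s u * I u > 0" using I[OF Suc.prems(2)] W_pos[OF Suc.prems(2)] by simp
  ultimately show ?case by (simp add: I_def ac_simps)
qed

text \<open>The extra factor \<open>K\<close> pays for the first weight in \<open>Q1_le\<close>, so
  that one constant bounds \<open>Q1\<close> from above at every level, level 0 included.\<close>

definition R :: real where "R = K * (K\<^sup>2 / \<rho>)"

lemma R0_ge: "K\<^sup>2 / \<rho> \<ge> 1"
  using Q1_ratio[of 1 _ _ 0] space_ne by auto

lemma R_ge: "R \<ge> 1" "R \<ge> K\<^sup>2 / \<rho>" "R \<ge> K"
proof -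
  show a: "R \<ge> K\<^sup>2 / \<rho>" unfolding R_def using K1 R0_ge mult_right_mono[of 1 K "K\<^sup>2 / \<rho>"] by simp
  then show "R \<ge> 1" using R0_ge by linarith
  show "R \<ge> K" unfolding R_def using K1 R0_ge mult_left_mono[of 1 "K\<^sup>2 / \<rho>" K] by simp
qed

text \<open>A function whose values are mutually comparable and whose mean under
  \<open>\<eta> s\<close> is one is comparable to one.\<close>

lemma Q1_bounds0:
  assumes s: "s \<ge> 1" and u: "u \<in> space mu"
  shows "1 / (K\<^sup>2 / \<rho>) \<le> Q1 n s u" "Q1 n s u \<le> K\<^sup>2 / \<rho>"
proof -
  interpret prob_space "\<eta> s" by (rule prob_space_eta)
  have "Q1 n s u \<le> (\<integral>v. K\<^sup>2 / \<rho> * Q1 n s v \<partial>\<eta> s)"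
    using Q1_ratio[OF s u] by (intro integral_ge_bound) auto
  then show "Q1 n s u \<le> K\<^sup>2 / \<rho>" by (simp only: integral_mult_right_zero Q1_eta)
  have "(\<integral>v. Q1 n s v \<partial>\<eta> s) \<le> K\<^sup>2 / \<rho> * Q1 n s u"
    using Q1_ratio[OF s _ u] by (intro integral_le_bound) auto
  then show "1 / (K\<^sup>2 / \<rho>) \<le> Q1 n s u" unfolding Q1_eta pos_divide_le_eq[OF R0_pos(1)] by (simp only: mult.commute)
qed

lemma Q1_pos:
  assumes u: "u \<in> space mu"
  shows "Q1 n s u > 0"
proof (cases n)
  case (Suc m)
  interpret prob_space "M (Suc s) u" using M_prob u by simp
  have "1 / (K\<^sup>2 / \<rho>) \<le> (\<integral>v. Q1 m (Suc s) v \<partial>M (Suc s) u)"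
    using M_prob[of "Suc s" u] u Q1_bounds0 by (intro integral_ge_bound) auto
  moreover note R0_pos(2)
  ultimately have "(\<integral>v. Q1 m (Suc s) v \<partial>M (Suc s) u) > 0" by linarith
  then show ?thesis using Suc W_pos[OF u] by simp
qed simp

lemma Q1_le:
  assumes u: "u \<in> space mu"
  shows "Q1 n s u \<le> R"
proof (cases n)
  case 0 then show ?thesis using R_ge by simp
next
  case (Suc m)
  interpret prob_space "M (Suc s) u" using M_prob u by simp
  have "(\<integral>v. Q1 m (Suc s) v \<partial>M (Suc s) u) \<le> K\<^sup>2 / \<rho>"
    using M_prob[of "Suc s" u] u Q1_bounds0 by (intro integral_le_bound) auto
  moreover have "0 \<le> (\<integral>v. Q1 m (Suc s) v \<partial>M (Suc s) u)"
    using M_prob[of "Suc s" u] u Q1_pos by (intro Bochner_Integration.integral_nonneg) (auto intro: less_imp_le)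
  ultimately have "W s u * (\<integral>v. Q1 m (Suc s) v \<partial>M (Suc s) u) \<le> K * (K\<^sup>2 / \<rho>)"
    using W_le[OF u] W_pos[OF u, of s] K1 by (intro mult_mono) auto
  then show ?thesis by (simp add: Suc R_def)
qed

lemma Q1_bounds:
  assumes "s \<ge> 1" "u \<in> space mu"
  shows "1 / R \<le> Q1 n s u \<and> Q1 n s u \<le> R"
proof
  have "1 / R \<le> 1 / (K\<^sup>2 / \<rho>)" using R_ge(2) R0_pos(1) by (intro frac_le) auto
  then show "1 / R \<le> Q1 n s u" using Q1_bounds0(1)[OF assms] by (rule order_trans)
qed (rule Q1_le[OF assms(2)])

text \<open>The square reflects two uses of mixing per step in \<open>Q_osc\<close>, for the
  numerator and for the denominator.\<close>

definition \<kappa> :: real where "\<kappa> = 1 - \<rho>\<^sup>2"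

lemma kappa: "0 < \<kappa>" "\<kappa> < 1"
  unfolding \<kappa>_def using rho by (auto simp: power_less_one_iff)

text \<open>A step replaces numerator and denominator by their integrals under
  \<open>M (Suc s)\<close>. After shifting by the infimum \<open>m\<close> of the previous ratio,
  mixing applied to both shows that the new ratio at \<open>v\<close> has at least the fraction
  \<open>\<rho>^2\<close> of the excess over \<open>m\<close> that it has at \<open>u\<close>. That
  excess is at most the previous oscillation, which gives the factor
  \<open>1 - \<rho>^2\<close>.\<close>

lemma Q_osc:
  assumes f: "f \<in> bmf mu" and osc: "\<And>u v. u \<in> space mu \<Longrightarrow> v \<in> space mu \<Longrightarrow> f u - f v \<le> d"
  shows "u \<in> space mu \<Longrightarrow> v \<in> space mu \<Longrightarrow> Q n s f u / Q1 n s u - Q n s f v / Q1 n s v \<le> \<kappa> ^ n * d"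
proof (induction n arbitrary: s u v)
  case 0
  then show ?case using osc by simp
next
  case (Suc n)
  define A B where "A = Q n (Suc s) f" and "B = Q1 n (Suc s)"
  have AB: "A \<in> bmf mu" "B \<in> bmf mu" unfolding A_def B_def using f by auto
  have B0: "B w > 0" if "w \<in> space mu" for w unfolding B_def by (rule Q1_pos[OF that])
  define e where "e = \<kappa> ^ n * d"
  \<comment> \<open>Subtracting \<open>m * B\<close> makes the numerator nonnegative, as
    \<open>M_mixing\<close> requires, and leaves it below \<open>e * B\<close>.\<close>
  define m where "m = (INF w\<in>space mu. A w / B w)"
  have r: "A w / B w - A x / B x \<le> e" if "w \<in> space mu" "x \<in> space mu" for w x
    unfolding A_def B_def e_def using that by (rule Suc.IH)
  have bdd: "bdd_below ((\<lambda>w. A w / B w) ` space mu)"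
    using r[OF Suc.prems(1)] by (intro bdd_belowI2[of _ "A u / B u - e"]) (simp add: algebra_simps)
  have m_le: "m \<le> A w / B w" if "w \<in> space mu" for w
    unfolding m_def using bdd that by (rule cINF_lower)
  have m_ge: "A w / B w - e \<le> m" if "w \<in> space mu" for w
    unfolding m_def using space_ne r[OF that] by (intro cINF_greatest) (auto simp: algebra_simps)
  define h where "h w = A w - m * B w" for w
  have h: "h \<in> bmf mu" unfolding h_def using AB by auto
  have h0: "0 \<le> h w" and h1: "h w \<le> e * B w" if "w \<in> space mu" for w
  proof -
    show "0 \<le> h w" using m_le[OF that] B0[OF that] by (simp add: h_def pos_le_divide_eq)
    have "A w / B w \<le> m + e" using m_ge[OF that] by simp
    then show "h w \<le> e * B w" using B0[OF that] by (simp add: h_def pos_divide_le_eq algebra_simps)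
  qed
  define I where "I g w = (\<integral>x. g x \<partial>M (Suc s) w)" for g :: "'a \<Rightarrow> real" and w
  have IB: "I B w > 0" if "w \<in> space mu" for w
    using Q1_pos[OF that, of "Suc n" s] W_pos[OF that, of s] by (simp add: I_def B_def zero_less_mult_iff)
  have Ih: "I h w = I A w - m * I B w" "I h w \<le> e * I B w" "I h w \<ge> 0" if w: "w \<in> space mu" for w
  proof -
    note p = M_prob[of "Suc s" w, simplified, OF w]
    interpret prob_space "M (Suc s) w" by (rule p)
    have i: "integrable (M (Suc s) w) A" "integrable (M (Suc s) w) B" "integrable (M (Suc s) w) h"
      using AB h p by auto
    show "I h w = I A w - m * I B w" unfolding I_def h_def using i by simp
    have "I h w \<le> (\<integral>x. e * B x \<partial>M (Suc s) w)"
      unfolding I_def using i h1 p by (intro integral_mono) auto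
    then show "I h w \<le> e * I B w" by (simp add: I_def)
    show "I h w \<ge> 0" unfolding I_def using h0 p by (intro Bochner_Integration.integral_nonneg) auto
  qed
  define P where "P w = I A w / I B w" for w
  have P: "P w - m = I h w / I B w" if "w \<in> space mu" for w
    using Ih(1)[OF that] IB[OF that] by (simp add: P_def field_simps)
  have "P u - m \<le> e" using Ih(2)[OF Suc.prems(1)] IB[OF Suc.prems(1)] P[OF Suc.prems(1)]
    by (simp add: pos_divide_le_eq)
  have "\<rho> * I h u \<le> I h v" unfolding I_def using Suc.prems h h0 by (intro M_mixing) auto
  moreover have "\<rho> * I B v \<le> I B u"
    unfolding I_def using Suc.prems AB B0 by (intro M_mixing) (auto intro: less_imp_le)
  ultimately have "(\<rho> * I h u) * (\<rho> * I B v) \<le> I h v * I B u"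
    using rho IB[OF Suc.prems(2)] Ih(3)[OF Suc.prems(2)] by (intro mult_mono) auto
  then have "\<rho>\<^sup>2 * (P u - m) \<le> P v - m"
    unfolding P[OF Suc.prems(1)] P[OF Suc.prems(2)] using IB[OF Suc.prems(1)] IB[OF Suc.prems(2)]
    by (simp add: divide_simps power2_eq_square ac_simps)
  then have "P u - P v \<le> \<kappa> * (P u - m)" unfolding \<kappa>_def by (simp add: left_diff_distrib)
  also have "\<dots> \<le> \<kappa> * e" using \<open>P u - m \<le> e\<close> kappa by (intro mult_left_mono) auto
  finally have "P u - P v \<le> \<kappa> ^ Suc n * d" by (simp add: e_def mult.assoc)
  \<comment> \<open>The weight \<open>W s\<close> is common to numerator and denominator and
    cancels, so the contraction also holds from level 0.\<close>
  moreover have "P w = Q (Suc n) s f w / Q1 (Suc n) s w" if "w \<in> space mu" for w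
    using W_pos[OF that, of s] by (simp add: P_def I_def A_def B_def)
  ultimately show ?case using Suc.prems by metis
qed

text \<open>The constant \<open>c\<close> is the mean of \<open>Q n s f / Q1 n s\<close> under
  \<open>\<nu>\<close> reweighted by \<open>Q1 n s\<close>, so it differs from any value of this
  ratio by at most the oscillation. It is applied with \<open>\<nu>\<close> a target law and with
  \<open>\<nu>\<close> a random resampling law.\<close>

lemma Q_deviation:
  assumes f: "f \<in> bmf mu" and osc: "\<And>u v. u \<in> space mu \<Longrightarrow> v \<in> space mu \<Longrightarrow> f u - f v \<le> d"
    and \<nu>: "prob_space \<nu>" "sets \<nu> = sets mu"
    and c: "c = (\<integral>v. Q n s f v \<partial>\<nu>) / (\<integral>v. Q1 n s v \<partial>\<nu>)" and u: "u \<in> space mu"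
    and pos: "(\<integral>v. Q1 n s v \<partial>\<nu>) > 0"
  shows "\<bar>Q n s f u - c * Q1 n s u\<bar> \<le> \<kappa> ^ n * d * Q1 n s u"
proof -
  interpret prob_space \<nu> by (rule \<nu>)
  have b: "bmf \<nu> = bmf mu" "space \<nu> = space mu" using bmf_cong_sets[OF \<nu>(2)] sets_eq_imp_space_eq[OF \<nu>(2)] by auto
  define r where "r v = Q n s f v / Q1 n s v" for v
  define e where "e = \<kappa> ^ n * d"
  have r: "\<bar>r u * Q1 n s v - Q n s f v\<bar> \<le> e * Q1 n s v" if v: "v \<in> space mu" for v
  proof -
    have "\<bar>r u - r v\<bar> \<le> e"
      unfolding r_def e_def using Q_osc[OF f osc u v, of n s] Q_osc[OF f osc v u, of n s] by (simp add: abs_le_iff)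
    then have "\<bar>r u - r v\<bar> * Q1 n s v \<le> e * Q1 n s v" using Q1_pos[OF v] by (intro mult_right_mono) (auto intro: less_imp_le)
    moreover have "(r u - r v) * Q1 n s v = r u * Q1 n s v - Q n s f v"
      using Q1_pos[OF v, of n s] by (simp add: r_def left_diff_distrib)
    moreover have "\<bar>(r u - r v) * Q1 n s v\<bar> = \<bar>r u - r v\<bar> * Q1 n s v"
      using Q1_pos[OF v, of n s] by (simp add: abs_mult)
    ultimately show ?thesis by metis
  qed
  have i: "integrable \<nu> (Q n s f)" "integrable \<nu> (Q1 n s)" using b f by auto
  have "\<bar>\<integral>v. r u * Q1 n s v - Q n s f v \<partial>\<nu>\<bar> \<le> (\<integral>v. \<bar>r u * Q1 n s v - Q n s f v\<bar> \<partial>\<nu>)"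
    by (rule integral_abs_bound)
  also have "\<dots> \<le> (\<integral>v. e * Q1 n s v \<partial>\<nu>)"
    using i r b by (intro integral_mono) auto
  finally have "\<bar>r u * (\<integral>v. Q1 n s v \<partial>\<nu>) - (\<integral>v. Q n s f v \<partial>\<nu>)\<bar> \<le> e * (\<integral>v. Q1 n s v \<partial>\<nu>)"
    using i by simp
  moreover have "r u * (\<integral>v. Q1 n s v \<partial>\<nu>) - (\<integral>v. Q n s f v \<partial>\<nu>) = (r u - c) * (\<integral>v. Q1 n s v \<partial>\<nu>)"
    using pos by (simp add: c left_diff_distrib)
  ultimately have "\<bar>r u - c\<bar> * (\<integral>v. Q1 n s v \<partial>\<nu>) \<le> e * (\<integral>v. Q1 n s v \<partial>\<nu>)"
    using pos by (simp add: abs_mult)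
  then have "\<bar>r u - c\<bar> \<le> e" using pos by simp
  then have "\<bar>r u - c\<bar> * Q1 n s u \<le> e * Q1 n s u" using Q1_pos[OF u, of n s] by (intro mult_right_mono) auto
  moreover have "Q n s f u - c * Q1 n s u = (r u - c) * Q1 n s u"
    using Q1_pos[OF u, of n s] by (simp add: r_def left_diff_distrib)
  moreover have "\<bar>(r u - c) * Q1 n s u\<bar> = \<bar>r u - c\<bar> * Q1 n s u"
    using Q1_pos[OF u, of n s] by (simp add: abs_mult)
  ultimately show ?thesis unfolding e_def by metis
qed

end

section \<open>The law of the particle system\<close>

text \<open>Here \<open>T\<close> is the last level that carries particles, so the estimator has
  \<open>Suc T\<close> increments.\<close>

locale smc_run = smc +
  fixes N :: "nat \<Rightarrow> nat" and T :: nat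
  assumes Npos: "\<And>l. l \<le> T \<Longrightarrow> N l > 0"
    and Ndec: "\<And>l. l < T \<Longrightarrow> N (Suc l) \<le> N l"
begin

abbreviation LS :: "nat \<Rightarrow> (nat \<Rightarrow> nat \<Rightarrow> 'a) measure" where "LS \<equiv> levels_space mu N"

abbreviation P :: "nat \<Rightarrow> (nat \<Rightarrow> nat \<Rightarrow> 'a) measure" where "P \<equiv> particle_law mu \<gamma> M N"

abbreviation sel :: "nat \<Rightarrow> (nat \<Rightarrow> nat \<Rightarrow> 'a) \<Rightarrow> 'a measure" where
  "sel k U \<equiv> selmove mu (Gw \<gamma> k) (M (Suc k)) (N k) (U k)"

abbreviation popl :: "nat \<Rightarrow> (nat \<Rightarrow> nat \<Rightarrow> 'a) \<Rightarrow> (nat \<Rightarrow> 'a) measure" where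
  "popl k U \<equiv> (\<Pi>\<^sub>M i\<in>{..<N (Suc k)}. sel k U)"

lemma N_antimono: "p \<le> q \<Longrightarrow> q \<le> T \<Longrightarrow> N q \<le> N p"
proof (induction q rule: dec_induct)
  case (step n)
  then show ?case using Ndec[of n] by simp
qed simp

lemma LS_component: "k \<le> j \<Longrightarrow> (\<lambda>U. U k) \<in> LS j \<rightarrow>\<^sub>M (\<Pi>\<^sub>M i\<in>{..<N k}. mu)"
  unfolding levels_space_def by (rule measurable_component_singleton) simp

lemma LS_component_space: "k \<le> j \<Longrightarrow> U \<in> space (LS j) \<Longrightarrow> U k \<in> space (\<Pi>\<^sub>M i\<in>{..<N k}. mu)"
  using measurable_space[OF LS_component] .

lemma LS_space: "k \<le> j \<Longrightarrow> i < N k \<Longrightarrow> U \<in> space (LS j) \<Longrightarrow> U k i \<in> space mu"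
  using LS_component_space[of k j U] by (auto simp: space_PiM)

lemma LS_upd: "(\<lambda>(U, V). U(Suc k := V)) \<in> (LS k \<Otimes>\<^sub>M (\<Pi>\<^sub>M i\<in>{..<N (Suc k)}. mu)) \<rightarrow>\<^sub>M LS (Suc k)"
  using measurable_add_dim[of "Suc k" "{..k}" "\<lambda>l. \<Pi>\<^sub>M i\<in>{..<N l}. mu"]
  unfolding levels_space_def atMost_Suc .

lemma LS_upd1: "U \<in> space (LS k) \<Longrightarrow> (\<lambda>V. U(Suc k := V)) \<in> (\<Pi>\<^sub>M i\<in>{..<N (Suc k)}. mu) \<rightarrow>\<^sub>M LS (Suc k)"
  using measurable_compose[OF measurable_Pair1' LS_upd] by simp

lemma sel_prob: "k \<le> T \<Longrightarrow> U \<in> space (LS k) \<Longrightarrow> prob_space (sel k U)"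
  using Npos by (intro prob_space_selmove Gw_meas Gw_pos kern LS_component_space) auto

lemma sets_sel [simp]: "sets (sel k U) = sets mu"
  by (simp add: selmove_def)

lemma bmf_sel [simp]: "bmf (sel k U) = bmf mu"
  by (rule bmf_cong_sets) simp

lemma space_sel [simp]: "space (sel k U) = space mu"
  by (rule sets_eq_imp_space_eq) simp

lemma sets_popl: "sets (popl k U) = sets (\<Pi>\<^sub>M i\<in>{..<N (Suc k)}. mu)"
  by (rule sets_PiM_cong) simp_all

lemma sel_measurable: "k \<le> T \<Longrightarrow> sel k \<in> LS k \<rightarrow>\<^sub>M prob_algebra mu"
  using Npos by (intro measurable_compose[OF LS_component measurable_selmove] Gw_meas Gw_pos kern) auto

lemma popl_measurable: "k \<le> T \<Longrightarrow> popl k \<in> LS k \<rightarrow>\<^sub>M prob_algebra (\<Pi>\<^sub>M i\<in>{..<N (Suc k)}. mu)"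
  by (rule measurable_PiM_iid[OF sel_measurable]) auto

lemma step_measurable:
  assumes k: "k \<le> T"
  shows "(\<lambda>U. distr (popl k U) (LS (Suc k)) (\<lambda>V. U(Suc k := V))) \<in> LS k \<rightarrow>\<^sub>M prob_algebra (LS (Suc k))"
proof (rule measurable_prob_algebraI)
  show "prob_space (distr (popl k U) (LS (Suc k)) (\<lambda>V. U(Suc k := V)))" if U: "U \<in> space (LS k)" for U
  proof (rule prob_space.prob_space_distr)
    show "prob_space (popl k U)" using prob_kernelD(1)[OF popl_measurable[OF k] U] .
    show "(\<lambda>V. U(Suc k := V)) \<in> popl k U \<rightarrow>\<^sub>M LS (Suc k)"
      using LS_upd1[OF U] by (simp cong: measurable_cong_sets add: sets_popl)
  qed
  show "(\<lambda>U. distr (popl k U) (LS (Suc k)) (\<lambda>V. U(Suc k := V))) \<in> LS k \<rightarrow>\<^sub>M subprob_algebra (LS (Suc k))"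
    using LS_upd by (intro measurable_distr2[OF _ measurable_prob_algebraD[OF popl_measurable[OF k]]]) simp
qed

lemma init_measurable: "(\<lambda>x. (\<lambda>l. undefined)(0 := x)) \<in> (\<Pi>\<^sub>M i\<in>{..<N 0}. \<eta> 0) \<rightarrow>\<^sub>M LS 0"
  unfolding levels_space_def
\<comment> \<open>The constant \<open>undefined\<close> function is the only point of the product
  over the empty index set, which is extended by index 0.\<close>
proof (rule measurable_fun_upd[where J="{}"])
  show "(\<lambda>x. x) \<in> (\<Pi>\<^sub>M i\<in>{..<N 0}. \<eta> 0) \<rightarrow>\<^sub>M (\<Pi>\<^sub>M i\<in>{..<N 0}. mu)"
    by (rule measurable_ident_sets) (rule sets_PiM_cong, simp_all)
qed (auto simp: space_PiM)

lemma P_prob: "k \<le> T \<Longrightarrow> P k \<in> space (prob_algebra (LS k))"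
proof (induction k)
  case 0
  have "prob_space (\<Pi>\<^sub>M i\<in>{..<N 0}. \<eta> 0)" by (intro prob_space_PiM prob_space_eta)
  from prob_space.prob_space_distr[OF this init_measurable] show ?case
    by (simp add: space_prob_algebra)
next
  case (Suc k)
  then have "P k \<in> space (prob_algebra (LS k))" and k: "k \<le> T" by auto
  then show ?case
    using prob_space_bind'[OF _ step_measurable[OF k]] sets_bind'[OF _ step_measurable[OF k]]
    by (simp add: space_prob_algebra)
qed

lemma P_facts:
  assumes "k \<le> T"
  shows "prob_space (P k)" "sets (P k) = sets (LS k)" "space (P k) = space (LS k)" "bmf (P k) = bmf (LS k)"
proof -
  show 1: "prob_space (P k)" and 2: "sets (P k) = sets (LS k)"
    using P_prob[OF assms] by (auto simp: space_prob_algebra)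
  show "space (P k) = space (LS k)" using 2 by (rule sets_eq_imp_space_eq)
  show "bmf (P k) = bmf (LS k)" using 2 by (rule bmf_cong_sets)
qed

lemma integral_P0:
  assumes F: "F \<in> bmf (LS 0)"
  shows "(\<integral>U. F U \<partial>P 0) = (\<integral>x. F ((\<lambda>l. undefined)(0 := x)) \<partial>(\<Pi>\<^sub>M i\<in>{..<N 0}. \<eta> 0))"
  using integral_distr[OF init_measurable bmfD1[OF F]] by simp

lemma integral_P_Suc:
  assumes k: "k < T" and F: "F \<in> bmf (LS (Suc k))"
  shows "(\<integral>U. F U \<partial>P (Suc k)) = (\<integral>U. (\<integral>V. F (U(Suc k := V)) \<partial>popl k U) \<partial>P k)"
proof -
  have km: "k \<le> T" using k by simp
  have "(\<lambda>U. distr (popl k U) (LS (Suc k)) (\<lambda>V. U(Suc k := V))) \<in> P k \<rightarrow>\<^sub>M prob_algebra (LS (Suc k))"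
    using step_measurable[OF km] by (simp cong: measurable_cong_sets add: P_facts[OF km])
  from integral_bind_kernel[OF P_facts(1)[OF km] this F]
  have "(\<integral>U. F U \<partial>P (Suc k)) = (\<integral>U. (\<integral>y. F y \<partial>distr (popl k U) (LS (Suc k)) (\<lambda>V. U(Suc k := V))) \<partial>P k)"
    by simp
  also have "\<dots> = (\<integral>U. (\<integral>V. F (U(Suc k := V)) \<partial>popl k U) \<partial>P k)"
  proof (rule Bochner_Integration.integral_cong[OF refl])
    fix U assume "U \<in> space (P k)"
    then have "(\<lambda>V. U(Suc k := V)) \<in> popl k U \<rightarrow>\<^sub>M LS (Suc k)"
      using LS_upd1[of U k] by (simp cong: measurable_cong_sets add: sets_popl P_facts[OF km])
    then show "(\<integral>y. F y \<partial>distr (popl k U) (LS (Suc k)) (\<lambda>V. U(Suc k := V))) = (\<integral>V. F (U(Suc k := V)) \<partial>popl k U)"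
      by (rule integral_distr) (rule bmfD1[OF F])
  qed
  finally show ?thesis .
qed

text \<open>Expresses that \<open>F\<close> is determined by the levels up to \<open>k\<close>. As
  \<open>LS j\<close> changes with \<open>j\<close>, boundedness and measurability are required on
  each of these spaces; invariance under updates of later levels replaces a filtration, so no
  conditional expectation has to be formed.\<close>

definition adapted :: "nat \<Rightarrow> ((nat \<Rightarrow> nat \<Rightarrow> 'a) \<Rightarrow> real) \<Rightarrow> bool" where
  "adapted k F \<longleftrightarrow> (\<forall>j\<ge>k. F \<in> bmf (LS j)) \<and> (\<forall>U V. \<forall>j>k. F (U(j := V)) = F U)"

lemma adapted_bmf: "adapted k F \<Longrightarrow> k \<le> j \<Longrightarrow> F \<in> bmf (LS j)"
  by (simp add: adapted_def)

lemma adapted_upd: "adapted k F \<Longrightarrow> F (U(Suc k := V)) = F U"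
  by (simp add: adapted_def)

lemma adapted_mono: "adapted k F \<Longrightarrow> k \<le> j \<Longrightarrow> adapted j F"
  by (auto simp: adapted_def)

lemma adapted_const [simp]: "adapted k (\<lambda>_. c)"
  by (auto simp: adapted_def)

lemma adapted_diff [simp]: "adapted k F \<Longrightarrow> adapted k H \<Longrightarrow> adapted k (\<lambda>U. F U - H U)"
  unfolding adapted_def by (intro conjI allI impI bmf_diff) simp_all

lemma adapted_mult [simp]: "adapted k F \<Longrightarrow> adapted k H \<Longrightarrow> adapted k (\<lambda>U. F U * H U)"
  unfolding adapted_def by (intro conjI allI impI bmf_mult) simp_all

lemma adapted_abs [simp]: "adapted k F \<Longrightarrow> adapted k (\<lambda>U. \<bar>F U\<bar>)"
  unfolding adapted_def by (intro conjI allI impI bmf_abs) simp_all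

lemma adapted_power [simp]: "adapted k F \<Longrightarrow> adapted k (\<lambda>U. F U ^ n)"
  unfolding adapted_def by (intro conjI allI impI bmf_power) simp_all

abbreviation E :: "((nat \<Rightarrow> nat \<Rightarrow> 'a) \<Rightarrow> real) \<Rightarrow> real" where "E F \<equiv> (\<integral>U. F U \<partial>P T)"

text \<open>The laws of the truncated systems are consistent, so every expectation can be taken
  under the final law.\<close>

lemma integral_P_adapted:
  assumes F: "adapted k F" and kj: "k \<le> j" and jT: "j \<le> T"
  shows "(\<integral>U. F U \<partial>P j) = (\<integral>U. F U \<partial>P k)"
  using kj jT
proof (induction j rule: dec_induct)
  case (step n)
  have "(\<integral>U. F U \<partial>P (Suc n)) = (\<integral>U. (\<integral>V. F (U(Suc n := V)) \<partial>popl n U) \<partial>P n)"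
    using step by (intro integral_P_Suc adapted_bmf[OF F]) auto
  also have "\<dots> = (\<integral>U. F U \<partial>P n)"
  proof (rule Bochner_Integration.integral_cong[OF refl])
    fix U assume "U \<in> space (P n)"
    then interpret prob_space "popl n U"
      using prob_kernelD(1)[OF popl_measurable] step P_facts(3)[of n] by auto
    show "(\<integral>V. F (U(Suc n := V)) \<partial>popl n U) = F U"
      using adapted_upd[OF adapted_mono[OF F step(1)]] by (simp add: prob_space)
  qed
  finally show ?case using step by simp
qed simp

text \<open>The tower property in one-sided form: the integral against \<open>popl k U\<close> is
  the conditional expectation given the levels up to \<open>k\<close>, and dominating it by an
  adapted \<open>H\<close> is all that later estimates require.\<close>

lemma E_step:
  assumes k: "k < T" and F: "adapted (Suc k) F" and H: "adapted k H"
    and le: "\<And>U. U \<in> space (LS k) \<Longrightarrow> (\<integral>V. F (U(Suc k := V)) \<partial>popl k U) \<le> H U"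
  shows "E F \<le> E H"
proof -
  have km: "k \<le> T" using k by simp
  interpret Pk: prob_space "P k" by (rule P_facts[OF km])
  have "E F = (\<integral>U. (\<integral>V. F (U(Suc k := V)) \<partial>popl k U) \<partial>P k)"
    using integral_P_adapted[OF F, of T] k integral_P_Suc[OF k adapted_bmf[OF F]] by simp
  also have "\<dots> \<le> (\<integral>U. H U \<partial>P k)"
  proof (rule integral_mono)
    have Fb: "F \<in> bmf (LS (Suc k))" using adapted_bmf[OF F] by simp
    \<comment> \<open>The inner integral is seen to be bounded and measurable in the form of an
      image measure, and this is then carried over to the integral against
      \<open>popl k U\<close>.\<close>
    have "(\<lambda>U. \<integral>y. F y \<partial>distr (popl k U) (LS (Suc k)) (\<lambda>V. U(Suc k := V))) \<in> bmf (LS k)"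
      by (rule bmf_kernel[OF step_measurable[OF km] Fb])
    then have "integrable (P k) (\<lambda>U. \<integral>y. F y \<partial>distr (popl k U) (LS (Suc k)) (\<lambda>V. U(Suc k := V)))"
      by (intro Pk.bmf_integrable) (simp add: P_facts[OF km])
    also have "?this \<longleftrightarrow> integrable (P k) (\<lambda>U. \<integral>V. F (U(Suc k := V)) \<partial>popl k U)"
    proof (rule Bochner_Integration.integrable_cong[OF refl])
      fix U assume "U \<in> space (P k)"
      then have "(\<lambda>V. U(Suc k := V)) \<in> popl k U \<rightarrow>\<^sub>M LS (Suc k)"
        using LS_upd1[of U k] by (simp cong: measurable_cong_sets add: sets_popl P_facts[OF km])
      then show "(\<integral>y. F y \<partial>distr (popl k U) (LS (Suc k)) (\<lambda>V. U(Suc k := V))) = (\<integral>V. F (U(Suc k := V)) \<partial>popl k U)"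
        by (rule integral_distr) (rule bmfD1[OF Fb])
    qed
    finally show "integrable (P k) (\<lambda>U. \<integral>V. F (U(Suc k := V)) \<partial>popl k U)" .
    show "integrable (P k) H" using adapted_bmf[OF H, of k] P_facts(4)[OF km] by (intro Pk.bmf_integrable) simp
    show "(\<integral>V. F (U(Suc k := V)) \<partial>popl k U) \<le> H U" if "U \<in> space (P k)" for U
      using le that P_facts(3)[OF km] by simp
  qed
  also have "\<dots> = E H" using integral_P_adapted[OF H, of T] k by simp
  finally show ?thesis .
qed

section \<open>Empirical means and normalised predictions\<close>

lemma adapted_emp [simp]:
  assumes \<phi>: "\<phi> \<in> bmf mu"
  shows "adapted l (\<lambda>U. emp N U l \<phi>)"
  unfolding adapted_def
proof (intro conjI allI impI)
  fix j assume j: "l \<le> j"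
  obtain B where B: "\<And>x. x \<in> space mu \<Longrightarrow> \<bar>\<phi> x\<bar> \<le> B" using bmf_bound[OF \<phi>] by metis
  have "(\<lambda>U. \<phi> (U l i)) \<in> bmf (LS j)" if i: "i < N l" for i
  proof (rule bmfI[of _ _ B])
    have "(\<lambda>U. U l i) \<in> LS j \<rightarrow>\<^sub>M mu"
      using measurable_compose[OF LS_component[OF j] measurable_component_singleton] i by simp
    then show "(\<lambda>U. \<phi> (U l i)) \<in> borel_measurable (LS j)"
      using measurable_compose bmfD1[OF \<phi>] by blast
    show "\<bar>\<phi> (U l i)\<bar> \<le> B" if "U \<in> space (LS j)" for U
      using B LS_space[OF j i that] by simp
  qed
  then show "(\<lambda>U. emp N U l \<phi>) \<in> bmf (LS j)" unfolding emp_def by (intro bmf_divide_const bmf_sum) simp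
qed (simp add: emp_def)

lemma emp_pos:
  assumes "l \<le> T" "l \<le> j" "U \<in> space (LS j)" "\<And>u. u \<in> space mu \<Longrightarrow> B u > 0"
  shows "emp N U l B > 0"
proof -
  have "(\<Sum>i<N l. B (U l i)) > 0"
    using assms Npos[of l] LS_space[OF assms(2) _ assms(3)] by (intro sum_pos) auto
  then show ?thesis using Npos[OF assms(1)] by (simp add: emp_def)
qed

lemma emp_ratio_le:
  assumes l: "l \<le> T" and j: "l \<le> j" and U: "U \<in> space (LS j)"
    and B: "\<And>u. u \<in> space mu \<Longrightarrow> B u > 0" and AB: "\<And>u. u \<in> space mu \<Longrightarrow> \<bar>A u\<bar> \<le> c * B u"
  shows "\<bar>emp N U l A / emp N U l B\<bar> \<le> c"
proof -
  have "\<bar>(\<Sum>i<N l. A (U l i)) / (\<Sum>i<N l. B (U l i)) - 0\<bar> \<le> c"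
    using B AB LS_space[OF j _ U] Npos[OF l] by (intro weighted_ratio_deviation) auto
  then show ?thesis using Npos[OF l] by (simp add: emp_def)
qed

lemma adapted_ratio:
  assumes l: "l \<le> T" and A: "A \<in> bmf mu" and B: "B \<in> bmf mu" "\<And>u. u \<in> space mu \<Longrightarrow> B u > 0"
    and AB: "\<And>u. u \<in> space mu \<Longrightarrow> \<bar>A u\<bar> \<le> c * B u"
  shows "adapted l (\<lambda>U. emp N U l A / emp N U l B)"
  unfolding adapted_def
proof (intro conjI allI impI)
  fix j assume j: "l \<le> j"
  have [measurable]: "(\<lambda>U. emp N U l A) \<in> borel_measurable (LS j)" "(\<lambda>U. emp N U l B) \<in> borel_measurable (LS j)"
    using adapted_bmf[OF adapted_emp j] A B by (blast dest: bmfD1)+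
  show "(\<lambda>U. emp N U l A / emp N U l B) \<in> bmf (LS j)"
  proof (rule bmfI[of _ _ c])
    show "\<bar>emp N U l A / emp N U l B\<bar> \<le> c" if "U \<in> space (LS j)" for U
      using emp_ratio_le[OF l j that B(2) AB] .
  qed measurable
qed (simp add: emp_def)

text \<open>The prediction of the mean of \<open>f\<close> under \<open>\<eta> (s + n)\<close> made
  from the particles at level \<open>s\<close>; for \<open>n = 0\<close> it is their plain empirical
  mean.\<close>

definition D :: "nat \<Rightarrow> nat \<Rightarrow> ('a \<Rightarrow> real) \<Rightarrow> (nat \<Rightarrow> nat \<Rightarrow> 'a) \<Rightarrow> real" where
  "D n s f U = emp N U s (Q n s f) / emp N U s (Q1 n s)"

lemma Q_le:
  assumes f: "f \<in> bmf mu" and c: "\<And>u. u \<in> space mu \<Longrightarrow> \<bar>f u\<bar> \<le> c"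
  shows "u \<in> space mu \<Longrightarrow> \<bar>Q n s f u\<bar> \<le> c * Q1 n s u"
proof (induction n arbitrary: s u)
  case (Suc n)
  note p = M_prob[of "Suc s" u, simplified, OF Suc.prems]
  interpret prob_space "M (Suc s) u" by (rule p)
  have "\<bar>\<integral>v. Q n (Suc s) f v \<partial>M (Suc s) u\<bar> \<le> (\<integral>v. \<bar>Q n (Suc s) f v\<bar> \<partial>M (Suc s) u)" by (rule integral_abs_bound)
  also have "\<dots> \<le> (\<integral>v. c * Q1 n (Suc s) v \<partial>M (Suc s) u)"
    using p f Suc.IH by (intro integral_mono) auto
  finally have "\<bar>\<integral>v. Q n (Suc s) f v \<partial>M (Suc s) u\<bar> \<le> c * (\<integral>v. Q1 n (Suc s) v \<partial>M (Suc s) u)" by simp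
  from mult_left_mono[OF this, of "W s u"] show ?case
    using W_pos[OF Suc.prems, of s] by (simp add: abs_mult ac_simps)
qed (use c in simp)

lemma adapted_D [simp]:
  assumes s: "s \<le> T" and f: "f \<in> bmf mu"
  shows "adapted s (D n s f)"
proof -
  obtain c where c: "\<And>u. u \<in> space mu \<Longrightarrow> \<bar>f u\<bar> \<le> c" using bmf_bound[OF f] by metis
  show ?thesis unfolding D_def
    using f by (intro adapted_ratio[OF s _ _ Q1_pos Q_le[OF f c]]) simp_all
qed

lemma sel_integral:
  assumes k: "k \<le> T" and U: "U \<in> space (LS k)" and f: "f \<in> bmf mu"
  shows "(\<integral>y. f y \<partial>sel k U)
    = emp N U k (\<lambda>u. W k u * (\<integral>y. f y \<partial>M (Suc k) u)) / emp N U k (W k)"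
proof -
  have z: "Zc mu \<gamma> k / Zc mu \<gamma> (Suc k) \<noteq> 0" using Zpos[of k] Zpos[of "Suc k"] by simp
  have "(\<integral>y. f y \<partial>sel k U) = (\<Sum>i<N k. Gw \<gamma> k (U k i) * (\<integral>y. f y \<partial>M (Suc k) (U k i))) / (\<Sum>i<N k. Gw \<gamma> k (U k i))"
    using Npos[OF k] f U by (intro integral_selmove Gw_meas Gw_pos kern LS_component_space) auto
  also have "\<dots> = (Zc mu \<gamma> k / Zc mu \<gamma> (Suc k) * (\<Sum>i<N k. Gw \<gamma> k (U k i) * (\<integral>y. f y \<partial>M (Suc k) (U k i))))
      / (Zc mu \<gamma> k / Zc mu \<gamma> (Suc k) * (\<Sum>i<N k. Gw \<gamma> k (U k i)))"
    by (rule mult_divide_mult_cancel_left[OF z, symmetric])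
  also have "\<dots> = (\<Sum>i<N k. W k (U k i) * (\<integral>y. f y \<partial>M (Suc k) (U k i))) / (\<Sum>i<N k. W k (U k i))"
    unfolding W_def sum_distrib_left by (simp only: mult.assoc)
  also have "\<dots> = emp N U k (\<lambda>u. W k u * (\<integral>y. f y \<partial>M (Suc k) u)) / emp N U k (W k)"
    using Npos[OF k] by (simp add: emp_def)
  finally show ?thesis .
qed

text \<open>Numerator and denominator on the right share the normalisation
  \<open>emp N U k (W k)\<close> of the resampling law, which cancels. This exact identity lets the
  predictions telescope.\<close>

lemma D_sel:
  assumes k: "k \<le> T" and U: "U \<in> space (LS k)" and f: "f \<in> bmf mu"
  shows "D (Suc n) k f U = (\<integral>y. Q n (Suc k) f y \<partial>sel k U) / (\<integral>y. Q1 n (Suc k) y \<partial>sel k U)"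
proof -
  have "emp N U k (W k) > 0" using k U W_pos by (intro emp_pos[of k k]) auto
  then show ?thesis using k U f by (simp add: sel_integral D_def)
qed

lemma D_upd:
  "D n (Suc k) f (U(Suc k := V)) = (\<Sum>i<N (Suc k). Q n (Suc k) f (V i)) / (\<Sum>i<N (Suc k). Q1 n (Suc k) (V i))"
  if "Suc k \<le> T"
  using Npos[OF that] by (simp add: D_def emp_def)

interpretation PT: prob_space "P T" by (rule P_facts) simp

context
  fixes k n :: nat and f :: "'a \<Rightarrow> real" and d :: real
  assumes k: "k < T" and f: "f \<in> bmf mu"
    and osc: "\<And>u v. u \<in> space mu \<Longrightarrow> v \<in> space mu \<Longrightarrow> f u - f v \<le> d"
begin

text \<open>An instance of \<open>iid_ratio\<close> for the resampling law, which by
  \<open>D_sel\<close> has the previous prediction as its ratio. The new level is at least 1, so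
  \<open>Q1\<close> is bounded below there; \<open>Q_deviation\<close> under the same law provides
  the factor \<open>\<kappa> ^ n * d\<close>.\<close>

lemma D_step_iid:
  assumes U: "U \<in> space (LS k)"
  shows "(\<integral>V. (D n (Suc k) f (U(Suc k := V)) - D (Suc n) k f U)^4 \<partial>popl k U)
      \<le> (2 * R\<^sup>2 * (\<kappa> ^ n * d) / sqrt (real (N (Suc k))))^4" (is ?A)
    and "\<bar>\<integral>V. D n (Suc k) f (U(Suc k := V)) - D (Suc n) k f U \<partial>popl k U\<bar>
      \<le> 4 * R^4 * (\<kappa> ^ n * d) / real (N (Suc k))" (is ?B)
proof -
  have kT: "k \<le> T" "Suc k \<le> T" using k by auto
  note s = sel_prob[OF kT(1) U]
  interpret s: prob_space "sel k U" by (rule s)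
  interpret p: prob_space "popl k U" by (rule s.prob_space_iid)
  have "1 / R \<le> (\<integral>y. Q1 n (Suc k) y \<partial>sel k U)"
    using Q1_bounds[of "Suc k"] by (intro s.integral_ge_bound) auto
  moreover have "1 / R > 0" using R_ge(1) by simp
  ultimately have pos: "(\<integral>y. Q1 n (Suc k) y \<partial>sel k U) > 0" by linarith
  have dev: "\<bar>Q n (Suc k) f u - D (Suc n) k f U * Q1 n (Suc k) u\<bar> \<le> \<kappa> ^ n * d * Q1 n (Suc k) u"
    if "u \<in> space mu" for u
    using f osc s that pos by (intro Q_deviation[of f d "sel k U"]) (auto intro: D_sel[OF kT(1) U f])
  note ir = s.iid_ratio[where A="Q n (Suc k) f" and B="Q1 n (Suc k)" and R=R and d="D (Suc n) k f U"
      and e="\<kappa> ^ n * d" and n="N (Suc k)", unfolded bmf_sel space_sel,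
      OF Q_bmf[OF f] Q_bmf[OF bmf_const] R_ge(1) Q1_bounds D_sel[OF kT(1) U f] dev Npos[OF kT(2)], simplified]
  show ?A using ir(1) unfolding p.L4_def D_upd[OF kT(2)] by blast
  show ?B using ir(2) unfolding D_upd[OF kT(2)] .
qed

lemma D_step_L4:
  assumes "d \<ge> 0"
  shows "PT.L4 (\<lambda>U. D n (Suc k) f U - D (Suc n) k f U) (2 * R\<^sup>2 * (\<kappa> ^ n * d) / sqrt (real (N (Suc k))))"
proof -
  have a1: "adapted (Suc k) (D n (Suc k) f)" and a2: "adapted k (D (Suc n) k f)" using k f by simp_all
  have a: "adapted (Suc k) (\<lambda>U. D n (Suc k) f U - D (Suc n) k f U)"
    using a1 adapted_mono[OF a2, of "Suc k"] by simp
  have "E (\<lambda>U. (D n (Suc k) f U - D (Suc n) k f U)^4) \<le> E (\<lambda>U. (2 * R\<^sup>2 * (\<kappa> ^ n * d) / sqrt (real (N (Suc k))))^4)"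
    using D_step_iid(1) by (intro E_step[OF k adapted_power[OF a] adapted_const]) (simp add: adapted_upd[OF a2])
  moreover have "0 \<le> 2 * R\<^sup>2 * (\<kappa> ^ n * d) / sqrt (real (N (Suc k)))"
    using assms kappa by simp
  ultimately show ?thesis
    unfolding PT.L4_def using adapted_bmf[OF a, of T] k P_facts(4)[of T] by (simp add: PT.prob_space)
qed

text \<open>Any weight \<open>H\<close> known before the step factors out of the conditional mean,
  so only the bias of order \<open>1 / N\<close> remains, where Cauchy-Schwarz with
  \<open>D_step_L4\<close> would leave \<open>1 / sqrt N\<close>.\<close>

lemma D_step_bias:
  assumes H: "adapted k H"
  shows "\<bar>E (\<lambda>U. H U * (D n (Suc k) f U - D (Suc n) k f U))\<bar>
    \<le> E (\<lambda>U. \<bar>H U\<bar>) * (4 * R^4 * (\<kappa> ^ n * d) / real (N (Suc k)))"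
proof -
  define c where "c = 4 * R^4 * (\<kappa> ^ n * d) / real (N (Suc k))"
  have a2: "adapted k (D (Suc n) k f)" using k f by simp
  have a: "adapted (Suc k) (\<lambda>U. D n (Suc k) f U - D (Suc n) k f U)"
    using adapted_mono[OF a2, of "Suc k"] k f by simp
  have *: "E (\<lambda>U. J U * (D n (Suc k) f U - D (Suc n) k f U)) \<le> E (\<lambda>U. \<bar>J U\<bar> * c)" if J: "adapted k J" for J
  proof (rule E_step[OF k])
    show "adapted (Suc k) (\<lambda>U. J U * (D n (Suc k) f U - D (Suc n) k f U))"
      using adapted_mono[OF J, of "Suc k"] a by simp
    show "adapted k (\<lambda>U. \<bar>J U\<bar> * c)" using J by simp
    fix U assume U: "U \<in> space (LS k)"
    define b where "b = (\<integral>V. D n (Suc k) f (U(Suc k := V)) - D (Suc n) k f U \<partial>popl k U)"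
    have "(\<integral>V. J (U(Suc k := V)) * (D n (Suc k) f (U(Suc k := V)) - D (Suc n) k f (U(Suc k := V))) \<partial>popl k U)
      = J U * b"
      unfolding b_def by (simp add: adapted_upd[OF J] adapted_upd[OF a2])
    also have "\<dots> \<le> \<bar>J U\<bar> * \<bar>b\<bar>" by (simp add: abs_mult[symmetric])
    also have "\<dots> \<le> \<bar>J U\<bar> * c" using D_step_iid(2)[OF U] unfolding b_def c_def by (intro mult_left_mono) auto
    finally show "(\<integral>V. J (U(Suc k := V)) * (D n (Suc k) f (U(Suc k := V)) - D (Suc n) k f (U(Suc k := V))) \<partial>popl k U)
      \<le> \<bar>J U\<bar> * c" .
  qed
  \<comment> \<open>The one-sided estimate for \<open>H\<close> and for \<open>- H\<close> yields
    the absolute value.\<close>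
  have "adapted k (\<lambda>U. - 1 * H U)" using H by (intro adapted_mult adapted_const)
  from *[OF this] *[OF H] show ?thesis unfolding c_def[symmetric] by (simp add: abs_le_iff)
qed

end

section \<open>Uniform fourth-moment bounds\<close>

lemma bmf_PT: "bmf (P T) = bmf (LS T)" and space_PT: "space (P T) = space (LS T)"
  by (rule P_facts; simp)+

lemma adapted_PT [simp]: "adapted k F \<Longrightarrow> k \<le> T \<Longrightarrow> F \<in> bmf (P T)"
  unfolding bmf_PT by (rule adapted_bmf)

lemma emp_init_L4:
  assumes \<phi>: "\<phi> \<in> bmf mu" and c: "\<And>u. u \<in> space mu \<Longrightarrow> \<bar>\<phi> u\<bar> \<le> c"
  shows "PT.L4 (\<lambda>U. emp N U 0 \<phi> - (\<integral>u. \<phi> u \<partial>\<eta> 0)) (4 * c / sqrt (real (N 0)))"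
proof -
  interpret e: prob_space "\<eta> 0" by (rule prob_space_eta)
  interpret p: prob_space "e.iid (N 0)" by (rule e.prob_space_iid)
  have a: "adapted 0 (\<lambda>U. emp N U 0 \<phi> - (\<integral>u. \<phi> u \<partial>\<eta> 0))" using \<phi> by simp
  note a4 = adapted_power[OF a, of 4]
  have "E (\<lambda>U. (emp N U 0 \<phi> - (\<integral>u. \<phi> u \<partial>\<eta> 0))^4)
    = (\<integral>U. (emp N U 0 \<phi> - (\<integral>u. \<phi> u \<partial>\<eta> 0))^4 \<partial>P 0)"
    by (rule integral_P_adapted[OF a4]) simp_all
  also have "\<dots> = (\<integral>x. ((\<Sum>i<N 0. \<phi> (x i)) / real (N 0) - (\<integral>u. \<phi> u \<partial>\<eta> 0))^4 \<partial>e.iid (N 0))"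
    by (subst integral_P0[OF adapted_bmf[OF a4 order_refl]]) (simp add: emp_def)
  finally show ?thesis
    using e.iid_mean_L4[of \<phi> c "N 0"] \<phi> c Npos[of 0] adapted_PT[OF a]
    unfolding PT.L4_def p.L4_def by simp
qed

text \<open>No lower bound on \<open>B\<close> is needed: the ratio \<open>r\<close> satisfies
  \<open>r = emp A - r (emp B - 1)\<close> and is itself bounded by \<open>e\<close>.\<close>

lemma ratio_L4:
  assumes p: "p \<le> T" and A: "A \<in> bmf mu" and B: "B \<in> bmf mu"
    and B0: "\<And>u. u \<in> space mu \<Longrightarrow> B u > 0" and B1: "\<And>u. u \<in> space mu \<Longrightarrow> B u \<le> S"
    and AB: "\<And>u. u \<in> space mu \<Longrightarrow> \<bar>A u\<bar> \<le> e * B u"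
    and A_int: "(\<integral>u. A u \<partial>\<eta> p) = 0" and B_int: "(\<integral>u. B u \<partial>\<eta> p) = 1"
    and emp_L4: "\<And>\<phi> c. \<phi> \<in> bmf mu \<Longrightarrow> (\<And>u. u \<in> space mu \<Longrightarrow> \<bar>\<phi> u\<bar> \<le> c) \<Longrightarrow>
      PT.L4 (\<lambda>U. emp N U p \<phi> - (\<integral>u. \<phi> u \<partial>\<eta> p)) (C * c / sqrt (real (N p)))"
  shows "PT.L4 (\<lambda>U. emp N U p A / emp N U p B) (2 * C * S * e / sqrt (real (N p)))"
proof -
  obtain u0 where u0: "u0 \<in> space mu" using space_ne by blast
  have "0 \<le> e * B u0" using AB[OF u0] by linarith
  then have e0: "e \<ge> 0" using B0[OF u0] by (simp add: zero_le_mult_iff)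
  have A1: "\<bar>A u\<bar> \<le> e * S" if "u \<in> space mu" for u
    using AB[OF that] mult_left_mono[OF B1[OF that] e0] by linarith
  have LA: "PT.L4 (\<lambda>U. emp N U p A) (C * (e * S) / sqrt (real (N p)))"
    using emp_L4[OF A A1] by (simp add: A_int)
  have LB: "PT.L4 (\<lambda>U. emp N U p B - 1) (C * S / sqrt (real (N p)))"
    using emp_L4[OF B, of S] B0 B1 by (simp add: B_int abs_of_pos)
  have b: "(\<lambda>U. emp N U p A) \<in> bmf (P T)" "(\<lambda>U. emp N U p B - 1) \<in> bmf (P T)"
    using bmf_diff[OF adapted_PT[OF adapted_emp[OF B] p] bmf_const] adapted_PT[OF adapted_emp[OF A] p] by simp_all
  have "PT.L4 (\<lambda>U. \<bar>emp N U p A\<bar> + e * \<bar>emp N U p B - 1\<bar>)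
      (C * (e * S) / sqrt (real (N p)) + \<bar>e\<bar> * (C * S / sqrt (real (N p))))"
    by (intro PT.L4_add PT.L4_cmult PT.L4_mono[OF LA] PT.L4_mono[OF LB] bmf_abs b) simp_all
  then show ?thesis
  proof (rule PT.L4_mono)
    show "(\<lambda>U. emp N U p A / emp N U p B) \<in> bmf (P T)"
      using adapted_ratio[OF p A B B0 AB] p by simp
    show "C * (e * S) / sqrt (real (N p)) + \<bar>e\<bar> * (C * S / sqrt (real (N p))) \<le> 2 * C * S * e / sqrt (real (N p))"
      using e0 by (simp add: ac_simps)
    fix U assume "U \<in> space (P T)"
    then have U: "U \<in> space (LS T)" by (simp add: space_PT)
    define a b r where "a = emp N U p A" and "b = emp N U p B" and "r = a / b"
    have "b > 0" unfolding b_def using p U B0 by (intro emp_pos)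
    then have "r = a - r * (b - 1)" by (simp add: r_def right_diff_distrib)
    moreover have "\<bar>r\<bar> \<le> e" unfolding r_def a_def b_def using p U B0 AB by (intro emp_ratio_le)
    ultimately have "\<bar>r\<bar> \<le> \<bar>a\<bar> + e * \<bar>b - 1\<bar>"
      using mult_right_mono[of "\<bar>r\<bar>" e "\<bar>b - 1\<bar>"] abs_mult[of r "b - 1"] by linarith
    then show "\<bar>emp N U p A / emp N U p B\<bar> \<le> \<bar>\<bar>emp N U p A\<bar> + e * \<bar>emp N U p B - 1\<bar>\<bar>"
      unfolding r_def a_def b_def by linarith
  qed
qed

text \<open>The bound on empirical means is a hypothesis because it is supplied twice: at level 0
  with constant 4, inside the proof of \<open>emp_L4\<close>, and afterwards at level
  \<open>p\<close> with constant \<open>C0\<close>. Centring of \<open>f\<close> makes the limiting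
  prediction zero.\<close>

lemma D_L4:
  assumes p: "p \<le> T" and f: "f \<in> bmf mu" and f0: "(\<integral>u. f u \<partial>\<eta> (p + n)) = 0"
    and osc: "\<And>u v. u \<in> space mu \<Longrightarrow> v \<in> space mu \<Longrightarrow> f u - f v \<le> d"
    and emp_L4: "\<And>\<phi> c. \<phi> \<in> bmf mu \<Longrightarrow> (\<And>u. u \<in> space mu \<Longrightarrow> \<bar>\<phi> u\<bar> \<le> c) \<Longrightarrow>
      PT.L4 (\<lambda>U. emp N U p \<phi> - (\<integral>u. \<phi> u \<partial>\<eta> p)) (C * c / sqrt (real (N p)))"
  shows "PT.L4 (D n p f) (2 * C * R * (\<kappa> ^ n * d) / sqrt (real (N p)))"
  unfolding D_def
proof (rule ratio_L4[OF p Q_bmf[OF f] Q_bmf[OF bmf_const] Q1_pos Q1_le _ _ Q1_eta emp_L4])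
  show "\<bar>Q n p f u\<bar> \<le> \<kappa> ^ n * d * Q1 n p u" if "u \<in> space mu" for u
    using Q_deviation[OF f osc prob_space_eta[of p] sets_eta refl that, where s=p and n=n] by (simp add: eta_Q f f0 Q1_eta)
  show "(\<integral>u. Q n p f u \<partial>\<eta> p) = 0" by (simp add: eta_Q f f0)
qed

text \<open>The start of the telescoping in \<open>emp_L4\<close> costs \<open>8 * R^2\<close>,
  which also covers the \<open>2 * R^2\<close> of each step; the oscillation \<open>2 * c\<close>
  doubles it, and the geometric series gives \<open>1 / (1 - \<kappa>)\<close>.\<close>

definition C0 :: real where "C0 = 16 * R\<^sup>2 / (1 - \<kappa>)"

lemma C0_ge: "C0 \<ge> 1"
proof -
  have "1 \<le> R\<^sup>2" using R_ge(1) by (simp add: one_le_power)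
  then show ?thesis using kappa unfolding C0_def by (simp add: pos_le_divide_eq)
qed

text \<open>The centred empirical mean at level \<open>q\<close> is the end of the chain of
  predictions \<open>D (q - s) s f\<close>. The step into level \<open>s\<close> is damped by
  \<open>\<kappa> ^ (q - s)\<close>, hence the bound is uniform in \<open>q\<close>.\<close>

lemma emp_L4:
  assumes q: "q \<le> T" and \<phi>: "\<phi> \<in> bmf mu" and c: "\<And>u. u \<in> space mu \<Longrightarrow> \<bar>\<phi> u\<bar> \<le> c"
  shows "PT.L4 (\<lambda>U. emp N U q \<phi> - (\<integral>u. \<phi> u \<partial>\<eta> q)) (C0 * c / sqrt (real (N q)))"
proof -
  interpret e: prob_space "\<eta> q" by (rule prob_space_eta)
  obtain u0 where u0: "u0 \<in> space mu" using space_ne by blast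
  then have c0: "c \<ge> 0" using c[OF u0] by linarith
  define f where "f u = \<phi> u - (\<integral>u. \<phi> u \<partial>\<eta> q)" for u
  have f: "f \<in> bmf mu" unfolding f_def using \<phi> by simp
  have f0: "(\<integral>u. f u \<partial>\<eta> q) = 0" unfolding f_def using \<phi> e.prob_space by simp
  define d where "d = 2 * c"
  have d0: "d \<ge> 0" using c0 by (simp add: d_def)
  have osc: "f u - f v \<le> d" if "u \<in> space mu" "v \<in> space mu" for u v
    using c[OF that(1)] c[OF that(2)] by (simp add: f_def d_def)
  define r where "r = sqrt (real (N q))"
  have r: "r > 0" unfolding r_def using Npos[OF q] by simp
  \<comment> \<open>Earlier populations are at least as large, so every error in the chain can be
    measured at the scale of level \<open>q\<close>.\<close>
  have rN: "x / sqrt (real (N s)) \<le> x / r" if "s \<le> q" "x \<ge> 0" for s x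
    unfolding r_def using that q N_antimono[OF that(1) q] Npos[OF q] by (intro divide_left_mono) auto
  have R2: "R \<le> R\<^sup>2" using R_ge(1) by (simp add: power2_eq_square)
  have "PT.L4 (D (q - s) s f) (8 * R\<^sup>2 * d / r * (\<kappa> ^ q + (\<Sum>i<s. \<kappa> ^ (q - Suc i))))" if "s \<le> q" for s
    using that
  proof (induction s)
    case 0
    have "PT.L4 (D q 0 f) (2 * 4 * R * (\<kappa> ^ q * d) / sqrt (real (N 0)))"
      by (rule D_L4[OF _ f _ osc emp_init_L4]) (use f0 in simp_all)
    moreover have "2 * 4 * R * (\<kappa> ^ q * d) / sqrt (real (N 0)) \<le> 2 * 4 * R * (\<kappa> ^ q * d) / r"
      using R_ge(1) kappa d0 by (intro rN) auto
    moreover have "2 * 4 * R * (\<kappa> ^ q * d) / r \<le> 2 * 4 * R\<^sup>2 * (\<kappa> ^ q * d) / r"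
      using R2 kappa d0 r by (intro divide_right_mono mult_right_mono) auto
    moreover have "D q 0 f \<in> bmf (P T)" by (rule adapted_PT[OF adapted_D[OF _ f]]) simp_all
    ultimately show ?case by (simp add: ac_simps PT.L4_mono[of "D q 0 f"])
  next
    case (Suc s)
    define m where "m = q - Suc s"
    have m: "q - s = Suc m" using Suc.prems by (simp add: m_def)
    have sT: "s < T" using Suc.prems q by simp
    have 1: "PT.L4 (D (Suc m) s f) (8 * R\<^sup>2 * d / r * (\<kappa> ^ q + (\<Sum>i<s. \<kappa> ^ (q - Suc i))))"
      using Suc by (simp add: m)
    have "PT.L4 (\<lambda>U. D m (Suc s) f U - D (Suc m) s f U) (2 * R\<^sup>2 * (\<kappa> ^ m * d) / sqrt (real (N (Suc s))))"
      by (rule D_step_L4[OF sT f osc d0])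
    moreover have "2 * R\<^sup>2 * (\<kappa> ^ m * d) / sqrt (real (N (Suc s))) \<le> 2 * R\<^sup>2 * (\<kappa> ^ m * d) / r"
      using Suc.prems d0 kappa by (intro rN) auto
    moreover have "2 * R\<^sup>2 * (\<kappa> ^ m * d) / r \<le> 8 * R\<^sup>2 * (\<kappa> ^ m * d) / r"
      using d0 kappa r by (intro divide_right_mono mult_right_mono) auto
    moreover have "(\<lambda>U. D m (Suc s) f U - D (Suc m) s f U) \<in> bmf (P T)"
      using sT f by (intro bmf_diff adapted_PT[OF adapted_D]) auto
    ultimately have 2: "PT.L4 (\<lambda>U. D m (Suc s) f U - D (Suc m) s f U) (8 * R\<^sup>2 * (\<kappa> ^ m * d) / r)"
      by (meson PT.L4_mono order_refl order_trans)
    have "PT.L4 (\<lambda>U. D (Suc m) s f U + (D m (Suc s) f U - D (Suc m) s f U))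
      (8 * R\<^sup>2 * d / r * (\<kappa> ^ q + (\<Sum>i<s. \<kappa> ^ (q - Suc i))) + 8 * R\<^sup>2 * (\<kappa> ^ m * d) / r)"
      by (rule PT.L4_add[OF 1 2])
    moreover have "8 * R\<^sup>2 * d / r * (\<kappa> ^ q + (\<Sum>i<s. \<kappa> ^ (q - Suc i))) + 8 * R\<^sup>2 * (\<kappa> ^ m * d) / r
      = 8 * R\<^sup>2 * d / r * (\<kappa> ^ q + (\<Sum>i<Suc s. \<kappa> ^ (q - Suc i)))"
      by (simp add: m_def distrib_left add_divide_distrib ac_simps)
    ultimately show ?case by (simp add: m_def)
  qed
  from this[of q] have L: "PT.L4 (D 0 q f) (8 * R\<^sup>2 * d / r * (\<kappa> ^ q + (\<Sum>i<q. \<kappa> ^ (q - Suc i))))" by simp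
  \<comment> \<open>The initial error contributes the power \<open>q\<close> and the steps the
    powers below it.\<close>
  have "\<kappa> ^ q + (\<Sum>i<q. \<kappa> ^ (q - Suc i)) = (\<Sum>i<Suc q. \<kappa> ^ i)"
    using sum.nat_diff_reindex[of "\<lambda>i. \<kappa> ^ i" q] by simp
  also have "\<dots> \<le> 1 / (1 - \<kappa>)" using kappa by (intro geometric_sum_le) auto
  finally have "8 * R\<^sup>2 * d / r * (\<kappa> ^ q + (\<Sum>i<q. \<kappa> ^ (q - Suc i))) \<le> 8 * R\<^sup>2 * d / r * (1 / (1 - \<kappa>))"
    using d0 r by (intro mult_left_mono) auto
  also have "\<dots> = C0 * c / r" by (simp add: C0_def d_def ac_simps)
  finally have le: "8 * R\<^sup>2 * d / r * (\<kappa> ^ q + (\<Sum>i<q. \<kappa> ^ (q - Suc i))) \<le> C0 * c / r" .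
  have D0: "D 0 q f U = emp N U q \<phi> - (\<integral>u. \<phi> u \<partial>\<eta> q)" for U
    using Npos[OF q] by (simp add: D_def emp_def f_def sum_subtractf diff_divide_distrib)
  have "PT.L4 (D 0 q f) (C0 * c / r)"
    by (rule PT.L4_mono[OF L adapted_PT[OF adapted_D[OF q f] q] order_refl le])
  then show ?thesis unfolding r_def D0[abs_def] .
qed

section \<open>Increments of the estimator\<close>

text \<open>The two coefficients of \<open>cross_linear\<close> and the one of
  \<open>cross_remainder\<close>, added.\<close>

definition C1 :: real where "C1 = 32 * C0\<^sup>2 * R + 64 * C0 * R^4 / (1 - \<kappa>) + 16 * C0^3 * K"

text \<open>The coefficients of the initial, diagonal and cross sums in \<open>mse_bound\<close>:
  each is doubled when the initial error is split off, and the cross terms once more since every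
  pair occurs twice in the square.\<close>

definition C2 :: real where "C2 = 2 * C0\<^sup>2 + 32 * C0\<^sup>2 + 4 * C1"

context
  fixes g :: "'a \<Rightarrow> real" and b :: "nat \<Rightarrow> real"
  assumes g: "g \<in> bmf mu" and g1: "\<And>u. u \<in> space mu \<Longrightarrow> \<bar>g u\<bar> \<le> 1"
    and b: "\<And>p u. p \<le> T \<Longrightarrow> u \<in> space mu \<Longrightarrow> \<bar>W p u - 1\<bar> \<le> b p"
begin

text \<open>Centring uses level \<open>Suc p\<close> because the weight \<open>W p\<close> moves
  \<open>\<eta> p\<close> there; thus \<open>W p * gc p\<close> has mean zero under
  \<open>\<eta> p\<close>.\<close>

definition gc :: "nat \<Rightarrow> 'a \<Rightarrow> real" where
  "gc p u = g u - (\<integral>v. g v \<partial>\<eta> (Suc p))"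

definition ff :: "nat \<Rightarrow> 'a \<Rightarrow> real" where
  "ff p u = gc p u * (W p u - 1)"

text \<open>The error of the reweighted empirical measure at level \<open>p\<close> as an estimator
  of the mean of \<open>g\<close> under \<open>\<eta> (Suc p)\<close>.\<close>

definition tilt :: "nat \<Rightarrow> (nat \<Rightarrow> nat \<Rightarrow> 'a) \<Rightarrow> real" where
  "tilt p U = emp N U p (\<lambda>u. W p u * gc p u) / emp N U p (W p)"

definition lin :: "nat \<Rightarrow> (nat \<Rightarrow> nat \<Rightarrow> 'a) \<Rightarrow> real" where
  "lin p U = emp N U p (ff p) - (\<integral>u. ff p u \<partial>\<eta> p)"

definition wdev :: "nat \<Rightarrow> (nat \<Rightarrow> nat \<Rightarrow> 'a) \<Rightarrow> real" where
  "wdev p U = emp N U p (\<lambda>u. W p u - 1)"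

text \<open>With \<open>A\<close> and \<open>B\<close> the empirical means of
  \<open>W p * gc p\<close> and \<open>W p\<close>, this rests on
  \<open>A / B = A - (B - 1) * (A / B)\<close>. Both terms carry a factor of size
  \<open>b p\<close>: the first through \<open>ff p\<close>, the second through
  \<open>wdev p\<close>.\<close>

definition \<Delta> :: "nat \<Rightarrow> (nat \<Rightarrow> nat \<Rightarrow> 'a) \<Rightarrow> real" where
  "\<Delta> p U = lin p U - wdev p U * tilt p U"

lemma b_nonneg: "p \<le> T \<Longrightarrow> b p \<ge> 0"
  using b space_ne by (meson abs_ge_zero all_not_in_conv order_trans)

lemma gc_bmf: "gc p \<in> bmf mu" unfolding gc_def using g by simp

lemma gc_le:
  assumes u: "u \<in> space mu"
  shows "\<bar>gc p u\<bar> \<le> 2"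
proof -
  interpret prob_space "\<eta> (Suc p)" by (rule prob_space_eta)
  have "\<bar>\<integral>v. g v \<partial>\<eta> (Suc p)\<bar> \<le> 1" using g g1 by (intro integral_abs_le_bound) auto
  then show ?thesis using g1[OF u] unfolding gc_def by linarith
qed

lemma Wgc_int: "(\<integral>u. W p u * gc p u \<partial>\<eta> p) = 0"
proof -
  interpret prob_space "\<eta> (Suc p)" by (rule prob_space_eta)
  have "(\<integral>u. gc p u \<partial>\<eta> (Suc p)) = 0" unfolding gc_def using g prob_space by simp
  then show ?thesis using eta_W[OF bmfD1[OF gc_bmf]] by simp
qed

lemma W_int: "(\<integral>u. W p u \<partial>\<eta> p) = 1"
  using eta_W[of "\<lambda>_. 1" p] prob_space.prob_space[OF prob_space_eta, of "Suc p"] by simp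

lemma ff_bmf: "ff p \<in> bmf mu" unfolding ff_def using gc_bmf by simp

lemma ff_le: "p \<le> T \<Longrightarrow> u \<in> space mu \<Longrightarrow> \<bar>ff p u\<bar> \<le> 2 * b p"
  unfolding ff_def abs_mult using gc_le b b_nonneg by (intro mult_mono) auto

lemma ff_int: "(\<integral>u. ff p u \<partial>\<eta> p) = (\<integral>v. g v \<partial>\<eta> (Suc p)) - (\<integral>v. g v \<partial>\<eta> p)"
proof -
  interpret prob_space "\<eta> p" by (rule prob_space_eta)
  have "(\<integral>u. ff p u \<partial>\<eta> p) = (\<integral>u. W p u * gc p u - gc p u \<partial>\<eta> p)"
    unfolding ff_def by (rule Bochner_Integration.integral_cong) (simp_all add: algebra_simps)
  also have "\<dots> = - (\<integral>u. gc p u \<partial>\<eta> p)"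
    using gc_bmf by (subst Bochner_Integration.integral_diff) (simp_all add: Wgc_int)
  also have "(\<integral>u. gc p u \<partial>\<eta> p) = (\<integral>v. g v \<partial>\<eta> p) - (\<integral>v. g v \<partial>\<eta> (Suc p))"
    unfolding gc_def using g prob_space by simp
  finally show ?thesis by simp
qed

lemma adapted_lin: "adapted p (lin p)"
  unfolding lin_def using ff_bmf by (intro adapted_diff adapted_emp adapted_const)

lemma adapted_wdev: "adapted p (wdev p)"
  unfolding wdev_def by (intro adapted_emp bmf_diff W_bmf bmf_const)

lemma tilt_bound: "u \<in> space mu \<Longrightarrow> \<bar>W p u * gc p u\<bar> \<le> 2 * W p u"
  using gc_le[of u p] W_pos[of u p] by (simp add: abs_mult mult.commute)

lemma adapted_tilt: "p \<le> T \<Longrightarrow> adapted p (tilt p)"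
  unfolding tilt_def using gc_bmf W_pos tilt_bound
  by (intro adapted_ratio[of _ _ _ 2]) auto

lemma adapted_Delta: "p \<le> T \<Longrightarrow> adapted p (\<Delta> p)"
  unfolding \<Delta>_def using adapted_lin adapted_wdev adapted_tilt by (intro adapted_diff adapted_mult)

text \<open>The normalising constants cancel in the quotient, and centring \<open>g\<close> shifts
  it by a constant. What remains beside \<open>\<Delta> p\<close> is the deterministic increment of
  the target means.\<close>

lemma Delta_eq:
  assumes p: "p \<le> T" and U: "U \<in> space (LS T)"
  shows "emp N U p (\<lambda>u. g u * Gw \<gamma> p u) / emp N U p (Gw \<gamma> p) - emp N U p g
    = \<Delta> p U + ((\<integral>v. g v \<partial>\<eta> (Suc p)) - (\<integral>v. g v \<partial>\<eta> p))"
proof -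
  define z where "z = Zc mu \<gamma> p / Zc mu \<gamma> (Suc p)"
  have z: "z > 0" unfolding z_def using Zpos[of p] Zpos[of "Suc p"] by simp
  define m where "m = (\<integral>v. g v \<partial>\<eta> (Suc p))"
  have n: "real (N p) > 0" using Npos[OF p] by simp
  define A B C where "A = emp N U p (\<lambda>u. W p u * gc p u)" and "B = emp N U p (W p)" and "C = emp N U p g"
  have B: "B > 0" unfolding B_def using p U W_pos by (intro emp_pos)
  have e1: "z * emp N U p (Gw \<gamma> p) = B"
    unfolding B_def emp_def W_def z_def[symmetric] by (simp add: sum_distrib_left)
  have "W p u * gc p u = z * (g u * Gw \<gamma> p u) - m * W p u" for u
    unfolding gc_def W_def z_def[symmetric] m_def[symmetric] by (simp add: algebra_simps)
  then have "A = z * emp N U p (\<lambda>u. g u * Gw \<gamma> p u) - m * B"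
    unfolding A_def B_def emp_def by (simp add: sum_subtractf sum_distrib_left diff_divide_distrib)
  then have e2: "z * emp N U p (\<lambda>u. g u * Gw \<gamma> p u) = A + m * B" by simp
  have "ff p u = W p u * gc p u - g u + m" for u
    unfolding ff_def gc_def m_def by (simp add: algebra_simps)
  then have e3: "emp N U p (ff p) = A - C + m"
    unfolding A_def C_def emp_def using n
    by (simp add: sum_subtractf sum.distrib add_divide_distrib diff_divide_distrib)
  have e4: "wdev p U = B - 1"
    unfolding wdev_def B_def emp_def using n by (simp add: sum_subtractf diff_divide_distrib)
  have "emp N U p (\<lambda>u. g u * Gw \<gamma> p u) / emp N U p (Gw \<gamma> p)
    = (z * emp N U p (\<lambda>u. g u * Gw \<gamma> p u)) / (z * emp N U p (Gw \<gamma> p))" using z by simp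
  also have "\<dots> = (A + m * B) / B" unfolding e1 e2 ..
  also have "\<dots> = A / B + m" using B by (simp add: add_divide_distrib)
  finally have r: "emp N U p (\<lambda>u. g u * Gw \<gamma> p u) / emp N U p (Gw \<gamma> p) = A / B + m" .
  have "wdev p U * tilt p U = A - A / B"
    unfolding e4 tilt_def A_def[symmetric] B_def[symmetric] using B by (simp add: left_diff_distrib diff_divide_distrib)
  then show ?thesis
    unfolding \<Delta>_def lin_def r ff_int e3 C_def[symmetric] m_def[symmetric] by simp
qed

lemma tilt_le:
  assumes p: "p \<le> T" and U: "U \<in> space (LS T)"
  shows "\<bar>tilt p U\<bar> \<le> 2"
  unfolding tilt_def using p U W_pos tilt_bound by (intro emp_ratio_le)

section \<open>Sizes and covariances of the increments\<close>

abbreviation rt :: "nat \<Rightarrow> real" where "rt p \<equiv> sqrt (real (N p))"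

lemma lin_L4: "p \<le> T \<Longrightarrow> PT.L4 (lin p) (C0 * (2 * b p) / rt p)"
  unfolding lin_def by (rule emp_L4[OF _ ff_bmf ff_le])

lemma wdev_L4: "p \<le> T \<Longrightarrow> PT.L4 (wdev p) (C0 * b p / rt p)"
proof -
  assume p: "p \<le> T"
  interpret prob_space "\<eta> p" by (rule prob_space_eta)
  have "(\<integral>u. W p u - 1 \<partial>\<eta> p) = 0" using W_int[of p] prob_space by simp
  moreover have "PT.L4 (\<lambda>U. emp N U p (\<lambda>u. W p u - 1) - (\<integral>u. W p u - 1 \<partial>\<eta> p)) (C0 * b p / sqrt (real (N p)))"
    using b[OF p] by (intro emp_L4[OF p]) auto
  ultimately show ?thesis unfolding wdev_def by simp
qed

lemma tilt_L4: "p \<le> T \<Longrightarrow> PT.L4 (tilt p) (4 * C0 * K / rt p)"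
proof -
  assume p: "p \<le> T"
  have "PT.L4 (tilt p) (2 * C0 * K * 2 / rt p)"
    unfolding tilt_def
    by (rule ratio_L4[OF p _ W_bmf W_pos W_le tilt_bound Wgc_int W_int emp_L4[OF p]])
      (use gc_bmf in auto)
  then show ?thesis by (simp add: ac_simps)
qed

text \<open>The pathwise bound 2 on \<open>tilt p\<close> makes the remainder no larger in order
  than the linear term; the finer rate of \<open>tilt_L4\<close> is kept for the
  covariances.\<close>

lemma Delta_L4: "p \<le> T \<Longrightarrow> PT.L4 (\<Delta> p) (4 * C0 * b p / rt p)"
proof -
  assume p: "p \<le> T"
  have "PT.L4 (\<lambda>U. wdev p U * tilt p U) (\<bar>2\<bar> * (C0 * b p / rt p))"
  proof (rule PT.L4_mono[OF PT.L4_cmult[OF wdev_L4[OF p], of 2] _ _ order_refl])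
    show "(\<lambda>U. wdev p U * tilt p U) \<in> bmf (P T)"
      by (rule adapted_PT[OF adapted_mult[OF adapted_wdev adapted_tilt[OF p]] p])
    show "\<bar>wdev p U * tilt p U\<bar> \<le> \<bar>2 * wdev p U\<bar>" if "U \<in> space (P T)" for U
      using mult_left_mono[OF tilt_le[OF p, of U], of "\<bar>wdev p U\<bar>"] that
      by (simp add: abs_mult space_PT mult.commute)
  qed
  from PT.L4_diff[OF lin_L4[OF p] this] have "PT.L4 (\<Delta> p) (C0 * (2 * b p) / rt p + \<bar>2\<bar> * (C0 * b p / rt p))"
    unfolding \<Delta>_def .
  then show ?thesis by (simp add: ac_simps)
qed

text \<open>The linear term at level \<open>q\<close> is traced back through its predictions to
  level \<open>p\<close>. There both factors fluctuate at scale \<open>1 / sqrt (N p)\<close> and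
  the prediction is damped by \<open>\<kappa> ^ (q - p)\<close>, giving the first term. Each later
  step is averaged against \<open>\<Delta> p\<close>, so only its bias enters, giving the
  second.\<close>

lemma cross_linear:
  assumes pq: "p < q" and q: "q \<le> T"
  shows "\<bar>E (\<lambda>U. \<Delta> p U * lin q U)\<bar>
    \<le> 32 * C0\<^sup>2 * R * (b p * b q * (\<kappa> ^ (q - p) / real (N p)))
      + 64 * C0 * R^4 / (1 - \<kappa>) * (b p * b q * (1 / (rt p * real (N q))))"
proof -
  have p: "p \<le> T" using pq q by simp
  interpret e: prob_space "\<eta> q" by (rule prob_space_eta)
  define n where "n = q - p"
  define f where "f u = ff q u - (\<integral>u. ff q u \<partial>\<eta> q)" for u
  have f: "f \<in> bmf mu" unfolding f_def using ff_bmf by simp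
  have f0: "(\<integral>u. f u \<partial>\<eta> q) = 0" unfolding f_def using ff_bmf e.prob_space by simp
  \<comment> \<open>Twice the bound \<open>2 * b q\<close> on \<open>ff q\<close>, hence a bound on
    the oscillation.\<close>
  define d where "d = 4 * b q"
  have osc: "f u - f v \<le> d" if "u \<in> space mu" "v \<in> space mu" for u v
    using ff_le[OF q that(1)] ff_le[OF q that(2)] by (simp add: f_def d_def)
  have d0: "d \<ge> 0" using b_nonneg[OF q] by (simp add: d_def)
  define X where "X j = D (n - j) (p + j) f" for j
  define a where "a = 4 * C0 * b p / rt p"
  define t where "t = 4 * R^4 * d / real (N q)"
  define z where "z = a * (2 * C0 * R * (\<kappa> ^ n * d) / rt p)"
  define G where "G j = a * t * (\<Sum>i<j. \<kappa> ^ (n - Suc i))" for j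
  have a0: "a \<ge> 0" unfolding a_def using C0_ge b_nonneg[OF p] by simp
  have t0: "t \<ge> 0" unfolding t_def using d0 by simp
  have Db: "\<Delta> p \<in> bmf (P T)" by (rule adapted_PT[OF adapted_Delta[OF p] p])
  have Xb: "X j \<in> bmf (P T)" if "j \<le> n" for j
    unfolding X_def using that q pq by (intro adapted_PT[OF adapted_D[OF _ f]]) (auto simp: n_def)
  have X0: "\<bar>E (\<lambda>U. \<Delta> p U * X 0 U)\<bar> \<le> z"
  proof -
    have pn: "p + n = q" using pq by (simp add: n_def)
    have X0_eq: "X 0 = D n p f" by (simp add: X_def)
    have "PT.L4 (X 0) (2 * C0 * R * (\<kappa> ^ n * d) / rt p)"
      unfolding X0_eq by (rule D_L4[OF p f f0[folded pn] osc emp_L4[OF p]])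
    from PT.L4_mult[OF Delta_L4[OF p] this] show ?thesis
      unfolding z_def a_def by (rule order_trans[OF integral_abs_bound])
  qed
  have "\<bar>E (\<lambda>U. \<Delta> p U * X j U)\<bar> \<le> z + G j"
    if "j \<le> n" for j
    using that
  proof (induction j)
    case 0
    then show ?case using X0 by (simp add: G_def)
  next
    case (Suc j)
    define m where "m = n - Suc j"
    have m: "n - j = Suc m" using Suc.prems by (simp add: m_def)
    have jT: "p + j < T" "Suc (p + j) \<le> q" using Suc.prems q pq by (auto simp: n_def)
    have Xj: "X j = D (Suc m) (p + j) f" "X (Suc j) = D m (Suc (p + j)) f"
      unfolding X_def m by (simp_all add: m_def)
    have i1: "\<bar>E (\<lambda>U. \<Delta> p U * (X (Suc j) U - X j U))\<bar>
      \<le> E (\<lambda>U. \<bar>\<Delta> p U\<bar>) * (4 * R^4 * (\<kappa> ^ m * d) / real (N (Suc (p + j))))"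
      unfolding Xj
      by (rule D_step_bias[OF jT(1) f osc adapted_mono[OF adapted_Delta[OF p]]]) simp_all
    have i2: "E (\<lambda>U. \<bar>\<Delta> p U\<bar>) * (4 * R^4 * (\<kappa> ^ m * d) / real (N (Suc (p + j))))
      \<le> a * (4 * R^4 * (\<kappa> ^ m * d) / real (N q))"
    proof (rule mult_mono)
      show "E (\<lambda>U. \<bar>\<Delta> p U\<bar>) \<le> a" unfolding a_def by (rule PT.L4_abs[OF Delta_L4[OF p]])
      have "0 \<le> 4 * R^4 * (\<kappa> ^ m * d)" using kappa(1) d0 by simp
      moreover have "0 < real (N q)" "real (N q) \<le> real (N (Suc (p + j)))"
        using N_antimono[OF jT(2) q] Npos[OF q] by simp_all
      ultimately show "4 * R^4 * (\<kappa> ^ m * d) / real (N (Suc (p + j))) \<le> 4 * R^4 * (\<kappa> ^ m * d) / real (N q)"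
        by (intro frac_le order_refl)
      show "0 \<le> 4 * R^4 * (\<kappa> ^ m * d) / real (N (Suc (p + j)))"
        using \<open>0 \<le> 4 * R^4 * (\<kappa> ^ m * d)\<close> by (rule divide_nonneg_nonneg) simp
    qed (rule a0)
    have i3: "a * (4 * R^4 * (\<kappa> ^ m * d) / real (N q)) = a * t * \<kappa> ^ m" by (simp add: t_def)
    have "\<bar>E (\<lambda>U. \<Delta> p U * (X (Suc j) U - X j U))\<bar> \<le> a * t * \<kappa> ^ m"
      using order_trans[OF i1 i2] unfolding i3 .
    moreover have "E (\<lambda>U. \<Delta> p U * (X (Suc j) U - X j U)) = E (\<lambda>U. \<Delta> p U * X (Suc j) U) - E (\<lambda>U. \<Delta> p U * X j U)"
      unfolding right_diff_distrib
      by (intro Bochner_Integration.integral_diff PT.bmf_integrable bmf_mult Db Xb Suc.prems Suc_leD)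
    moreover have "\<bar>E (\<lambda>U. \<Delta> p U * X j U)\<bar> \<le> z + G j"
      using Suc by simp
    moreover have "G (Suc j) = G j + a * t * \<kappa> ^ m"
      by (simp add: G_def m_def distrib_left)
    ultimately show ?case by arith
  qed
  then have j1: "\<bar>E (\<lambda>U. \<Delta> p U * X n U)\<bar> \<le> z + G n" by blast
  have j2: "G n \<le> a * t * (1 / (1 - \<kappa>))"
  proof -
    have "(\<Sum>i<n. \<kappa> ^ (n - Suc i)) \<le> 1 / (1 - \<kappa>)"
      using kappa sum.nat_diff_reindex[of "\<lambda>i. \<kappa> ^ i" n] geometric_sum_le[of \<kappa> n] by simp
    then show ?thesis unfolding G_def using a0 t0 by (intro mult_left_mono) simp_all
  qed
  \<comment> \<open>At \<open>n\<close> no steps remain, so the denominator is the empirical mean of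
    the constant 1.\<close>
  have j3: "X n = lin q"
    using Npos[OF q] pq
    by (simp add: X_def n_def lin_def D_def emp_def f_def sum_subtractf diff_divide_distrib fun_eq_iff)
  have j4: "z = 32 * C0\<^sup>2 * R * (b p * b q * (\<kappa> ^ (q - p) / real (N p)))"
  proof -
    have "z = (4 * C0 * b p * (2 * C0 * R * (\<kappa> ^ n * d))) / (rt p * rt p)"
      by (simp add: z_def a_def)
    also have "\<dots> = (4 * C0 * b p * (2 * C0 * R * (\<kappa> ^ (q - p) * (4 * b q)))) / real (N p)"
      unfolding d_def n_def by simp
    also have "4 * C0 * b p * (2 * C0 * R * (\<kappa> ^ (q - p) * (4 * b q))) = 32 * C0\<^sup>2 * R * (b p * b q * \<kappa> ^ (q - p))"
      by algebra
    finally show ?thesis by simp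
  qed
  have j5: "a * t * (1 / (1 - \<kappa>)) = 64 * C0 * R^4 / (1 - \<kappa>) * (b p * b q * (1 / (rt p * real (N q))))"
  proof -
    have "a * t * (1 / (1 - \<kappa>)) = (4 * C0 * b p * (4 * R^4 * (4 * b q))) / (rt p * real (N q) * (1 - \<kappa>))"
      by (simp add: a_def t_def d_def)
    also have "4 * C0 * b p * (4 * R^4 * (4 * b q)) = 64 * C0 * R^4 * (b p * b q)" by algebra
    finally show ?thesis by simp
  qed
  show ?thesis using order_trans[OF j1 add_left_mono[OF j2]] unfolding j3 j4 j5 .
qed

text \<open>Here \<open>wdev q\<close> and \<open>tilt q\<close> each contribute
  \<open>1 / sqrt (N q)\<close>, which is the reason for \<open>L4_mult3\<close>.\<close>

lemma cross_remainder:
  assumes p: "p \<le> T" and q: "q \<le> T"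
  shows "\<bar>E (\<lambda>U. \<Delta> p U * (wdev q U * tilt q U))\<bar>
    \<le> 16 * C0^3 * K * (b p * b q * (1 / (rt p * real (N q))))"
proof -
  have "\<bar>E (\<lambda>U. \<Delta> p U * (wdev q U * tilt q U))\<bar>
    \<le> (4 * C0 * b p / rt p) * ((C0 * b q / rt q) * (4 * C0 * K / rt q))"
    using PT.L4_mult3[OF Delta_L4[OF p] wdev_L4[OF q] tilt_L4[OF q]]
    by (rule order_trans[OF integral_abs_bound])
  also have "\<dots> = (4 * C0 * b p * (C0 * b q * (4 * C0 * K))) / (rt p * (rt q * rt q))" by simp
  also have "\<dots> = 16 * C0^3 * K * (b p * b q * (1 / (rt p * real (N q))))"
    by (simp add: power3_eq_cube ac_simps)
  finally show ?thesis .
qed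

lemma cross_bound:
  assumes pq: "p < q" and q: "q \<le> T"
  shows "E (\<lambda>U. \<Delta> p U * \<Delta> q U)
    \<le> C1 * (b p * b q * (\<kappa> ^ (q - p) / real (N p) + 1 / (rt p * real (N q))))"
proof -
  have p: "p \<le> T" using pq q by simp
  have bm: "\<Delta> p \<in> bmf (P T)" "lin q \<in> bmf (P T)" "(\<lambda>U. wdev q U * tilt q U) \<in> bmf (P T)"
    using adapted_PT[OF adapted_Delta[OF p] p] adapted_PT[OF adapted_lin q]
      adapted_PT[OF adapted_mult[OF adapted_wdev adapted_tilt[OF q]] q] by blast+
  have split: "E (\<lambda>U. \<Delta> p U * \<Delta> q U) = E (\<lambda>U. \<Delta> p U * lin q U) - E (\<lambda>U. \<Delta> p U * (wdev q U * tilt q U))"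
    unfolding \<Delta>_def[of q] right_diff_distrib
    using bmf_mult[OF bm(1,2)] bmf_mult[OF bm(1,3)]
    by (intro Bochner_Integration.integral_diff PT.bmf_integrable)
  define x where "x = b p * b q * (\<kappa> ^ (q - p) / real (N p))"
  define y where "y = b p * b q * (1 / (rt p * real (N q)))"
  have xy: "x \<ge> 0" "y \<ge> 0" unfolding x_def y_def using b_nonneg p q kappa by auto
  have c: "32 * C0\<^sup>2 * R \<ge> 0" "64 * C0 * R^4 / (1 - \<kappa>) \<ge> 0" "16 * C0^3 * K \<ge> 0"
    using C0_ge R_ge(1) K1 kappa by auto
  define c1 c2 c3 where "c1 = 32 * C0\<^sup>2 * R" and "c2 = 64 * C0 * R^4 / (1 - \<kappa>)" and "c3 = 16 * C0^3 * K"
  have C1: "C1 = c1 + c2 + c3" unfolding C1_def c1_def c2_def c3_def ..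
  have "E (\<lambda>U. \<Delta> p U * \<Delta> q U) \<le> (c1 * x + c2 * y) + c3 * y"
    using cross_linear[OF pq q] cross_remainder[OF p q] split
    unfolding x_def[symmetric] y_def[symmetric] c1_def[symmetric] c2_def[symmetric] c3_def[symmetric] by linarith
  moreover have "c1 * x \<le> C1 * x" "(c2 + c3) * y \<le> C1 * y"
    using xy c[folded c1_def c2_def c3_def] unfolding C1 by (auto intro!: mult_right_mono)
  ultimately have "E (\<lambda>U. \<Delta> p U * \<Delta> q U) \<le> C1 * x + C1 * y"
    by (simp only: distrib_right)
  also have "C1 * x + C1 * y = C1 * (b p * b q * (\<kappa> ^ (q - p) / real (N p) + 1 / (rt p * real (N q))))"
    unfolding x_def y_def by (simp only: distrib_left)
  finally show ?thesis .
qed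

lemma diag_bound:
  assumes p: "p \<le> T"
  shows "E (\<lambda>U. (\<Delta> p U)\<^sup>2) \<le> 16 * C0\<^sup>2 * ((b p)\<^sup>2 * (1 / real (N p)))"
proof -
  have "(4 * C0 * b p / rt p)\<^sup>2 = 16 * C0\<^sup>2 * ((b p)\<^sup>2 * (1 / real (N p)))"
    by (simp add: power_divide power_mult_distrib)
  then show ?thesis using PT.L4_imp_L2[OF Delta_L4[OF p]] by metis
qed

text \<open>The deterministic increments of the target means telescope; the index \<open>p\<close>
  stands for \<open>l - 1\<close>.\<close>

lemma Yhat_eq:
  assumes U: "U \<in> space (LS T)"
  shows "Yhat \<gamma> N (Suc T) g U - (\<integral>u. g u \<partial>\<eta> (Suc T))
    = (emp N U 0 g - (\<integral>u. g u \<partial>\<eta> 0)) + (\<Sum>p\<le>T. \<Delta> p U)"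
proof -
  have "(\<Sum>l\<in>{1..Suc T}. emp N U (l - 1) (\<lambda>u. g u * Gw \<gamma> (l - 1) u) / emp N U (l - 1) (Gw \<gamma> (l - 1)) - emp N U (l - 1) g)
    = (\<Sum>p\<le>T. emp N U p (\<lambda>u. g u * Gw \<gamma> p u) / emp N U p (Gw \<gamma> p) - emp N U p g)"
    by (rule sum.reindex_bij_witness[where i=Suc and j="\<lambda>l. l - 1"]) auto
  also have "\<dots> = (\<Sum>p\<le>T. \<Delta> p U + ((\<integral>v. g v \<partial>\<eta> (Suc p)) - (\<integral>v. g v \<partial>\<eta> p)))"
    using Delta_eq[OF _ U] by (intro sum.cong) auto
  also have "\<dots> = (\<Sum>p\<le>T. \<Delta> p U) + ((\<integral>v. g v \<partial>\<eta> (Suc T)) - (\<integral>v. g v \<partial>\<eta> 0))"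
    using sum_lessThan_telescope[of "\<lambda>p. \<integral>v. g v \<partial>\<eta> p" "Suc T"]
    by (simp only: sum.distrib lessThan_Suc_atMost)
  finally show ?thesis unfolding Yhat_def by simp
qed

lemma mse_bound:
  defines "F \<equiv> \<lambda>U. (emp N U 0 g - (\<integral>u. g u \<partial>\<eta> 0)) + (\<Sum>p\<le>T. \<Delta> p U)"
  shows "F \<in> bmf (P T)"
    and "E (\<lambda>U. (F U)\<^sup>2) \<le> C2 * (1 / real (N 0) + (\<Sum>p\<le>T. (b p)\<^sup>2 * (1 / real (N p)))
      + (\<Sum>p\<le>T. \<Sum>q\<in>{p<..T}. b p * b q * (\<kappa> ^ (q - p) / real (N p) + 1 / (rt p * real (N q)))))"
proof -
  define X where "X U = emp N U 0 g - (\<integral>u. g u \<partial>\<eta> 0)" for U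
  define Y where "Y U = (\<Sum>p\<le>T. \<Delta> p U)" for U
  have F: "F U = X U + Y U" for U by (simp add: F_def X_def Y_def)
  have Db: "\<Delta> p \<in> bmf (P T)" if "p \<le> T" for p
    by (rule adapted_PT[OF adapted_Delta[OF that] that])
  have Yb: "Y \<in> bmf (P T)" unfolding Y_def using Db by (intro bmf_sum) simp
  have Xb: "X \<in> bmf (P T)" unfolding X_def
    by (rule adapted_PT[of 0]) (use g in simp_all)
  show "F \<in> bmf (P T)" unfolding F using Xb Yb by (rule bmf_add)
  have iX: "integrable (P T) (\<lambda>U. (X U)\<^sup>2)" and iY: "integrable (P T) (\<lambda>U. (Y U)\<^sup>2)"
    by (rule PT.bmf_integrable[OF bmf_power[OF Xb]], rule PT.bmf_integrable[OF bmf_power[OF Yb]])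
  have iD: "integrable (P T) (\<lambda>U. (\<Delta> p U)\<^sup>2)" if "p \<le> T" for p
    using Db[OF that] by (intro PT.bmf_integrable bmf_power)
  have iDD: "integrable (P T) (\<lambda>U. \<Delta> p U * \<Delta> q U)" if "p \<le> T" "q \<le> T" for p q
    using Db[OF that(1)] Db[OF that(2)] by (intro PT.bmf_integrable bmf_mult)
  define S1 where "S1 = (\<Sum>p\<le>T. (b p)\<^sup>2 * (1 / real (N p)))"
  define S2 where "S2 = (\<Sum>p\<le>T. \<Sum>q\<in>{p<..T}. b p * b q * (\<kappa> ^ (q - p) / real (N p) + 1 / (rt p * real (N q))))"
  have b0: "b p \<ge> 0" if "p \<le> T" for p using b_nonneg[OF that] .
  have S1: "S1 \<ge> 0" unfolding S1_def by (intro sum_nonneg) simp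
  have S2: "S2 \<ge> 0" unfolding S2_def using b0 kappa(1) by (intro sum_nonneg mult_nonneg_nonneg add_nonneg_nonneg) simp_all
  have EX: "E (\<lambda>U. (X U)\<^sup>2) \<le> C0\<^sup>2 * (1 / real (N 0))"
  proof -
    have "PT.L4 X (C0 * 1 / rt 0)" unfolding X_def by (rule emp_L4[OF _ g g1]) simp_all
    from PT.L4_imp_L2[OF this] show ?thesis by (simp add: power_divide)
  qed
  have "E (\<lambda>U. (Y U)\<^sup>2) = (\<Sum>p\<le>T. E (\<lambda>U. (\<Delta> p U)\<^sup>2)) + 2 * (\<Sum>p\<le>T. \<Sum>q\<in>{p<..T}. E (\<lambda>U. \<Delta> p U * \<Delta> q U))"
  proof (rule has_bochner_integral_integral_eq)
    show "has_bochner_integral (P T) (\<lambda>U. (Y U)\<^sup>2)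
      ((\<Sum>p\<le>T. E (\<lambda>U. (\<Delta> p U)\<^sup>2)) + 2 * (\<Sum>p\<le>T. \<Sum>q\<in>{p<..T}. E (\<lambda>U. \<Delta> p U * \<Delta> q U)))"
      unfolding Y_def square_sum_split
      by (intro has_bochner_integral_add has_bochner_integral_mult_right has_bochner_integral_sum
          has_bochner_integral_integrable iD iDD) simp_all
  qed
  moreover have "(\<Sum>p\<le>T. E (\<lambda>U. (\<Delta> p U)\<^sup>2)) \<le> 16 * C0\<^sup>2 * S1"
    unfolding S1_def sum_distrib_left using diag_bound by (intro sum_mono) simp
  moreover have "(\<Sum>p\<le>T. \<Sum>q\<in>{p<..T}. E (\<lambda>U. \<Delta> p U * \<Delta> q U)) \<le> C1 * S2"
    unfolding S2_def sum_distrib_left using cross_bound by (intro sum_mono) simp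
  ultimately have EY: "E (\<lambda>U. (Y U)\<^sup>2) \<le> 16 * C0\<^sup>2 * S1 + 2 * (C1 * S2)" by linarith
  have C1: "C1 \<ge> 0" unfolding C1_def using C0_ge R_ge(1) K1 kappa
    by (intro add_nonneg_nonneg mult_nonneg_nonneg divide_nonneg_nonneg) simp_all
  \<comment> \<open>The initial error is separated by \<open>(x + y)^2 \<le> 2 x^2 + 2 y^2\<close>,
    as its square already has the order \<open>1 / N 0\<close>; only covariances among the
    increments call for the finer analysis.\<close>
  have "E (\<lambda>U. (F U)\<^sup>2) \<le> E (\<lambda>U. 2 * (X U)\<^sup>2 + 2 * (Y U)\<^sup>2)"
  proof (rule integral_mono)
    show "integrable (P T) (\<lambda>U. (F U)\<^sup>2)"
      using \<open>F \<in> bmf (P T)\<close> by (intro PT.bmf_integrable bmf_power)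
    show "integrable (P T) (\<lambda>U. 2 * (X U)\<^sup>2 + 2 * (Y U)\<^sup>2)" using iX iY by simp
    show "(F U)\<^sup>2 \<le> 2 * (X U)\<^sup>2 + 2 * (Y U)\<^sup>2" for U
      unfolding F using sum_squares_bound[of "X U" "Y U"] by (simp add: power2_sum)
  qed
  also have "E (\<lambda>U. 2 * (X U)\<^sup>2 + 2 * (Y U)\<^sup>2) = 2 * E (\<lambda>U. (X U)\<^sup>2) + 2 * E (\<lambda>U. (Y U)\<^sup>2)"
    using iX iY by simp
  also have "\<dots> \<le> 2 * C0\<^sup>2 * (1 / real (N 0)) + 32 * C0\<^sup>2 * S1 + 4 * C1 * S2"
    using EX EY by linarith
  also have "\<dots> \<le> C2 * (1 / real (N 0)) + C2 * S1 + C2 * S2"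
    unfolding C2_def using S1 S2 C1 by (intro add_mono mult_right_mono) simp_all
  also have "\<dots> = C2 * (1 / real (N 0) + S1 + S2)" by (simp only: distrib_left)
  finally show "E (\<lambda>U. (F U)\<^sup>2) \<le> C2 * (1 / real (N 0) + (\<Sum>p\<le>T. (b p)\<^sup>2 * (1 / real (N p)))
      + (\<Sum>p\<le>T. \<Sum>q\<in>{p<..T}. b p * b q * (\<kappa> ^ (q - p) / real (N p) + 1 / (rt p * real (N q)))))"
    unfolding S1_def S2_def .
qed

lemma mse_bound_ennreal:
  "(\<integral>\<^sup>+U. ennreal ((Yhat \<gamma> N (Suc T) g U - (\<integral>u. g u \<partial>\<eta> (Suc T)))\<^sup>2) \<partial>P T)
    \<le> ennreal C2 * (ennreal (1 / real (N 0)) + (\<Sum>p\<le>T. (ennreal (b p))\<^sup>2 * ennreal (1 / real (N p)))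
      + (\<Sum>p\<le>T. \<Sum>q\<in>{p<..T}. ennreal (b p) * ennreal (b q) * ennreal (\<kappa> ^ (q - p) / real (N p) + 1 / (rt p * real (N q)))))"
proof -
  define F where "F U = (emp N U 0 g - (\<integral>u. g u \<partial>\<eta> 0)) + (\<Sum>p\<le>T. \<Delta> p U)" for U
  note F = mse_bound[folded F_def]
  have b0: "b p \<ge> 0" if "p \<le> T" for p using b_nonneg[OF that] .
  have "(\<integral>\<^sup>+U. ennreal ((Yhat \<gamma> N (Suc T) g U - (\<integral>u. g u \<partial>\<eta> (Suc T)))\<^sup>2) \<partial>P T)
    = (\<integral>\<^sup>+U. ennreal ((F U)\<^sup>2) \<partial>P T)"
    unfolding F_def using Yhat_eq by (intro nn_integral_cong) (simp add: space_PT)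
  also have "\<dots> = ennreal (E (\<lambda>U. (F U)\<^sup>2))"
    using F(1) by (intro nn_integral_eq_integral PT.bmf_integrable bmf_power) simp_all
  also have "\<dots> \<le> ennreal (C2 * (1 / real (N 0) + (\<Sum>p\<le>T. (b p)\<^sup>2 * (1 / real (N p)))
      + (\<Sum>p\<le>T. \<Sum>q\<in>{p<..T}. b p * b q * (\<kappa> ^ (q - p) / real (N p) + 1 / (rt p * real (N q))))))"
    by (rule ennreal_leI[OF F(2)])
  also have "\<dots> = ennreal C2 * (ennreal (1 / real (N 0)) + ennreal (\<Sum>p\<le>T. (b p)\<^sup>2 * (1 / real (N p)))
      + ennreal (\<Sum>p\<le>T. \<Sum>q\<in>{p<..T}. b p * b q * (\<kappa> ^ (q - p) / real (N p) + 1 / (rt p * real (N q)))))"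
  proof -
    have "0 \<le> (\<Sum>p\<le>T. (b p)\<^sup>2 * (1 / real (N p)))" by (intro sum_nonneg) simp
    moreover have "0 \<le> (\<Sum>p\<le>T. \<Sum>q\<in>{p<..T}. b p * b q * (\<kappa> ^ (q - p) / real (N p) + 1 / (rt p * real (N q))))"
      using b0 kappa(1) by (intro sum_nonneg mult_nonneg_nonneg add_nonneg_nonneg) simp_all
    ultimately show ?thesis by (simp add: ennreal_mult'' ennreal_plus)
  qed
  also have "ennreal (\<Sum>p\<le>T. (b p)\<^sup>2 * (1 / real (N p))) = (\<Sum>p\<le>T. (ennreal (b p))\<^sup>2 * ennreal (1 / real (N p)))"
  proof -
    have "(ennreal (b p))\<^sup>2 * ennreal (1 / real (N p)) = ennreal ((b p)\<^sup>2 * (1 / real (N p)))" if "p \<le> T" for p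
      using b0[OF that] by (subst ennreal_mult) (simp_all add: ennreal_power)
    then have "(\<Sum>p\<le>T. (ennreal (b p))\<^sup>2 * ennreal (1 / real (N p))) = (\<Sum>p\<le>T. ennreal ((b p)\<^sup>2 * (1 / real (N p))))"
      by (intro sum.cong) simp_all
    also have "\<dots> = ennreal (\<Sum>p\<le>T. (b p)\<^sup>2 * (1 / real (N p)))" by (rule sum_ennreal) simp
    finally show ?thesis by (rule sym)
  qed
  also have "ennreal (\<Sum>p\<le>T. \<Sum>q\<in>{p<..T}. b p * b q * (\<kappa> ^ (q - p) / real (N p) + 1 / (rt p * real (N q))))
    = (\<Sum>p\<le>T. \<Sum>q\<in>{p<..T}. ennreal (b p) * ennreal (b q) * ennreal (\<kappa> ^ (q - p) / real (N p) + 1 / (rt p * real (N q))))"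
  proof -
    have nn: "0 \<le> \<kappa> ^ (q - p) / real (N p) + 1 / (rt p * real (N q))" for p q
      using kappa(1) by (intro add_nonneg_nonneg) simp_all
    have "ennreal (b p) * ennreal (b q) * ennreal (\<kappa> ^ (q - p) / real (N p) + 1 / (rt p * real (N q)))
      = ennreal (b p * b q * (\<kappa> ^ (q - p) / real (N p) + 1 / (rt p * real (N q))))"
      if "p \<le> T" "q \<le> T" for p q
      using b0[OF that(1)] b0[OF that(2)] nn by (simp only: ennreal_mult'')
    then have "(\<Sum>p\<le>T. \<Sum>q\<in>{p<..T}. ennreal (b p) * ennreal (b q) * ennreal (\<kappa> ^ (q - p) / real (N p) + 1 / (rt p * real (N q))))
      = (\<Sum>p\<le>T. \<Sum>q\<in>{p<..T}. ennreal (b p * b q * (\<kappa> ^ (q - p) / real (N p) + 1 / (rt p * real (N q)))))"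
      by (intro sum.cong) simp_all
    also have "\<dots> = (\<Sum>p\<le>T. ennreal (\<Sum>q\<in>{p<..T}. b p * b q * (\<kappa> ^ (q - p) / real (N p) + 1 / (rt p * real (N q)))))"
      using b0 nn by (intro sum.cong sum_ennreal mult_nonneg_nonneg) simp_all
    also have "\<dots> = ennreal (\<Sum>p\<le>T. \<Sum>q\<in>{p<..T}. b p * b q * (\<kappa> ^ (q - p) / real (N p) + 1 / (rt p * real (N q))))"
      using b0 nn by (intro sum_ennreal sum_nonneg mult_nonneg_nonneg) simp_all
    finally show ?thesis by (rule sym)
  qed
  finally show ?thesis .
qed

end

end

section \<open>The mean squared error\<close>

lemma supnorm_bound:
  assumes "supnorm mu f \<noteq> \<top>" "u \<in> space mu"
  shows "\<bar>f u\<bar> \<le> enn2real (supnorm mu f)"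
proof -
  have "ennreal \<bar>f u\<bar> \<le> supnorm mu f" unfolding supnorm_def using assms(2) by (rule SUP_upper)
  also have "\<dots> = ennreal (enn2real (supnorm mu f))" using assms(1) by (simp add: top.not_eq_extremum)
  finally show ?thesis by (simp add: ennreal_le_iff)
qed

text \<open>The ratio of consecutive normalising constants is a mean of
  \<open>Gw \<gamma> l\<close>, so it inherits the bounds of (A1).\<close>

lemma Zc_Suc_bounds:
  assumes integ: "\<And>l. integrable mu (\<gamma> l)" and gpos: "\<And>l u. u \<in> space mu \<Longrightarrow> \<gamma> l u > 0"
    and G: "\<And>u. u \<in> space mu \<Longrightarrow> Clo \<le> Gw \<gamma> l u \<and> Gw \<gamma> l u \<le> Chi"
  shows "Clo * Zc mu \<gamma> l \<le> Zc mu \<gamma> (Suc l)" "Zc mu \<gamma> (Suc l) \<le> Chi * Zc mu \<gamma> l"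
proof -
  have "Clo * \<gamma> l u \<le> \<gamma> (Suc l) u \<and> \<gamma> (Suc l) u \<le> Chi * \<gamma> l u" if "u \<in> space mu" for u
    using G[OF that] gpos[OF that, of l] unfolding Gw_def by (simp add: pos_le_divide_eq pos_divide_le_eq)
  then have "(\<integral>u. Clo * \<gamma> l u \<partial>mu) \<le> Zc mu \<gamma> (Suc l)" "Zc mu \<gamma> (Suc l) \<le> (\<integral>u. Chi * \<gamma> l u \<partial>mu)"
    unfolding Zc_def using integ by (intro integral_mono; simp)+
  then show "Clo * Zc mu \<gamma> l \<le> Zc mu \<gamma> (Suc l)" "Zc mu \<gamma> (Suc l) \<le> Chi * Zc mu \<gamma> l"
    by (simp_all add: Zc_def)
qed

lemma sum_greaterThanAtMost_Suc: "(\<Sum>q\<in>{Suc p<..Suc n}. h q) = (\<Sum>q\<in>{p<..n}. h (Suc q))"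
  by (rule sum.reindex_bij_witness[where i=Suc and j="\<lambda>l. l - 1"]) auto

theorem theorem3p1:
  fixes mu :: "'a measure" and \<gamma> :: "nat \<Rightarrow> 'a \<Rightarrow> real" and M :: "nat \<Rightarrow> 'a \<Rightarrow> 'a measure"
    and Clo Chi \<rho> :: real
  assumes fin: "finite_measure mu"
    and integ: "\<And>l. integrable mu (\<gamma> l)"
    and gpos: "\<And>l u. u \<in> space mu \<Longrightarrow> \<gamma> l u > 0"
    and Zpos: "\<And>l. Zc mu \<gamma> l > 0"
    and kern: "\<And>l. l \<ge> 1 \<Longrightarrow> M l \<in> mu \<rightarrow>\<^sub>M prob_algebra mu"
    and inv: "\<And>l. l \<ge> 1 \<Longrightarrow> eta mu \<gamma> l \<bind> M l = eta mu \<gamma> l"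
    and A1: "0 < Clo" "Clo < Chi"
      "\<And>l u. l \<ge> 1 \<Longrightarrow> u \<in> space mu \<Longrightarrow> Clo \<le> Gw \<gamma> l u \<and> Gw \<gamma> l u \<le> Chi"
    and A2: "0 < \<rho>" "\<rho> < 1"
      "\<And>l u v A. l \<ge> 1 \<Longrightarrow> u \<in> space mu \<Longrightarrow> v \<in> space mu \<Longrightarrow> A \<in> sets mu \<Longrightarrow>
         emeasure (M l u) A \<ge> ennreal \<rho> * emeasure (M l v) A"
  shows "\<exists>C \<kappa>::real. 0 < \<kappa> \<and> \<kappa> < 1 \<and>
    (\<forall>L N g. L \<ge> 1 \<longrightarrow> (\<forall>l. l + 1 < L \<longrightarrow> N (l + 1) \<le> N l) \<longrightarrow> N (L - 1) \<ge> 1 \<longrightarrow>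
       g \<in> borel_measurable mu \<longrightarrow> supnorm mu g = 1 \<longrightarrow>
       (\<integral>\<^sup>+ U. ennreal ((Yhat \<gamma> N L g U - (\<integral>u. g u \<partial>eta mu \<gamma> L))\<^sup>2) \<partial>particle_law mu \<gamma> M N (L - 1))
       \<le> ennreal C *
         (ennreal (1 / real (N 0))
          + (\<Sum>l\<in>{1..L}. (supnorm mu (\<lambda>u. Zc mu \<gamma> (l - 1) / Zc mu \<gamma> l * Gw \<gamma> (l - 1) u - 1))\<^sup>2
                          * ennreal (1 / real (N (l - 1))))
          + (\<Sum>l\<in>{1..L}. \<Sum>q\<in>{l<..L}.
               supnorm mu (\<lambda>u. Zc mu \<gamma> (l - 1) / Zc mu \<gamma> l * Gw \<gamma> (l - 1) u - 1)
               * supnorm mu (\<lambda>u. Zc mu \<gamma> (q - 1) / Zc mu \<gamma> q * Gw \<gamma> (q - 1) u - 1)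
               * ennreal (\<kappa> ^ (q - l) / real (N (l - 1))
                          + 1 / (sqrt (real (N (l - 1))) * real (N (q - 1)))))))"
proof -
  define sn where "sn l = supnorm mu (\<lambda>u. Zc mu \<gamma> (l - 1) / Zc mu \<gamma> l * Gw \<gamma> (l - 1) u - 1)" for l
  \<comment> \<open>Downward induction from the last level, where positivity is assumed.\<close>
  have N_ge: "N l \<ge> 1" if "\<forall>l. l + 1 < L \<longrightarrow> N (l + 1) \<le> N l" "N (L - 1) \<ge> 1" "l < L" for N :: "nat \<Rightarrow> nat" and L l
  proof -
    have "l \<le> L - 1" using that(3) by simp
    then show ?thesis
    proof (induction l rule: inc_induct)
      case (step n)
      then have "N (n + 1) \<le> N n" using that(1) by simp
      then show ?case using step by simp
    qed (rule that(2))
  qed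
  show ?thesis
  proof (cases "sn 1 = \<top>")
    case True
    \<comment> \<open>The first summand alone is infinite because \<open>N 0\<close> is positive;
      \<open>r\<close> stands for the double sum.\<close>
    have "(\<integral>\<^sup>+ U. ennreal ((Yhat \<gamma> N L g U - (\<integral>u. g u \<partial>eta mu \<gamma> L))\<^sup>2) \<partial>particle_law mu \<gamma> M N (L - 1))
        \<le> ennreal 1 * (ennreal (1 / real (N 0)) + (\<Sum>l\<in>{1..L}. (sn l)\<^sup>2 * ennreal (1 / real (N (l - 1)))) + r)"
      if L: "L \<ge> 1" and N: "\<forall>l. l + 1 < L \<longrightarrow> N (l + 1) \<le> N l" "N (L - 1) \<ge> 1" for L N g r
    proof -
      have N0: "N 0 \<ge> 1" using N_ge[OF N, of 0] L by simp
      have "(sn 1)\<^sup>2 * ennreal (1 / real (N (1 - 1))) = \<top>"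
        unfolding True using N0 by (simp add: ennreal_top_mult)
      moreover have "(sn 1)\<^sup>2 * ennreal (1 / real (N (1 - 1)))
          \<le> (\<Sum>l\<in>{1..L}. (sn l)\<^sup>2 * ennreal (1 / real (N (l - 1))))"
        using L by (intro member_le_sum) simp_all
      ultimately have "(\<Sum>l\<in>{1..L}. (sn l)\<^sup>2 * ennreal (1 / real (N (l - 1)))) = \<top>"
        by (simp only: top_unique)
      then show ?thesis by (simp only:) simp
    qed
    \<comment> \<open>Against an infinite bound any positive \<open>C\<close> and any
      \<open>\<kappa>\<close> in the open unit interval will do.\<close>
    then show ?thesis unfolding sn_def by (intro exI[of _ 1] exI[of _ "1/2"]) simp
  next
    case False
    define b0 where "b0 = enn2real (sn 1)"
    \<comment> \<open>From level 1 on, (A1) places the normalised weight between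
      \<open>Clo / Chi\<close> and \<open>Chi / Clo\<close>; at level 0 it exceeds 1 by at most
      \<open>b0\<close>.\<close>
    define K where "K = max (Chi / Clo) (1 + b0)"
    have K1: "K \<ge> 1" and K2: "K \<ge> Chi / Clo" "K \<ge> 1 + b0"
      using A1(1,2) unfolding K_def by (simp_all add: le_max_iff_disj b0_def)
    have W: "1 / K \<le> Zc mu \<gamma> l / Zc mu \<gamma> (Suc l) * Gw \<gamma> l u \<and> Zc mu \<gamma> l / Zc mu \<gamma> (Suc l) * Gw \<gamma> l u \<le> K"
      if l: "l \<ge> 1" and u: "u \<in> space mu" for l u
    proof -
      define z where "z = Zc mu \<gamma> l / Zc mu \<gamma> (Suc l)"
      note zb = Zc_Suc_bounds[OF integ gpos A1(3)[OF l]]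
      have z: "1 / Chi \<le> z" "z \<le> 1 / Clo"
        using zb Zpos[of l] Zpos[of "Suc l"] A1(1,2) unfolding z_def
        by (simp_all add: pos_le_divide_eq pos_divide_le_eq mult.commute)
      have G: "Clo \<le> Gw \<gamma> l u" "Gw \<gamma> l u \<le> Chi" using A1(3)[OF l u] by auto
      have "0 < 1 / Chi" using A1(1,2) by simp
      then have z0: "0 \<le> z" using z(1) by linarith
      have "1 / Chi * Clo \<le> z * Gw \<gamma> l u" using z(1) G(1) z0 less_imp_le[OF A1(1)] by (rule mult_mono)
      moreover have "1 / K \<le> 1 / (Chi / Clo)" using K2(1) A1(1,2) K1 by (intro frac_le) simp_all
      moreover have "z * Gw \<gamma> l u \<le> 1 / Clo * Chi"
        using z(2) G(2) by (rule mult_mono) (use A1(1) G(1) in simp_all)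
      ultimately show ?thesis using K2(1) unfolding z_def[symmetric] by simp
    qed
    have W0: "Zc mu \<gamma> 0 / Zc mu \<gamma> (Suc 0) * Gw \<gamma> 0 u \<le> K" if "u \<in> space mu" for u
      using supnorm_bound[OF False[unfolded sn_def] that] K2(2) unfolding b0_def sn_def by simp
    interpret smc mu \<gamma> M K \<rho>
    proof
      show "Zc mu \<gamma> l / Zc mu \<gamma> (Suc l) * Gw \<gamma> l u \<le> K" if "u \<in> space mu" for l u
        using W[OF _ that, of l] W0[OF that] by (cases l) auto
    qed (use assms K1 W in auto)
    have sn_W: "sn (Suc p) = supnorm mu (\<lambda>u. W p u - 1)" for p
      unfolding sn_def W_def by simp
    have "supnorm mu (\<lambda>u. W p u - 1) \<le> ennreal (K + 1)" for p
      unfolding supnorm_def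
    proof (rule SUP_least)
      fix u assume "u \<in> space mu"
      then show "ennreal \<bar>W p u - 1\<bar> \<le> ennreal (K + 1)"
        using W_le[of u p] W_pos[of u p] K1 by (intro ennreal_leI) linarith
    qed
    then have sn_fin: "sn (Suc p) \<noteq> \<top>" for p
      unfolding sn_W by (metis ennreal_neq_top top_unique)
    \<comment> \<open>Weights bounded by \<open>K\<close> have finite sup norms, which can then
      serve as the real bounds \<open>b\<close> of the previous part.\<close>
    define bb where "bb p = enn2real (sn (Suc p))" for p
    have bb: "\<bar>W p u - 1\<bar> \<le> bb p" if "u \<in> space mu" for p u
      unfolding bb_def sn_W using sn_fin[of p] that by (intro supnorm_bound) (simp_all add: sn_W)
    have sn_bb: "sn (Suc p) = ennreal (bb p)" for p
      unfolding bb_def using sn_fin[of p] by (simp add: top.not_eq_extremum)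
    \<comment> \<open>Outside its locale \<open>C2\<close> has only the parameters \<open>K\<close>
      and \<open>\<rho>\<close>, and \<open>\<kappa>\<close> depends on \<open>\<rho>\<close> alone,
      so both constants are fixed before \<open>L\<close>, \<open>N\<close> and
      \<open>g\<close>.\<close>
    have main: "(\<integral>\<^sup>+ U. ennreal ((Yhat \<gamma> N L g U - (\<integral>u. g u \<partial>eta mu \<gamma> L))\<^sup>2) \<partial>particle_law mu \<gamma> M N (L - 1))
       \<le> ennreal (smc_run.C2 K \<rho>) *
         (ennreal (1 / real (N 0))
          + (\<Sum>l\<in>{1..L}. (sn l)\<^sup>2 * ennreal (1 / real (N (l - 1))))
          + (\<Sum>l\<in>{1..L}. \<Sum>q\<in>{l<..L}. sn l * sn q
               * ennreal (\<kappa> ^ (q - l) / real (N (l - 1)) + 1 / (sqrt (real (N (l - 1))) * real (N (q - 1))))))"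
      if L: "L \<ge> 1" and N: "\<forall>l. l + 1 < L \<longrightarrow> N (l + 1) \<le> N l" "N (L - 1) \<ge> 1"
        and g: "g \<in> borel_measurable mu" "supnorm mu g = 1" for L N g
    proof -
      obtain T where T: "L = Suc T" using L by (cases L) auto
      interpret smc_run mu \<gamma> M K \<rho> N T
      proof
        show "0 < N l" if "l \<le> T" for l using N_ge[OF N, of l] that T by simp
        show "N (Suc l) \<le> N l" if "l < T" for l using N(1) that T by simp
      qed
      have g1: "\<bar>g u\<bar> \<le> 1" if "u \<in> space mu" for u
        using supnorm_bound[of mu g u] g(2) that by simp
      have gb: "g \<in> bmf mu" using g(1) g1 by (rule bmfI)
      show ?thesis
        using mse_bound_ennreal[OF gb g1 bb]
        unfolding T One_nat_def sum.atLeast_Suc_atMost_Suc_shift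
        by (simp add: sn_bb atLeast0AtMost sum_greaterThanAtMost_Suc)
    qed
    show ?thesis
      using main kappa unfolding sn_def by (intro exI[of _ "smc_run.C2 K \<rho>"] exI[of _ \<kappa>]) blast
  qed
qed

end
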